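(* Let $\xi$ be a random variable with values in $\{0,1,2,\dots\}$ such that $\mathbb{E}\xi=1$, $0<\operatorname{Var}\xi<\infty$, and $\mathbb{E}e^{t\xi}<\infty$ for some $t>0$. Let $\Phi(z):=\mathbb{E}z^{\xi}$ be its probability generating function, with radius of convergence $R_\Phi\le\infty$, and assume that $\Phi'(R_\Phi):=\lim_{z\nearrow R_\Phi}\Phi'(z)=\infty$. Let $\mathcal{T}_n$ be the conditioned Galton--Watson tree of order $n$ with offspring distribution $\xi$, and let $R(T)$ denote the number of root subtrees of a rooted tree $T$. Then there exist sequences of numbers $\gamma_m>0$ ($m\ge1$) and $1<\tau_1<\tau_2<\cdots$ such that for any fixed $m\ge1$, as $n\to\infty$, $$\mathbb{E}\,R(\mathcal{T}_n)^m=\bigl(1+O(n^{-1})\bigr)\gamma_m\tau_m^n .$$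
   Context: All trees are rooted, ordered and finite; $|T|$ is the number of nodes of $T$. A root subtree of $T$ is a connected subset of the node set of $T$ that contains the root of $T$; $R(T)$ is the number of root subtrees of $T$. A Galton--Watson tree $\mathcal{T}$ with offspring distribution $\xi$ is the random tree in which each node independently has a number of children distributed as $\xi$; the conditioned Galton--Watson tree $\mathcal{T}_n$ is $\mathcal{T}$ conditioned on $|\mathcal{T}|=n$. Only those $n$ with $\mathbb{P}(|\mathcal{T}|=n)>0$ are considered. *)

theory Defs
  imports "HOL-Probability.Probability" "HOL-Library.Landau_Symbols"
begin

(* Ulam-Harris encoding: a node of a rooted ordered tree is the word of child indices leading
   to it from the root [], so v @ [i] is the i-th child (counted from 0) of v; a tree is
   identified with its set of nodes. *)

type_synonym node = "nat list"

(* The tree in which each node v has exactly c v children. *)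
inductive_set tree_of :: "(node \<Rightarrow> nat) \<Rightarrow> node set" for c :: "node \<Rightarrow> nat" where
  root: "[] \<in> tree_of c"
| child: "v \<in> tree_of c \<Longrightarrow> i < c v \<Longrightarrow> v @ [i] \<in> tree_of c"

definition adjacent :: "node \<Rightarrow> node \<Rightarrow> bool" where
  "adjacent u v \<longleftrightarrow> (\<exists>i. v = u @ [i] \<or> u = v @ [i])"

(* Any two elements of S are joined by a path of tree edges that stays inside S. *)
definition connected_nodes :: "node set \<Rightarrow> bool" where
  "connected_nodes S \<longleftrightarrow>
     (\<forall>u\<in>S. \<forall>v\<in>S. (u, v) \<in> {(a, b). a \<in> S \<and> b \<in> S \<and> adjacent a b}\<^sup>*)"

definition root_subtrees :: "node set \<Rightarrow> node set set" where
  "root_subtrees T = {S. S \<subseteq> T \<and> [] \<in> S \<and> connected_nodes S}"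

definition num_root_subtrees :: "node set \<Rightarrow> nat" where
  "num_root_subtrees T = card (root_subtrees T)"

(* Independent offspring numbers with distribution \<xi>, one for each potential node. The
   Galton-Watson tree is the random variable tree_of on this space. *)
definition gw_space :: "nat pmf \<Rightarrow> (node \<Rightarrow> nat) measure" where
  "gw_space \<xi> = (\<Pi>\<^sub>M v\<in>UNIV. measure_pmf \<xi>)"

(* Finiteness is required explicitly because card is 0 on infinite sets. *)
definition gw_size :: "nat pmf \<Rightarrow> nat \<Rightarrow> (node \<Rightarrow> nat) set" where
  "gw_size \<xi> n = {\<omega> \<in> space (gw_space \<xi>). finite (tree_of \<omega>) \<and> card (tree_of \<omega>) = n}"

(* tree_of on this space is the conditioned Galton-Watson tree of order n;
   meaningful for n in gw_orders. *)
definition cond_gw_space :: "nat pmf \<Rightarrow> nat \<Rightarrow> (node \<Rightarrow> nat) measure" where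
  "cond_gw_space \<xi> n = uniform_measure (gw_space \<xi>) (gw_size \<xi> n)"

definition gw_orders :: "nat pmf \<Rightarrow> nat set" where
  "gw_orders \<xi> = {n. measure (gw_space \<xi>) (gw_size \<xi> n) > 0}"

definition pgf :: "nat pmf \<Rightarrow> real \<Rightarrow> real" where
  "pgf \<xi> z = measure_pmf.expectation \<xi> (\<lambda>k. z ^ k)"

definition pgf_radius :: "nat pmf \<Rightarrow> ereal" where
  "pgf_radius \<xi> = conv_radius (pmf \<xi>)"

lemma tree_of_snoc_iff: "v @ [i] \<in> tree_of c \<longleftrightarrow> v \<in> tree_of c \<and> i < c v"
  by (auto intro: tree_of.child elim: tree_of.cases)

lemma gw_size_measurable: "gw_size \<xi> n \<in> sets (gw_space \<xi>)"
proof -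
  let ?M = "gw_space \<xi>"
  have coord: "(\<lambda>\<omega>. \<omega> v) \<in> measurable ?M (count_space UNIV)" for v
    unfolding gw_space_def
    using measurable_component_singleton[of v UNIV "\<lambda>_. measure_pmf \<xi>"]
    by (simp cong: measurable_cong_sets)
  have node: "Measurable.pred ?M (\<lambda>\<omega>. v \<in> tree_of \<omega>)" for v
  proof (induction v rule: rev_induct)
    case Nil
    then show ?case by (simp add: tree_of.root)
  next
    case (snoc i v)
    note coord[of v, measurable] snoc[measurable]
    show ?case unfolding tree_of_snoc_iff by measurable
  qed
  have tree: "{\<omega> \<in> space ?M. tree_of \<omega> = t} \<in> sets ?M" for t
  proof -
    note node[measurable]
    have "Measurable.pred ?M (\<lambda>\<omega>. \<forall>v. (v \<in> tree_of \<omega>) = (v \<in> t))" by measurable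
    then show ?thesis by (simp add: pred_def set_eq_iff)
  qed
  have eq: "gw_size \<xi> n =
      (\<Union>t\<in>{t. finite t \<and> card t = n}. {\<omega> \<in> space ?M. tree_of \<omega> = t})"
    by (auto simp: gw_size_def)
  have "countable {t :: node set. finite t \<and> card t = n}"
    by (rule countable_subset[OF _ countable_Collect_finite]) auto
  then show ?thesis unfolding eq using tree by (intro sets.countable_UN') auto
qed

end

theory Submission
  imports Defs "HOL-Complex_Analysis.Complex_Analysis"
begin

text \<open>
Since \<open>R(T)\<close> is the product of \<open>1 + R(T')\<close> over the branches \<open>T'\<close> at the root, the generating function
\<open>F m z = E (R(T) ^ m z ^ |T|)\<close> satisfies \<open>F m = z \<Phi> (Y m)\<close>, where \<open>Y m = E ((1 + R(T)) ^ m z ^ |T|)\<close> is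
\<open>F m + g m\<close> and \<open>g m\<close> only involves lower moments. Let \<open>\<rho> m\<close> be the radius of convergence of \<open>F m\<close>.
As \<open>\<Phi>'\<close> is unbounded at its radius of convergence, \<open>Y m (\<rho> m)\<close> is finite and lies inside the disc of
convergence of \<open>\<Phi>\<close>; a supersolution argument gives \<open>\<rho> m \<Phi>' (Y m (\<rho> m)) = 1\<close> by induction on \<open>m\<close>, and
\<open>Y m < Y (m + 1)\<close> then forces \<open>\<rho> (m + 1) < \<rho> m\<close>. Hence \<open>F m\<close> has a square root singularity at \<open>\<rho> m\<close>,
and its coefficients are a constant times \<open>\<rho> m ^ (-n)\<close> times those of \<open>sqrt (1 - z)\<close>, up to a factor
\<open>1 + O(1/n)\<close>. Dividing by the case \<open>m = 0\<close> gives the theorem with \<open>\<tau> m = \<rho> 0 / \<rho> m\<close>.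
\<close>

text \<open>The delicate point is that \<open>g m\<close> must be analytic beyond \<rho> m. Its
  coefficients are controlled only by those of \<open>F (m - 1)\<close>, that is, up to \<rho> (m -
  1), so the strict decrease of the radii is a tool for the next level and not merely a result.
  Convergence itself is unknown at first; sums over trees are therefore taken in [0, infinity],
  where the functional equation always holds and its tree solution lies below every supersolution.
  Any supersolution is thus a proof of convergence. Steepness of \<Phi> keeps the value of
  \<open>Y m\<close> at \<rho> m away from the singularity of \<Phi> itself, which could otherwise
  be met before the derivative reaches its critical value. The relative error is 1/n and not
  n^(-1/2) because even powers of sqrt (1 - z) are polynomials: the first correction that counts is
  the cube. A periodic offspring law produces several singularities of equal modulus; on the
  admissible orders they all contribute the same amount. For m = 0 the coefficients are the
  probabilities of |T| = n, which supply the normalisation of the conditioned tree.\<close>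

section \<open>Holomorphic implicit functions\<close>

text \<open>Newton's iteration with the derivative frozen at the centre is a contraction; its
  iterates are holomorphic in \<open>x\<close> and converge uniformly, so the fixed point is
  holomorphic too. In place of joint holomorphy of \<open>K\<close> stands \<open>comp\<close>,
  stability under substitution of holomorphic functions, which is what the iterates require. The
  lemma serves twice: for the value of the series near a regular point, and for the argument as a
  function of that value near the singular point.\<close>

lemma holomorphic_implicit_function:
  fixes K K' :: "complex \<Rightarrow> complex \<Rightarrow> complex"
  assumes r: "r > 0"
    and der: "\<And>x v. x \<in> ball x0 r \<Longrightarrow> v \<in> ball v0 r \<Longrightarrow> (K x has_field_derivative K' x v) (at v)"
    and cont: "isCont (\<lambda>(x, v). K' x v) (x0, v0)"
    and nz: "K' x0 v0 \<noteq> 0"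
    and contK: "isCont (\<lambda>x. K x v0) x0"
    and K0: "K x0 v0 = 0"
    and comp: "\<And>h S. open S \<Longrightarrow> S \<subseteq> ball x0 r \<Longrightarrow> h holomorphic_on S \<Longrightarrow> h ` S \<subseteq> ball v0 r
                 \<Longrightarrow> (\<lambda>x. K x (h x)) holomorphic_on S"
  obtains \<delta> \<epsilon> h where "\<delta> > 0" "\<delta> \<le> r" "\<epsilon> > 0" "\<epsilon> \<le> r" "h holomorphic_on ball x0 \<delta>" "h x0 = v0"
    "\<And>x. x \<in> ball x0 \<delta> \<Longrightarrow> h x \<in> ball v0 \<epsilon>"
    "\<And>x v. x \<in> ball x0 \<delta> \<Longrightarrow> v \<in> ball v0 \<epsilon> \<Longrightarrow> K x v = 0 \<longleftrightarrow> v = h x"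
proof -
  define A where "A = K' x0 v0"
  have A: "norm A > 0" using nz by (simp add: A_def)
  obtain e0 where e0: "e0 > 0" "\<And>p. dist p (x0, v0) < e0 \<Longrightarrow> dist ((\<lambda>(x, v). K' x v) p) A < norm A / 2"
    using cont A unfolding continuous_at_eps_delta A_def by (metis case_prod_conv half_gt_zero)
  define e where "e = min r (e0 / 2)"
  have e: "e > 0" "e \<le> r" using r e0 by (auto simp: e_def)
  have K'A: "norm (K' x v - A) \<le> norm A / 2" if "x \<in> ball x0 e" "v \<in> ball v0 e" for x v
  proof -
    have "dist (x, v) (x0, v0) \<le> dist x x0 + dist v v0"
      unfolding dist_Pair_Pair by (rule sqrt_sum_squares_le_sum) auto
    also have "\<dots> < e0" using that by (auto simp: e_def dist_commute)
    finally show ?thesis using e0(2)[of "(x, v)"] by (auto simp: dist_norm)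
  qed
  define \<epsilon> where "\<epsilon> = e / 2"
  have \<epsilon>: "\<epsilon> > 0" "\<epsilon> < e" using e by (auto simp: \<epsilon>_def)
  \<comment> \<open>The 1/4 leaves room: a step started at \<open>v0\<close> moves by less than
    \<open>\<epsilon>\<close> / 4 and the contraction adds at most \<open>\<epsilon>\<close> / 2, so
    \<open>T x\<close> maps the closed ball into the open one.\<close>
  obtain d0 where d0: "d0 > 0" "\<And>x. dist x x0 < d0 \<Longrightarrow> dist (K x v0) 0 < norm A * \<epsilon> / 4"
    using contK A \<epsilon> K0 unfolding continuous_at_eps_delta
    by (metis (no_types, lifting) divide_pos_pos mult_pos_pos zero_less_numeral)
  define \<delta> where "\<delta> = min e d0"
  have \<delta>: "\<delta> > 0" "\<delta> \<le> e" using e d0 by (auto simp: \<delta>_def)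
  define T where "T x v = v - K x v / A" for x v
  have T_contr: "norm (T x v - T x v') \<le> 1/2 * norm (v - v')"
    if x: "x \<in> ball x0 e" and "v \<in> ball v0 e" "v' \<in> ball v0 e" for x v v'
  proof (rule field_differentiable_bound[of "ball v0 e"])
    fix u assume u: "u \<in> ball v0 e"
    have "(T x has_field_derivative 1 - K' x u / A) (at u)"
      unfolding T_def using x u e
      by (intro DERIV_diff DERIV_ident DERIV_cdivide der) auto
    then show "(T x has_field_derivative 1 - K' x u / A) (at u within ball v0 e)"
      by (rule has_field_derivative_at_within)
    have "1 - K' x u / A = (A - K' x u) / A" using A by (simp add: field_simps)
    then have eq: "norm (1 - K' x u / A) = norm (K' x u - A) / norm A"
      by (metis norm_divide norm_minus_commute)
    show "norm (1 - K' x u / A) \<le> 1/2"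
      unfolding eq using K'A[OF x u] A by (simp add: divide_le_eq)
  qed (use that in auto)
  have cb: "cball v0 \<epsilon> \<subseteq> ball v0 e" using \<epsilon> by auto
  have T0: "norm (T x v0 - v0) < \<epsilon> / 4" if "x \<in> ball x0 \<delta>" for x
    using d0(2)[of x] that A by (simp add: T_def \<delta>_def norm_divide field_simps dist_commute)
  have T_ball: "T x v \<in> ball v0 \<epsilon>" if "x \<in> ball x0 \<delta>" "v \<in> cball v0 \<epsilon>" for x v
  proof -
    have "norm (T x v - T x v0) \<le> 1/2 * norm (v - v0)"
      using that cb \<delta> e by (intro T_contr) auto
    also have "\<dots> \<le> \<epsilon> / 2" using that by (simp add: dist_norm norm_minus_commute)
    finally have "norm (T x v - T x v0) + norm (T x v0 - v0) < \<epsilon>"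
      using T0[OF that(1)] \<epsilon> by linarith
    then have "norm (T x v - v0) < \<epsilon>"
      by (smt (verit) norm_triangle_ineq add_diff_eq diff_add_cancel)
    then show ?thesis by (simp add: dist_norm norm_minus_commute)
  qed
  have ex1: "\<exists>!v. v \<in> cball v0 \<epsilon> \<and> T x v = v" if x: "x \<in> ball x0 \<delta>" for x
  proof -
    have "\<exists>!v\<in>cball v0 \<epsilon>. T x v = v"
    proof (rule Banach_fix[OF compact_imp_complete[OF compact_cball], where c = "1/2"])
      show "T x ` cball v0 \<epsilon> \<subseteq> cball v0 \<epsilon>" using T_ball[OF x] by force
      show "dist (T x u) (T x w) \<le> 1/2 * dist u w" if "u \<in> cball v0 \<epsilon>" "w \<in> cball v0 \<epsilon>" for u w
        using T_contr[of x u w] subsetD[OF cb that(1)] subsetD[OF cb that(2)] x \<delta>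
        by (auto simp: dist_norm)
    qed (use \<epsilon> in auto)
    then show ?thesis by blast
  qed
  define h where "h x = (THE v. v \<in> cball v0 \<epsilon> \<and> T x v = v)" for x
  have h: "h x \<in> cball v0 \<epsilon>" "T x (h x) = h x" if "x \<in> ball x0 \<delta>" for x
    using theI'[OF ex1[OF that]] unfolding h_def by auto
  have h_ball: "h x \<in> ball v0 \<epsilon>" if "x \<in> ball x0 \<delta>" for x
    using T_ball[OF that h(1)[OF that]] h(2)[OF that] by simp
  have K_iff: "K x v = 0 \<longleftrightarrow> v = h x" if "x \<in> ball x0 \<delta>" "v \<in> ball v0 \<epsilon>" for x v
  proof -
    have "K x v = 0 \<longleftrightarrow> T x v = v" using A by (auto simp: T_def)
    also have "\<dots> \<longleftrightarrow> v = h x"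
      using ex1[OF that(1)] h[OF that(1)] that(2) by (metis ball_subset_cball subsetD)
    finally show ?thesis .
  qed
  define hn where "hn n x = (T x ^^ n) v0" for n x
  have hn_cball: "hn n x \<in> cball v0 \<epsilon>" if "x \<in> ball x0 \<delta>" for n x
  proof (induction n)
    case 0 show ?case using \<epsilon> by (simp add: hn_def)
  next
    case (Suc n) then show ?case using T_ball[OF that] by (force simp: hn_def)
  qed
  have hn_hol: "hn n holomorphic_on ball x0 \<delta>" for n
  proof (induction n)
    case 0 show ?case by (simp add: hn_def)
  next
    case (Suc n)
    have "(\<lambda>x. K x (hn n x)) holomorphic_on ball x0 \<delta>"
      using hn_cball[of _ n] \<epsilon> e \<delta> by (intro comp Suc) (force simp: image_subset_iff)+
    then have "(\<lambda>x. hn n x - K x (hn n x) / A) holomorphic_on ball x0 \<delta>"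
      using A by (intro holomorphic_intros Suc) auto
    then show ?case by (simp add: hn_def T_def)
  qed
  have hn_lim: "norm (hn n x - h x) \<le> (1/2)^n * \<epsilon>" if x: "x \<in> ball x0 \<delta>" for n x
  proof (induction n)
    case 0 show ?case using h(1)[OF x] by (simp add: hn_def dist_norm)
  next
    case (Suc n)
    have "norm (hn (Suc n) x - h x) = norm (T x (hn n x) - T x (h x))"
      using h(2)[OF x] by (simp add: hn_def)
    also have "\<dots> \<le> 1/2 * norm (hn n x - h x)"
      using x \<delta> hn_cball[OF x, of n] h(1)[OF x] \<epsilon> by (intro T_contr) auto
    finally show ?case using Suc by simp
  qed
  have "h holomorphic_on ball x0 \<delta>"
  proof (rule holomorphic_uniform_sequence[OF _ hn_hol])
    fix x assume "x \<in> ball x0 \<delta>"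
    then obtain d where d: "d > 0" "cball x d \<subseteq> ball x0 \<delta>"
      using open_contains_cball open_ball by blast
    have lim: "(\<lambda>n. (1/2)^n * \<epsilon>) \<longlonglongrightarrow> 0" by (auto intro!: tendsto_eq_intros LIMSEQ_realpow_zero)
    have "uniform_limit (cball x d) hn h sequentially"
      unfolding uniform_limit_iff
    proof (intro allI impI)
      fix e :: real assume "e > 0"
      with lim have "\<forall>\<^sub>F n in sequentially. (1/2)^n * \<epsilon> < e" by (rule order_tendstoD)
      then show "\<forall>\<^sub>F n in sequentially. \<forall>y\<in>cball x d. dist (hn n y) (h y) < e"
      proof eventually_elim
        case (elim n)
        then show ?case using hn_lim[of _ n] d unfolding dist_norm by (meson le_less_trans subsetD)
      qed
    qed
    then show "\<exists>d>0. cball x d \<subseteq> ball x0 \<delta> \<and> uniform_limit (cball x d) hn h sequentially"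
      using d by blast
  qed auto
  moreover have "h x0 = v0"
    using K_iff[of x0 v0] K0 \<delta> \<epsilon> by auto
  ultimately show ?thesis
    using that[of \<delta> \<epsilon> h] \<delta> \<epsilon> e h_ball K_iff by auto
qed

section \<open>Power series with nonnegative coefficients\<close>

definition pseries :: "(nat \<Rightarrow> real) \<Rightarrow> complex \<Rightarrow> complex" where
  "pseries c z = (\<Sum>n. complex_of_real (c n) * z ^ n)"

lemma pseries_summable_norm:
  assumes "\<And>n. c n \<ge> 0" "summable (\<lambda>n. c n * r ^ n)" "norm z \<le> r"
  shows "summable (\<lambda>n. norm (complex_of_real (c n) * z ^ n))"
    "summable (\<lambda>n. complex_of_real (c n) * z ^ n)"
    "summable (\<lambda>n. c n * norm z ^ n)"
proof -
  show 1: "summable (\<lambda>n. c n * norm z ^ n)"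
    by (rule summable_comparison_test'[OF assms(2), of 0])
      (use assms in \<open>auto intro!: mult_left_mono power_mono simp: norm_mult\<close>)
  then show 2: "summable (\<lambda>n. norm (complex_of_real (c n) * z ^ n))"
    using assms(1) by (simp add: norm_mult norm_power)
  show "summable (\<lambda>n. complex_of_real (c n) * z ^ n)"
    using 2 by (rule summable_norm_cancel)
qed

lemma pseries_norm_le:
  assumes "\<And>n. c n \<ge> 0" "summable (\<lambda>n. c n * norm z ^ n)"
  shows "norm (pseries c z) \<le> (\<Sum>n. c n * norm z ^ n)"
  unfolding pseries_def
  using summable_norm[OF pseries_summable_norm(1)[OF assms order_refl]] assms(1)
  by (simp add: norm_mult norm_power)

lemma pseries_norm_le_total:
  assumes "\<And>n. c n \<ge> 0" "c sums s" "norm z \<le> 1"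
  shows "norm (pseries c z) \<le> s"
proof -
  have s1: "summable (\<lambda>n. c n * 1 ^ n)" using assms(2) by (simp add: sums_iff)
  have s: "summable (\<lambda>n. c n * norm z ^ n)"
    by (rule pseries_summable_norm[OF assms(1) s1 assms(3)])
  have "norm (pseries c z) \<le> (\<Sum>n. c n * norm z ^ n)"
    by (rule pseries_norm_le[OF assms(1) s])
  also have "\<dots> \<le> (\<Sum>n. c n * 1 ^ n)"
    by (intro suminf_le s s1 mult_left_mono power_mono assms(1)) (use assms(3) in auto)
  finally show ?thesis using assms(2) by (simp add: sums_iff)
qed

lemma pseries_of_real:
  assumes "summable (\<lambda>n. c n * x ^ n)"
  shows "pseries c (of_real x) = of_real (\<Sum>n. c n * x ^ n)"
  unfolding pseries_def using suminf_of_real[OF assms, where ?'a = complex] by simp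

lemma pseries_continuous_on:
  assumes "\<And>n. c n \<ge> 0" "summable (\<lambda>n. c n * r ^ n)"
  shows "continuous_on (cball 0 r) (pseries c)"
  unfolding pseries_def
proof (rule uniform_limit_theorem[OF _ Weierstrass_m_test])
  show "\<forall>\<^sub>F n in sequentially. continuous_on (cball 0 r)
      (\<lambda>z. \<Sum>i<n. complex_of_real (c i) * z ^ i)"
    by (intro always_eventually allI continuous_intros)
  show "norm (complex_of_real (c n) * z ^ n) \<le> c n * r ^ n" if "z \<in> cball 0 r" for n z
    using that assms(1) by (auto simp: norm_mult norm_power intro!: mult_left_mono power_mono)
qed (use assms in auto)

lemma pseries_has_field_derivative:
  assumes "\<And>n. c n \<ge> 0" "summable (\<lambda>n. c n * r ^ n)" "norm z < r"
  shows "(pseries c has_field_derivative pseries (diffs c) z) (at z)"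
proof -
  have r: "norm (complex_of_real r) = r"
    using le_less_trans[OF norm_ge_zero assms(3)] by simp
  have "((\<lambda>x. \<Sum>n. complex_of_real (c n) * x ^ n) has_field_derivative
          (\<Sum>n. diffs (\<lambda>n. complex_of_real (c n)) n * z ^ n)) (at z)"
    using pseries_summable_norm(2)[OF assms(1,2), of "of_real r"] assms(3) r
    by (intro termdiffs_strong[where K = "of_real r"]) auto
  then show ?thesis
    unfolding pseries_def[abs_def] diffs_def by simp
qed

lemma pseries_holomorphic:
  assumes "\<And>n. c n \<ge> 0" "summable (\<lambda>n. c n * r ^ n)"
  shows "pseries c holomorphic_on ball 0 r"
  unfolding holomorphic_on_open[OF open_ball]
  using pseries_has_field_derivative[OF assms] by (intro ballI exI) auto

lemma summable_diffs_smaller: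
  assumes "summable (\<lambda>n. c n * r ^ n)" "0 \<le> x" "x < (r::real)"
  shows "summable (\<lambda>n. diffs c n * x ^ n)"
  using assms
  by (intro termdiff_converges[where K = r])
    (auto intro!: powser_inside[where x = r] simp: abs_if split: if_splits)

lemma diffs_nonneg: "(\<And>n. c n \<ge> (0::real)) \<Longrightarrow> diffs c n \<ge> 0"
  by (simp add: diffs_def)

lemma pseries_strict_mono_real:
  assumes "\<And>n. c n \<ge> 0" "c i > 0" "i > 0" "0 \<le> x" "x < y" "summable (\<lambda>n. c n * y ^ n)"
  shows "(\<Sum>n. c n * x ^ n) < (\<Sum>n. c n * (y::real) ^ n)"
proof -
  have s: "summable (\<lambda>n. c n * x ^ n)"
    by (rule summable_comparison_test'[OF assms(6), of 0])
      (use assms in \<open>auto intro!: mult_left_mono power_mono\<close>)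
  have "0 < (\<Sum>n. c n * y ^ n - c n * x ^ n)"
  proof (rule suminf_pos2[where i = i])
    show "0 < c i * y ^ i - c i * x ^ i"
      using assms by (simp add: power_strict_mono)
  qed (use assms s in \<open>auto intro!: summable_diff mult_left_mono power_mono\<close>)
  then show ?thesis using suminf_diff[OF assms(6) s] by simp
qed

section \<open>Square root singularities of functional equations\<close>

lemma norm_less_of_ball: "z \<in> ball u r \<Longrightarrow> norm u + r \<le> s \<Longrightarrow> norm z < s"
  using norm_triangle_ineq[of "z - u" u] by (simp add: dist_norm norm_minus_commute)

text \<open>The singularity is normalised to lie at 1: \<open>a\<close> and \<open>b\<close> will be
  the coefficients of \<open>Y m\<close> and \<open>g m\<close> rescaled by \<rho> m, and
  \<open>p\<close> the offspring law times \<rho> m, so \<open>critical\<close> says \<rho> m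
  \<Phi>' = 1. The equation is required on (0, 1) only, where it comes from sums of nonnegative
  terms. \<open>a1\<close> and \<open>a_Suc\<close> reflect the one-node tree and the stars; they
  detect on the unit circle where the terms of the series fail to be aligned.\<close>

locale sqrt_singularity =
  fixes p a b :: "nat \<Rightarrow> real" and R0 R1 ys :: real
  assumes p_nonneg: "p k \<ge> 0" and a_nonneg: "a n \<ge> 0" and b_nonneg: "b n \<ge> 0"
    and p0: "p 0 > 0" and p_nonlinear: "\<exists>k\<ge>2. p k > 0"
    and a_sums: "a sums ys"
    and R1: "ys < R1" and p_summable: "summable (\<lambda>k. p k * R1 ^ k)"
    and R0: "1 < R0" and b_summable: "summable (\<lambda>n. b n * R0 ^ n)"
    and real_fun_eq: "0 < x \<Longrightarrow> x < 1 \<Longrightarrow>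
      (\<Sum>n. a n * x ^ n) = (\<Sum>n. b n * x ^ n) + x * (\<Sum>k. p k * (\<Sum>n. a n * x ^ n) ^ k)"
    and critical: "(\<Sum>k. diffs p k * ys ^ k) = 1"
    and a1: "a 1 > 0" and a_Suc: "p k > 0 \<Longrightarrow> a (Suc k) > 0"
begin

abbreviation "Y \<equiv> pseries a"
abbreviation "g \<equiv> pseries b"
abbreviation "\<Phi> \<equiv> pseries p"

lemma a_summable: "summable (\<lambda>n. a n * 1 ^ n)"
  using a_sums by (simp add: sums_iff)

lemma ys_pos: "ys > 0"
  using suminf_pos2[of a 1] a1 a_nonneg a_sums by (simp add: sums_iff)

lemma continuous_Y: "continuous_on (cball 0 1) Y"
  by (rule pseries_continuous_on[OF a_nonneg a_summable])

lemma norm_Y_le: "norm z \<le> 1 \<Longrightarrow> norm (Y z) \<le> ys"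
  by (rule pseries_norm_le_total[OF a_nonneg a_sums])

lemma \<Phi>_hol: "\<Phi> holomorphic_on ball 0 R1"
  by (rule pseries_holomorphic[OF p_nonneg p_summable])

lemma g_hol: "g holomorphic_on ball 0 R0"
  by (rule pseries_holomorphic[OF b_nonneg b_summable])

lemma Y_hol: "Y holomorphic_on ball 0 1"
  by (rule pseries_holomorphic[OF a_nonneg a_summable])

text \<open>The equation passes from the real interval to the disc by the identity theorem, with 0
  as accumulation point of (0, 1).\<close>

lemma fun_eq:
  assumes z: "norm z < 1" shows "Y z = g z + z * \<Phi> (Y z)"
proof -
  have g_hol1: "g holomorphic_on ball 0 1"
    using g_hol by (rule holomorphic_on_subset) (use R0 in auto)
  have \<Phi>Y_hol: "(\<lambda>z. \<Phi> (Y z)) holomorphic_on ball 0 1"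
  proof (rule holomorphic_on_compose_gen[OF Y_hol \<Phi>_hol, unfolded o_def], rule image_subsetI)
    fix z :: complex assume "z \<in> ball 0 1"
    then show "Y z \<in> ball 0 R1" using norm_Y_le[of z] R1 by simp
  qed
  have "Y z - (g z + z * \<Phi> (Y z)) = 0"
  proof (rule analytic_continuation[where f = "\<lambda>z. Y z - (g z + z * \<Phi> (Y z))" and S = "ball 0 1"
        and U = "of_real ` {0<..<1}" and \<xi> = 0])
    show "(\<lambda>z. Y z - (g z + z * \<Phi> (Y z))) holomorphic_on ball 0 1"
      by (intro holomorphic_intros Y_hol g_hol1 \<Phi>Y_hol)
    show "(0 :: complex) islimpt of_real ` {0<..<1}"
      unfolding islimpt_approachable
    proof (intro allI impI)
      fix e :: real assume "e > 0"
      then show "\<exists>x'\<in>complex_of_real ` {0<..<1}. x' \<noteq> 0 \<and> dist x' 0 < e"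
        by (intro bexI[of _ "of_real (min (e / 2) (1 / 2))"] imageI) (auto simp: min_def)
    qed
    fix w :: complex assume "w \<in> of_real ` {0<..<1}"
    then obtain x where x: "w = of_real x" "0 < x" "x < 1" by auto
    define A where "A = (\<Sum>n. a n * x ^ n)"
    have sa: "summable (\<lambda>n. a n * x ^ n)"
      using pseries_summable_norm(3)[OF a_nonneg a_summable, of "of_real x"] x by simp
    have sb: "summable (\<lambda>n. b n * x ^ n)"
      using pseries_summable_norm(3)[OF b_nonneg b_summable, of "of_real x"] x R0 by simp
    have Yw: "Y w = of_real A" unfolding x(1) A_def by (rule pseries_of_real[OF sa])
    have "norm (Y w) \<le> ys" using x by (intro norm_Y_le) simp
    then have "summable (\<lambda>k. p k * \<bar>A\<bar> ^ k)"
      using pseries_summable_norm(3)[OF p_nonneg p_summable, of "Y w"] R1 by (simp add: Yw)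
    moreover have "A \<ge> 0" unfolding A_def using sa a_nonneg x by (intro suminf_nonneg) auto
    ultimately have sp: "summable (\<lambda>k. p k * A ^ k)" by simp
    have "A = (\<Sum>n. b n * x ^ n) + x * (\<Sum>k. p k * A ^ k)"
      unfolding A_def by (rule real_fun_eq[OF x(2,3)])
    then have "complex_of_real A = g w + w * \<Phi> (of_real A)"
      unfolding x(1) pseries_of_real[OF sb] pseries_of_real[OF sp] by (simp flip: of_real_mult of_real_add)
    then show "Y w - (g w + w * \<Phi> (Y w)) = 0" unfolding Yw by simp
  qed (use z in auto)
  then show ?thesis by simp
qed

lemma Y_1: "Y 1 = of_real ys"
  using pseries_of_real[of a 1] a_summable a_sums by (simp add: sums_iff)

text \<open>Summability of \<open>a\<close> makes \<open>Y\<close> continuous up to the unit circle.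
  The boundary values are needed as base points for the implicit function theorem.\<close>

lemma fun_eq_cball: "norm z \<le> 1 \<Longrightarrow> Y z = g z + z * \<Phi> (Y z)"
proof -
  assume z: "norm z \<le> 1"
  have cg: "continuous_on (cball 0 1) g"
    using pseries_continuous_on[OF b_nonneg b_summable]
    by (rule continuous_on_subset) (use R0 in auto)
  have c\<Phi>: "continuous_on (cball 0 1) (\<lambda>z. \<Phi> (Y z))"
    by (rule continuous_on_compose2[OF pseries_continuous_on[OF p_nonneg p_summable] continuous_Y])
      (use norm_Y_le R1 in force)
  have "continuous_on (closure (ball 0 1)) (\<lambda>z. Y z - (g z + z * \<Phi> (Y z)))"
    by (simp, intro continuous_intros continuous_Y cg c\<Phi>)
  then have "Y z - (g z + z * \<Phi> (Y z)) = 0"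
    by (rule continuous_constant_on_closure[where S = "ball 0 1"])
      (use fun_eq z in \<open>auto\<close>)
  then show ?thesis by simp
qed

lemma \<Phi>_deriv: "norm w < R1 \<Longrightarrow> (\<Phi> has_field_derivative pseries (diffs p) w) (at w)"
  by (rule pseries_has_field_derivative[OF p_nonneg p_summable])

lemma g_deriv: "norm w < R0 \<Longrightarrow> (g has_field_derivative pseries (diffs b) w) (at w)"
  by (rule pseries_has_field_derivative[OF b_nonneg b_summable])

lemma dp_summable: "0 \<le> x \<Longrightarrow> x < R1 \<Longrightarrow> summable (\<lambda>k. diffs p k * x ^ k)"
  by (rule summable_diffs_smaller[OF p_summable])

lemma d\<Phi>_deriv:
  assumes "norm w < R1"
  shows "(pseries (diffs p) has_field_derivative pseries (diffs (diffs p)) w) (at w)"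
proof -
  obtain r where r: "norm w < r" "r < R1" using dense assms by blast
  show ?thesis
    by (rule pseries_has_field_derivative[OF diffs_nonneg[OF p_nonneg] dp_summable r(1)])
      (use r norm_ge_zero[of w] in linarith)+
qed

lemma dg_deriv:
  assumes "norm w < R0"
  shows "(pseries (diffs b) has_field_derivative pseries (diffs (diffs b)) w) (at w)"
proof -
  obtain r where r: "norm w < r" "r < R0" using dense assms by blast
  show ?thesis
    by (rule pseries_has_field_derivative[OF diffs_nonneg[OF b_nonneg]
          summable_diffs_smaller[OF b_summable] r(1)])
      (use r norm_ge_zero[of w] in linarith)+
qed

text \<open>\<Phi>' has nonnegative coefficients and, because of some k >= 2, a nonconstant term, so
  it stays strictly below its critical value 1. This excludes branching wherever |Y| < ys.\<close>

lemma norm_d\<Phi>_less_1: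
  assumes "norm w < ys"
  shows "norm (pseries (diffs p) w) < 1"
proof -
  obtain k where k: "k \<ge> 2" "p k > 0" using p_nonlinear by blast
  have "norm (pseries (diffs p) w) \<le> (\<Sum>k. diffs p k * norm w ^ k)"
    by (intro pseries_norm_le dp_summable diffs_nonneg p_nonneg) (use assms R1 in auto)
  also have "\<dots> < (\<Sum>k. diffs p k * ys ^ k)"
    by (rule pseries_strict_mono_real[where i = "k - 1"])
      (use k assms p_nonneg dp_summable ys_pos R1 in \<open>auto simp: diffs_def\<close>)
  finally show ?thesis by (simp add: critical)
qed

text \<open>Equality with \<open>ys\<close> would force all nonzero terms of the series at u to have
  the same argument. The terms of index 1 and k + 1 differ in direction by the factor u^k, so they
  alone already cause a strict loss.\<close>

lemma norm_Y_less:
  assumes u: "norm u = 1" and k: "p k > 0" "u ^ k \<noteq> 1"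
  shows "norm (Y u) < ys"
proof -
  have k0: "k \<noteq> 0" using k by (cases "k = 0") auto
  have s: "summable (\<lambda>n. complex_of_real (a n) * u ^ n)"
    using pseries_summable_norm[OF a_nonneg a_summable, of u] u by auto
  define c where "c n = (if n = 1 then 0 else if n = Suc k then 0 else a n)" for n
  have c: "c n \<ge> 0" for n using a_nonneg by (simp add: c_def)
  have fin: "(\<lambda>n. a n - c n) sums (a 1 + a (Suc k))"
    "(\<lambda>n. complex_of_real (a n - c n) * u ^ n) sums (of_real (a 1) * u + of_real (a (Suc k)) * u ^ Suc k)"
  proof -
    show "(\<lambda>n. a n - c n) sums (a 1 + a (Suc k))"
      using sums_finite[of "{1, Suc k}" "\<lambda>n. a n - c n"] k0 by (simp add: c_def)
    show "(\<lambda>n. complex_of_real (a n - c n) * u ^ n) sums (of_real (a 1) * u + of_real (a (Suc k)) * u ^ Suc k)"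
      using sums_finite[of "{1, Suc k}" "\<lambda>n. complex_of_real (a n - c n) * u ^ n"] k0 by (simp add: c_def)
  qed
  have cs: "c sums (ys - (a 1 + a (Suc k)))"
    using sums_diff[OF a_sums fin(1)] by simp
  have cu: "pseries c u = Y u - (of_real (a 1) * u + of_real (a (Suc k)) * u ^ Suc k)"
    using sums_diff[OF summable_sums[OF s] fin(2)] unfolding pseries_def
    by (simp add: sums_iff algebra_simps)
  have "norm (pseries c u) \<le> ys - (a 1 + a (Suc k))"
    using pseries_norm_le[of c u] c cs u by (simp add: sums_iff)
  moreover have "norm (of_real (a 1) * u + of_real (a (Suc k)) * u ^ Suc k) < a 1 + a (Suc k)"
  proof -
    have "of_real (a 1) * u + of_real (a (Suc k)) * u ^ Suc k = u * (of_real (a 1) + of_real (a (Suc k)) * u ^ k)"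
      by (simp add: algebra_simps)
    then have "norm (of_real (a 1) * u + of_real (a (Suc k)) * u ^ Suc k)
        = norm (of_real (a 1) + of_real (a (Suc k)) * u ^ k)"
      using u by (simp add: norm_mult)
    moreover have "norm (of_real (a 1) + of_real (a (Suc k)) * u ^ k) \<noteq> a 1 + a (Suc k)"
    proof
      assume eq: "norm (of_real (a 1) + of_real (a (Suc k)) * u ^ k) = a 1 + a (Suc k)"
      have a: "a 1 > 0" "a (Suc k) > 0" using a1 a_Suc k by auto
      then have n: "norm (complex_of_real (a 1)) = a 1" "norm (of_real (a (Suc k)) * u ^ k) = a (Suc k)"
        using u by (simp_all add: norm_mult norm_power)
      have "a 1 *\<^sub>R (of_real (a (Suc k)) * u ^ k) = a (Suc k) *\<^sub>R complex_of_real (a 1)"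
        using norm_triangle_eq[of "complex_of_real (a 1)" "of_real (a (Suc k)) * u ^ k"]
        unfolding n using eq by simp
      then have "u ^ k = 1" using a by (simp add: scaleR_conv_of_real)
      then show False using k by simp
    qed
    moreover have "norm (of_real (a 1) + of_real (a (Suc k)) * u ^ k) \<le> a 1 + a (Suc k)"
      using norm_triangle_ineq[of "of_real (a 1)" "of_real (a (Suc k)) * u ^ k"] u a_nonneg
      by (simp add: norm_mult norm_power)
    ultimately show ?thesis by linarith
  qed
  ultimately show ?thesis
    using norm_triangle_ineq[of "pseries c u" "of_real (a 1) * u + of_real (a (Suc k)) * u ^ Suc k"]
    unfolding cu by simp
qed

text \<open>The derivative of the equation in the value is u \<Phi>'(Y u) - 1, which is nonzero
  because |Y u| < ys; so Y continues analytically across u.\<close>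

lemma regular_point:
  assumes u: "norm u = 1" and k: "p k > 0" "u ^ k \<noteq> 1"
  obtains \<epsilon> h where "\<epsilon> > 0" "h holomorphic_on ball u \<epsilon>"
    "\<And>z. z \<in> ball u \<epsilon> \<inter> ball 0 1 \<Longrightarrow> Y z = h z"
proof -
  note Yu = norm_Y_less[OF assms]
  define r where "r = min (R0 - 1) (R1 - ys)"
  have r: "r > 0" using R0 R1 by (simp add: r_def)
  have zR0: "norm z < R0" if "z \<in> ball u r" for z
    by (rule norm_less_of_ball[of z u "R0 - 1"]) (use that u in \<open>auto simp: r_def\<close>)
  have vR1: "norm v < R1" if "v \<in> ball (Y u) r" for v
    by (rule norm_less_of_ball[of v "Y u" "R1 - ys"]) (use that Yu in \<open>auto simp: r_def\<close>)
  define K where "K z v = g z + z * \<Phi> v - v" for z v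
  define K' where "K' z v = z * pseries (diffs p) v - 1" for z v
  have "norm (u * pseries (diffs p) (Y u)) < 1"
    using norm_d\<Phi>_less_1[OF Yu] u by (simp add: norm_mult)
  then have nz: "K' u (Y u) \<noteq> 0" unfolding K'_def by auto
  have cont: "isCont (\<lambda>(z, v). K' z v) (u, Y u)"
  proof -
    have "isCont (\<lambda>x. pseries (diffs p) (snd x)) (u, Y u)"
      by (rule isCont_o2[where f = snd, OF isCont_snd[OF continuous_ident]])
        (use DERIV_isCont[OF d\<Phi>_deriv] vR1 r in auto)
    then show ?thesis unfolding K'_def case_prod_beta by (intro continuous_intros)
  qed
  obtain \<delta> \<epsilon> h where h: "\<delta> > 0" "\<delta> \<le> r" "\<epsilon> > 0" "\<epsilon> \<le> r" "h holomorphic_on ball u \<delta>"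
    "\<And>x v. x \<in> ball u \<delta> \<Longrightarrow> v \<in> ball (Y u) \<epsilon> \<Longrightarrow> K x v = 0 \<longleftrightarrow> v = h x"
  proof (rule holomorphic_implicit_function[of r u "Y u" K K', OF r _ cont nz])
    show "(K x has_field_derivative K' x v) (at v)" if "x \<in> ball u r" "v \<in> ball (Y u) r" for x v
      unfolding K_def[abs_def] K'_def using vR1[OF that(2)]
      by (auto intro!: derivative_eq_intros \<Phi>_deriv)
    show "isCont (\<lambda>x. K x (Y u)) u"
      unfolding K_def using DERIV_isCont[OF g_deriv[OF zR0]] r by (intro continuous_intros) auto
    show "K u (Y u) = 0" using fun_eq_cball[of u] u by (simp add: K_def)
    show "(\<lambda>x. K x (h x)) holomorphic_on S"
      if "open S" "S \<subseteq> ball u r" "h holomorphic_on S" "h ` S \<subseteq> ball (Y u) r" for h S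
      unfolding K_def using that zR0 vR1
      by (intro holomorphic_intros holomorphic_on_subset[OF g_hol]
          holomorphic_on_compose_gen[OF _ \<Phi>_hol, unfolded o_def]) (auto simp: image_subset_iff)
  qed blast
  \<comment> \<open>Continuity of Y up to the boundary puts \<open>Y z\<close> into the ball in
    which the solution is unique, so that it must be \<open>h z\<close>.\<close>
  obtain d where d: "d > 0" "\<And>z. z \<in> cball 0 1 \<Longrightarrow> dist z u < d \<Longrightarrow> dist (Y z) (Y u) < \<epsilon>"
    using continuous_Y h(3) u unfolding continuous_on_iff by (metis mem_cball_0 order_refl)
  show ?thesis
  proof (rule that[of "min \<delta> d" h])
    show "h holomorphic_on ball u (min \<delta> d)" using h(5) by (rule holomorphic_on_subset) auto
    show "Y z = h z" if "z \<in> ball u (min \<delta> d) \<inter> ball 0 1" for z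
    proof -
      have "Y z \<in> ball (Y u) \<epsilon>" using d(2)[of z] that by (auto simp: dist_commute)
      then show ?thesis using h(6)[of z "Y z"] that fun_eq[of z] by (auto simp: K_def)
    qed
  qed (use h d in auto)
qed

text \<open>The functional equation is solved for \<open>z\<close> as a function \<open>W\<close> of the value \<open>y\<close>
  of \<open>Y\<close>. Criticality makes \<open>W\<close> stationary with nonzero second derivative, so \<open>1 - W\<close> is the
  square of a local chart \<open>q\<close>, and \<open>Y\<close> is the inverse of \<open>q\<close> at a square root of \<open>1 - z\<close>;
  the choice of root is constant by connectedness.\<close>

lemma singular_point:
  obtains \<epsilon> \<eta> H where "\<epsilon> > 0" "\<eta> > 0" "H holomorphic_on ball 0 \<eta>" "deriv H 0 \<noteq> 0"
    "\<And>z. z \<in> ball 1 \<epsilon> \<inter> ball 0 1 \<Longrightarrow> norm (csqrt (1 - z)) < \<eta> \<and> Y z = H (csqrt (1 - z))"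
proof -
  define y0 where "y0 = complex_of_real ys"
  have y0: "norm y0 = ys" "Y 1 = y0" using ys_pos Y_1 by (auto simp: y0_def)
  define r where "r = min (R0 - 1) (R1 - ys)"
  have r: "r > 0" using R0 R1 by (simp add: r_def)
  have zR0: "norm z < R0" if "z \<in> ball 1 r" for z :: complex
    by (rule norm_less_of_ball[of z 1 "R0 - 1"]) (use that in \<open>auto simp: r_def\<close>)
  have vR1: "norm v < R1" if "v \<in> ball y0 r" for v
    by (rule norm_less_of_ball[of v y0 "R1 - ys"]) (use that y0 in \<open>auto simp: r_def\<close>)
  \<comment> \<open>The arguments are swapped against the regular case: at the critical point the
    derivative in the value vanishes, while the derivative in \<open>z\<close>, which is g' +
    \<Phi>, is positive.\<close>
  define K where "K v z = g z + z * \<Phi> v - v" for z v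
  define K' where "K' v z = pseries (diffs b) z + \<Phi> v" for z v
  have y0R1: "norm y0 < R1" using y0 R1 by simp
  have pser_pos: "pseries c (of_real x) = of_real (\<Sum>n. c n * x ^ n) \<and> (\<Sum>n. c n * x ^ n) > 0"
    if "\<And>n. c n \<ge> 0" "c i > 0" "x > 0" "summable (\<lambda>n. c n * x ^ n)" for c i x
    using that suminf_pos2[OF that(4), of i] pseries_of_real[OF that(4)] by auto
  have nz: "K' y0 1 \<noteq> 0"
  proof -
    have "summable (\<lambda>n. p n * ys ^ n)"
      using pseries_summable_norm(3)[OF p_nonneg p_summable, of y0] y0 R1 by simp
    then obtain A where A: "\<Phi> y0 = of_real A" "A > 0"
      using pser_pos[of p 0 ys] p_nonneg p0 ys_pos unfolding y0_def by auto
    have sb: "summable (\<lambda>n. diffs b n * 1 ^ n)"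
      by (rule summable_diffs_smaller[OF b_summable]) (use R0 in auto)
    have "pseries (diffs b) 1 = of_real (\<Sum>n. diffs b n * 1 ^ n)"
      using pseries_of_real[OF sb] by simp
    moreover have "(\<Sum>n. diffs b n * 1 ^ n) \<ge> 0"
      using sb diffs_nonneg[of b] b_nonneg by (intro suminf_nonneg) auto
    ultimately have "K' y0 1 = of_real ((\<Sum>n. diffs b n * 1 ^ n) + A)" "(\<Sum>n. diffs b n * 1 ^ n) + A > 0"
      using A by (auto simp: K'_def)
    then show ?thesis by (metis less_irrefl of_real_eq_0_iff)
  qed
  have cont: "isCont (\<lambda>(v, z). K' v z) (y0, 1)"
  proof -
    have "isCont (\<lambda>x. \<Phi> (fst x)) (y0, 1)"
      by (rule isCont_o2[where f = fst, OF isCont_fst[OF continuous_ident]])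
        (use DERIV_isCont[OF \<Phi>_deriv] y0R1 in auto)
    moreover have "isCont (\<lambda>x. pseries (diffs b) (snd x)) (y0, 1)"
      by (rule isCont_o2[where f = snd, OF isCont_snd[OF continuous_ident]])
        (use DERIV_isCont[OF dg_deriv] R0 in auto)
    ultimately show ?thesis unfolding K'_def case_prod_beta by (intro continuous_intros)
  qed
  obtain \<delta> e W where W: "\<delta> > 0" "\<delta> \<le> r" "e > 0" "e \<le> r" "W holomorphic_on ball y0 \<delta>" "W y0 = 1"
    "\<And>x. x \<in> ball y0 \<delta> \<Longrightarrow> W x \<in> ball 1 e"
    "\<And>x v. x \<in> ball y0 \<delta> \<Longrightarrow> v \<in> ball 1 e \<Longrightarrow> K x v = 0 \<longleftrightarrow> v = W x"
  proof (rule holomorphic_implicit_function[of r y0 1 K K', OF r _ cont nz])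
    show "(K x has_field_derivative K' x v) (at v)" if "x \<in> ball y0 r" "v \<in> ball 1 r" for x v
      unfolding K_def[abs_def] K'_def using zR0[OF that(2)]
      by (auto intro!: derivative_eq_intros g_deriv)
    show "isCont (\<lambda>x. K x 1) y0"
      unfolding K_def using DERIV_isCont[OF \<Phi>_deriv[OF y0R1]] by (intro continuous_intros) auto
    show "K y0 1 = 0" using fun_eq_cball[of 1] y0 by (simp add: K_def)
    show "(\<lambda>x. K x (h x)) holomorphic_on S"
      if "open S" "S \<subseteq> ball y0 r" "h holomorphic_on S" "h ` S \<subseteq> ball 1 r" for h S
      unfolding K_def using that zR0 vR1
      by (intro holomorphic_intros holomorphic_on_subset[OF \<Phi>_hol]
          holomorphic_on_compose_gen[OF _ g_hol, unfolded o_def]) (auto simp: image_subset_iff)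
  qed blast
  have dW: "(W has_field_derivative deriv W y) (at y)" if "y \<in> ball y0 \<delta>" for y
    using W(5) that by (intro holomorphic_derivI[of W "ball y0 \<delta>"]) auto
  have ddW: "(deriv W has_field_derivative deriv (deriv W) y) (at y)" if "y \<in> ball y0 \<delta>" for y
    using W(5) that by (intro holomorphic_derivI[of "deriv W" "ball y0 \<delta>"] holomorphic_deriv) auto
  have WR0: "norm (W y) < R0" if "y \<in> ball y0 \<delta>" for y
    using zR0[of "W y"] W(7)[OF that] W(4) by auto
  have yR1: "norm y < R1" if "y \<in> ball y0 \<delta>" for y
    using vR1[of y] that W(2) by auto
  \<comment> \<open>Implicit differentiation of K y (W y) = 0. By criticality the right side
    vanishes at \<open>y0\<close>, so W is stationary there.\<close>
  have first: "deriv W y * K' y (W y) = 1 - W y * pseries (diffs p) y" if y: "y \<in> ball y0 \<delta>" for y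
  proof -
    have "((\<lambda>y. K y (W y)) has_field_derivative
        (pseries (diffs b) (W y) * deriv W y + (deriv W y * \<Phi> y + W y * pseries (diffs p) y) - 1)) (at y)"
      unfolding K_def
      by (rule derivative_eq_intros DERIV_chain2[OF g_deriv[OF WR0[OF y]] dW[OF y]] dW[OF y] \<Phi>_deriv[OF yR1[OF y]] refl)+ simp
    moreover have "((\<lambda>y. K y (W y)) has_field_derivative 0) (at y)"
    proof (rule has_field_derivative_transform_within_open[where S = "ball y0 \<delta>"])
      show "((\<lambda>_. 0) has_field_derivative 0) (at y)" by simp
      show "0 = K x (W x)" if "x \<in> ball y0 \<delta>" for x
        using W(8)[OF that W(7)[OF that]] by simp
    qed (use y in auto)
    ultimately have "pseries (diffs b) (W y) * deriv W y + (deriv W y * \<Phi> y + W y * pseries (diffs p) y) - 1 = 0"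
      by (rule DERIV_unique)
    then show ?thesis unfolding K'_def by (simp add: algebra_simps)
  qed
  have y0\<delta>: "y0 \<in> ball y0 \<delta>" using W(1) by simp
  have dp1: "pseries (diffs p) y0 = 1"
    using pseries_of_real[OF dp_summable[of ys]] ys_pos R1 critical by (simp add: y0_def)
  have dW0: "deriv W y0 = 0"
    using first[OF y0\<delta>] nz W(6) dp1 by simp
  \<comment> \<open>Differentiating \<open>first\<close> once more at \<open>y0\<close>, where W' =
    0 and W = 1, gives W'' K' = - \<Phi>''(ys), and a coefficient with k >= 2 makes the right side
    nonzero.\<close>
  have ddW0: "deriv (deriv W) y0 \<noteq> 0"
  proof
    assume dd0: "deriv (deriv W) y0 = 0"
    define D where "D = pseries (diffs (diffs p)) y0"
    have dK': "((\<lambda>y. K' y (W y)) has_field_derivative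
        (pseries (diffs (diffs b)) (W y0) * deriv W y0 + pseries (diffs p) y0)) (at y0)"
      unfolding K'_def
      by (rule derivative_eq_intros DERIV_chain2[OF dg_deriv[OF WR0[OF y0\<delta>]] dW[OF y0\<delta>]] \<Phi>_deriv[OF yR1[OF y0\<delta>]] refl)+
    have 1: "((\<lambda>y. deriv W y * K' y (W y)) has_field_derivative 0) (at y0)"
      by (rule derivative_eq_intros ddW[OF y0\<delta>] dK')+ (simp add: dd0 dW0)
    have "((\<lambda>y. 1 - W y * pseries (diffs p) y) has_field_derivative - D) (at y0)"
      by (rule derivative_eq_intros dW[OF y0\<delta>] d\<Phi>_deriv[OF yR1[OF y0\<delta>]] refl)+
        (simp add: dW0 W(6) D_def)
    then have "((\<lambda>y. deriv W y * K' y (W y)) has_field_derivative - D) (at y0)"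
      by (rule has_field_derivative_transform_within_open[where S = "ball y0 \<delta>"])
        (use first y0\<delta> in auto)
    with 1 have "D = 0" using DERIV_unique by fastforce
    moreover have "D \<noteq> 0"
    proof -
      obtain k where k: "k \<ge> 2" "p k > 0" using p_nonlinear by blast
      obtain r where r: "ys < r" "r < R1" using dense R1 by blast
      have "summable (\<lambda>n. diffs (diffs p) n * ys ^ n)"
        by (rule summable_diffs_smaller[OF dp_summable]) (use r ys_pos in auto)
      then have "D = of_real (\<Sum>n. diffs (diffs p) n * ys ^ n) \<and> (\<Sum>n. diffs (diffs p) n * ys ^ n) > 0"
        unfolding D_def y0_def
        by (intro pser_pos[where i = "k - 2"] diffs_nonneg p_nonneg ys_pos)
          (use k in \<open>auto simp: diffs_def numeral_2_eq_2 Suc_diff_Suc\<close>)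
      then show ?thesis by (metis less_irrefl of_real_eq_0_iff)
    qed
    ultimately show False by simp
  qed
  obtain G r1 where G: "r1 > 0" "G holomorphic_on ball y0 r1"
    "\<And>w. w \<in> ball y0 r1 \<Longrightarrow> W w - W y0 = ((w - y0) * G w) ^ 2" "\<And>w. w \<in> ball y0 r1 \<Longrightarrow> G w \<noteq> 0"
  proof (rule holomorphic_factor_order_of_zero_strong[OF W(5) open_ball y0\<delta>, of 2])
    show "(deriv ^^ i) W y0 = 0" if "0 < i" "i < 2" for i
      using that dW0 by (cases "i = 1") auto
  qed (use ddW0 in \<open>auto simp: numeral_2_eq_2\<close>)
  define r2 where "r2 = min r1 \<delta>"
  \<comment> \<open>The factor \<open>\<i>\<close> turns W - 1 = ((y - y0) G y)^2 into 1 - W = (q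
    y)^2.\<close>
  define q where "q y = (y - y0) * (\<i> * G y)" for y
  have G2: "G holomorphic_on ball y0 r2"
    using G(2) by (rule holomorphic_on_subset) (simp add: r2_def subset_ball)
  have r2: "r2 > 0" using G(1) W(1) by (simp add: r2_def)
  have q_hol: "q holomorphic_on ball y0 r2" unfolding q_def by (intro holomorphic_intros G2)
  have q_sq: "1 - W y = (q y)\<^sup>2" if "y \<in> ball y0 r2" for y
  proof -
    have "W y = 1 + ((y - y0) * G y)\<^sup>2"
      using G(3)[of y] that W(6) by (simp add: r2_def algebra_simps)
    moreover have "(q y)\<^sup>2 = \<i>\<^sup>2 * ((y - y0) * G y)\<^sup>2"
      by (simp add: q_def power_mult_distrib mult_ac del: power2_i)
    ultimately show ?thesis by simp
  qed
  have "(q has_field_derivative \<i> * G y0) (at y0)"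
  proof -
    have "(G has_field_derivative deriv G y0) (at y0)"
      using G2 r2 by (intro holomorphic_derivI[of G "ball y0 r2"]) auto
    then show ?thesis unfolding q_def by (auto intro!: derivative_eq_intros)
  qed
  then have dq: "deriv q y0 \<noteq> 0"
    using G(4)[of y0] G(1) by (simp add: DERIV_imp_deriv)
  obtain r3 where r3: "r3 > 0" "ball y0 r3 \<subseteq> ball y0 r2" "open (q ` ball y0 r3)" "inj_on q (ball y0 r3)"
    using has_complex_derivative_locally_invertible[OF q_hol _ open_ball dq] r2 by auto
  obtain Q where Q: "Q holomorphic_on (q ` ball y0 r3)"
    "\<And>z. z \<in> ball y0 r3 \<Longrightarrow> deriv q z * deriv Q (q z) = 1" "\<And>z. z \<in> ball y0 r3 \<Longrightarrow> Q (q z) = z"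
    using holomorphic_has_inverse[OF holomorphic_on_subset[OF q_hol r3(2)] open_ball r3(4)] by blast
  have q0: "q y0 = 0" by (simp add: q_def)
  have y03: "y0 \<in> ball y0 r3" using r3 by simp
  obtain \<eta> where \<eta>: "\<eta> > 0" "ball 0 \<eta> \<subseteq> q ` ball y0 r3"
    using r3(3) y03 q0 open_contains_ball by (metis image_eqI)
  have dQ: "deriv Q 0 \<noteq> 0" using Q(2)[OF y03] q0 by auto
  obtain d where d: "d > 0" "\<And>z. z \<in> cball 0 1 \<Longrightarrow> dist z 1 < d \<Longrightarrow> dist (Y z) y0 < r3"
    using continuous_Y r3(1) y0(2) unfolding continuous_on_iff by (metis mem_cball_0 order_refl norm_one)
  \<comment> \<open>\<open>d\<close> keeps \<open>Y z\<close> inside the chart, \<open>e\<close>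
    keeps \<open>z\<close> where \<open>W\<close> is the unique solution, and the square of
    \<open>\<eta>\<close> keeps csqrt (1 - z) below \<open>\<eta>\<close>.\<close>
  define \<epsilon> where "\<epsilon> = Min {d, e, \<eta>\<^sup>2}"
  have \<epsilon>: "\<epsilon> > 0" "\<epsilon> \<le> d" "\<epsilon> \<le> e" "\<epsilon> \<le> \<eta>\<^sup>2" using d W(3) \<eta> by (auto simp: \<epsilon>_def)
  define V where "V = ball (1::complex) \<epsilon> \<inter> ball 0 1"
  have YV: "Y z \<in> ball y0 r3" if "z \<in> V" for z
    using d(2)[of z] that \<epsilon> by (auto simp: V_def dist_commute)
  have qY: "(q (Y z))\<^sup>2 = 1 - z" if z: "z \<in> V" for z
  proof -
    have 1: "Y z \<in> ball y0 \<delta>" "Y z \<in> ball y0 r2" using YV[OF z] r3(2) by (auto simp: r2_def)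
    have "K (Y z) z = 0" using fun_eq[of z] z by (simp add: K_def V_def)
    then have "z = W (Y z)" using W(8)[OF 1(1), of z] z \<epsilon> by (auto simp: V_def)
    then show ?thesis using q_sq[OF 1(2)] by simp
  qed
  have Re: "Re (1 - z) > 0" if "z \<in> V" for z
    using that abs_Re_le_cmod[of z] by (auto simp: V_def)
  define \<sigma> where "\<sigma> z = q (Y z) / csqrt (1 - z)" for z
  have nz: "csqrt (1 - z) \<noteq> 0" if "z \<in> V" for z using Re[OF that] by auto
  have \<sigma>_sq: "\<sigma> z = 1 \<or> \<sigma> z = -1" if "z \<in> V" for z
  proof -
    have "(\<sigma> z)\<^sup>2 = 1" using qY[OF that] nz[OF that] by (simp add: \<sigma>_def power_divide)
    then show ?thesis by (simp add: power2_eq_1_iff)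
  qed
  have "\<sigma> constant_on V"
  proof (rule continuous_finite_range_constant)
    show "connected V" unfolding V_def by (intro convex_connected convex_Int convex_ball)
    have 1: "continuous_on V Y" using continuous_Y by (rule continuous_on_subset) (auto simp: V_def)
    have 2: "continuous_on V (\<lambda>z. q (Y z))"
      by (rule continuous_on_compose2[OF holomorphic_on_imp_continuous_on[OF q_hol] 1])
        (use YV r3(2) in auto)
    have 3: "continuous_on V (\<lambda>z. csqrt (1 - z))"
      by (rule continuous_on_compose2[OF continuous_on_csqrt])
        (use Re in \<open>force intro!: continuous_intros simp: complex_nonpos_Reals_iff\<close>)+
    show "continuous_on V \<sigma>" unfolding \<sigma>_def by (intro continuous_intros 2 3) (use nz in auto)
    show "finite (\<sigma> ` V)" by (rule finite_subset[of _ "{1, -1}"]) (use \<sigma>_sq in auto)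
  qed
  then obtain \<sigma>0 where \<sigma>0: "\<And>z. z \<in> V \<Longrightarrow> \<sigma> z = \<sigma>0" unfolding constant_on_def by blast
  have "\<exists>s. (s = 1 \<or> s = -1) \<and> (\<forall>z\<in>V. q (Y z) = s * csqrt (1 - z))"
  proof (cases "V = {}")
    case False
    then have "\<sigma>0 = 1 \<or> \<sigma>0 = -1" using \<sigma>0 \<sigma>_sq by force
    moreover have "q (Y z) = \<sigma>0 * csqrt (1 - z)" if "z \<in> V" for z
      using \<sigma>0[OF that] nz[OF that] by (simp add: \<sigma>_def field_simps)
    ultimately show ?thesis by blast
  qed auto
  then obtain s where s: "s = 1 \<or> s = -1" "\<And>z. z \<in> V \<Longrightarrow> q (Y z) = s * csqrt (1 - z)" by blast
  \<comment> \<open>Which of the two signs occurs is left open; it is absorbed into H and multiplies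
    the derivative at 0 by a number of modulus 1.\<close>
  define H where "H w = Q (s * w)" for w
  have ns: "norm s = 1" using s(1) by auto
  have Q_hol: "Q holomorphic_on ball 0 \<eta>" using Q(1) \<eta>(2) by (rule holomorphic_on_subset)
  show ?thesis
  proof (rule that[of \<epsilon> \<eta> H])
    show "H holomorphic_on ball 0 \<eta>"
      unfolding H_def using ns
      by (intro holomorphic_on_compose_gen[OF _ Q_hol, unfolded o_def] holomorphic_intros)
        (auto simp: norm_mult)
    have "(Q has_field_derivative deriv Q 0) (at (s * 0))"
      using Q_hol \<eta>(1) holomorphic_derivI[of Q "ball 0 \<eta>" 0 UNIV] by simp
    then have "(H has_field_derivative deriv Q 0 * s) (at 0)"
      unfolding H_def by (rule DERIV_chain2) (auto intro!: derivative_eq_intros)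
    then show "deriv H 0 \<noteq> 0" using dQ ns by (auto simp: DERIV_imp_deriv)
    fix z :: complex assume "z \<in> ball 1 \<epsilon> \<inter> ball 0 1"
    then have z: "z \<in> V" by (simp add: V_def)
    have "(norm (csqrt (1 - z)))\<^sup>2 = norm (1 - z)" by (metis norm_power power2_csqrt)
    also have "\<dots> < \<eta>\<^sup>2" using z \<epsilon> by (auto simp: V_def dist_norm)
    finally have "norm (csqrt (1 - z)) < \<eta>" by (rule power_less_imp_less_base) (use \<eta>(1) in simp)
    moreover have "Y z = H (csqrt (1 - z))"
      using Q(3)[OF YV[OF z]] s(2)[OF z] by (simp add: H_def)
    ultimately show "norm (csqrt (1 - z)) < \<eta> \<and> Y z = H (csqrt (1 - z))" by blast
  qed (use \<epsilon> \<eta> in auto)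
qed

end

section \<open>Singularity analysis\<close>

text \<open>The coefficient of z^n in (1 - z)^(j/2). For odd j it has order n^(-j/2 - 1), so raising
  j by 2 gains a factor 1/n.\<close>

definition sqrt_coeff :: "nat \<Rightarrow> nat \<Rightarrow> real" where
  "sqrt_coeff j n = (-1) ^ n * ((real j / 2) gchoose n)"

lemma csqrt_power_sums:
  assumes "norm z < 1"
  shows "(\<lambda>n. complex_of_real (sqrt_coeff j n) * z ^ n) sums csqrt (1 - z) ^ j"
proof -
  have "1 - z \<noteq> 0" using assms by auto
  then have "csqrt (1 - z) ^ j = (1 + (- z)) powr (of_real (real j / 2))"
    by (simp add: csqrt_conv_powr powr_power)
  moreover have "(\<lambda>n. (complex_of_real (real j / 2) gchoose n) * (- z) ^ n) sums (1 + (- z)) powr (of_real (real j / 2))"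
    using assms by (intro gen_binomial_complex) simp
  moreover have "(complex_of_real a gchoose n) = of_real (a gchoose n)" for a n
    by (simp add: gbinomial_prod_rev)
  ultimately show ?thesis
    by (simp add: sqrt_coeff_def power_minus[of z] mult_ac del: of_real_divide)
qed

text \<open>This is the absorption identity (a + 1 - n) binom(a + 1, n) = (a + 1) binom(a, n) with a
  = j/2. Dividing by the second factor on the left bounds the coefficients for j + 2 by those for
  j.\<close>

lemma sqrt_coeff_step:
  "\<bar>sqrt_coeff (j + 2) n\<bar> * \<bar>real j / 2 + 1 - n\<bar> = (real j / 2 + 1) * \<bar>sqrt_coeff j n\<bar>"
proof -
  have "(real j / 2 + 1 - of_nat n) * ((real j / 2 + 1) gchoose n) = (real j / 2 + 1) * ((real j / 2) gchoose n)"
    using gbinomial_absorb_comp[of "real j / 2 + 1" n] by simp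
  then have "\<bar>(real j / 2 + 1 - of_nat n) * ((real j / 2 + 1) gchoose n)\<bar> = (real j / 2 + 1) * \<bar>(real j / 2) gchoose n\<bar>"
    by (simp add: abs_mult)
  then show ?thesis by (simp add: sqrt_coeff_def abs_mult add_divide_distrib add.commute mult.commute)
qed

text \<open>The true order is n^(-3/2). The weaker bound n^(-2) passes through a short induction and
  is enough: it makes a remainder of order n^(-3) at most a constant times the coefficient over
  n.\<close>

lemma sqrt_coeff_1_neg:
  assumes "n \<ge> 1" shows "sqrt_coeff 1 n \<le> - 1 / (2 * real n ^ 2)"
  using assms
proof (induction n rule: nat_induct_at_least)
  case base
  show ?case by (simp add: sqrt_coeff_def)
next
  case (Suc n)
  define x y where "x = (1/2 :: real) gchoose Suc n" and "y = (1/2 :: real) gchoose n"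
  have "x * (real n + 1) = y * (1/2 - real n)"
    using gbinomial_absorption[of n "1/2 :: real"] gbinomial_absorb_comp[of "1/2 :: real" n]
    by (simp add: x_def y_def mult_ac add_ac)
  then have "(-1) ^ n * (x * (real n + 1)) = (-1) ^ n * (y * (1/2 - real n))" by simp
  moreover have "sqrt_coeff 1 (Suc n) = - ((-1) ^ n * x)" "sqrt_coeff 1 n = (-1) ^ n * y"
    by (simp_all add: sqrt_coeff_def x_def y_def)
  ultimately have "sqrt_coeff 1 (Suc n) * (real n + 1) = sqrt_coeff 1 n * (real n - 1/2)"
    by (simp add: algebra_simps)
  also have "\<dots> \<le> (- 1 / (2 * real n ^ 2)) * (real n - 1/2)"
    using Suc by (intro mult_right_mono) auto
  \<comment> \<open>After clearing denominators this is n^2 <= (n - 1/2) (n + 1), which holds for n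
    >= 1.\<close>
  also have "\<dots> \<le> (- 1 / (2 * real (Suc n) ^ 2)) * (real n + 1)"
  proof -
    have n: "real n \<ge> 1" using Suc by simp
    have "(real n - 1/2) * (real n + 1) = real n ^ 2 + (real n - 1) / 2"
      by (simp add: power2_eq_square field_simps)
    then have "real n ^ 2 \<le> (real n - 1/2) * (real n + 1)" using n by simp
    then have "1 / (real n + 1) \<le> (real n - 1/2) / real n ^ 2"
      using n by (simp add: pos_le_divide_eq pos_divide_le_eq)
    then have "(1/2) * (1 / (real n + 1)) \<le> (1/2) * ((real n - 1/2) / real n ^ 2)"
      by (rule mult_left_mono) simp
    moreover have "(1 / (2 * N ^ 2)) * N = (1/2) * (1 / N)" if "N \<noteq> 0" for N :: real
      using that by (simp add: power2_eq_square)
    from this[of "real n + 1"] have "(1 / (2 * real (Suc n) ^ 2)) * (real n + 1) = (1/2) * (1 / (real n + 1))"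
      by (simp add: add.commute)
    ultimately show ?thesis by simp
  qed
  finally show ?case
    by (rule mult_right_le_imp_le) simp
qed

lemma abs_sqrt_coeff_1: "n \<ge> 1 \<Longrightarrow> \<bar>sqrt_coeff 1 n\<bar> = - sqrt_coeff 1 n"
  and sqrt_coeff_1_lower: "n \<ge> 1 \<Longrightarrow> 1 / (2 * real n ^ 2) \<le> \<bar>sqrt_coeff 1 n\<bar>"
proof -
  assume n: "n \<ge> 1"
  have "1 / (2 * real n ^ 2) > 0" using n by simp
  with sqrt_coeff_1_neg[OF n] show "\<bar>sqrt_coeff 1 n\<bar> = - sqrt_coeff 1 n"
    "1 / (2 * real n ^ 2) \<le> \<bar>sqrt_coeff 1 n\<bar>" by linarith+
qed

lemma sqrt_coeff_1_pos: "n \<ge> 1 \<Longrightarrow> 0 < \<bar>sqrt_coeff 1 n\<bar>"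
  by (rule less_le_trans[OF _ sqrt_coeff_1_lower]) auto

lemma sqrt_coeff_3: "n \<ge> 1 \<Longrightarrow> \<bar>sqrt_coeff 3 n\<bar> \<le> 6 * \<bar>sqrt_coeff 1 n\<bar> / real n"
proof -
  assume n: "n \<ge> 1"
  have "real n / 4 \<le> \<bar>3/2 - real n\<bar>"
  proof (cases "n = 1")
    case False
    then have "real n \<ge> 2" using n by linarith
    then show ?thesis by linarith
  qed auto
  then have "\<bar>sqrt_coeff 3 n\<bar> * (real n / 4) \<le> \<bar>sqrt_coeff 3 n\<bar> * \<bar>3/2 - real n\<bar>"
    by (intro mult_left_mono) auto
  also have "\<dots> = 3/2 * \<bar>sqrt_coeff 1 n\<bar>"
    using sqrt_coeff_step[of 1 n] by (simp add: numeral_3_eq_3)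
  finally show ?thesis using n by (simp add: field_simps)
qed

text \<open>Here only |5/2 - n| >= 1/2 is used. This gives away a factor 1/n, but stays within five
  times the bound for j = 3, whence 30 = 5 * 6.\<close>

lemma sqrt_coeff_5: "n \<ge> 1 \<Longrightarrow> \<bar>sqrt_coeff 5 n\<bar> \<le> 30 * \<bar>sqrt_coeff 1 n\<bar> / real n"
proof -
  assume n: "n \<ge> 1"
  have "1 / 2 \<le> \<bar>5/2 - real n\<bar>"
  proof (cases "n \<le> 2")
    case False
    then have "real n \<ge> 3" by linarith
    then show ?thesis by linarith
  qed linarith
  then have "\<bar>sqrt_coeff 5 n\<bar> * (1 / 2) \<le> \<bar>sqrt_coeff 5 n\<bar> * \<bar>5/2 - real n\<bar>"
    by (intro mult_left_mono) auto
  also have "\<dots> = 5/2 * \<bar>sqrt_coeff 3 n\<bar>"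
    using sqrt_coeff_step[of 3 n] by simp
  finally show ?thesis using sqrt_coeff_3[OF n] by simp
qed

section \<open>Expansions in the local variable s = csqrt (1 - z / u)\<close>

lemma holomorphic_taylor_remainder:
  assumes "H holomorphic_on ball 0 \<eta>"
  shows "\<exists>c K. K holomorphic_on ball 0 \<eta> \<and> (\<forall>s\<in>ball 0 \<eta>. H s = (\<Sum>j<n. c j * s ^ j) + s ^ n * K s)"
proof (induction n)
  case 0
  show ?case by (rule exI, rule exI[of _ H]) (simp add: assms)
next
  case (Suc n)
  then obtain c K where "K holomorphic_on ball 0 \<eta> \<and> (\<forall>s\<in>ball 0 \<eta>. H s = (\<Sum>j<n. c j * s ^ j) + s ^ n * K s)"
    by (elim exE)
  then have K: "K holomorphic_on ball 0 \<eta>"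
    "\<And>s. s \<in> ball 0 \<eta> \<Longrightarrow> H s = (\<Sum>j<n. c j * s ^ j) + s ^ n * K s" by simp_all
  define K' where "K' s = (if s = 0 then deriv K 0 else (K s - K 0) / (s - 0))" for s
  have "K' holomorphic_on ball 0 \<eta>"
    unfolding K'_def[abs_def] by (rule pole_lemma_open[OF K(1) open_ball])
  moreover have K': "K s = K 0 + s * K' s" for s by (simp add: K'_def)
  have "H s = (\<Sum>j<Suc n. (c(n := K 0)) j * s ^ j) + s ^ Suc n * K' s" if "s \<in> ball 0 \<eta>" for s
  proof -
    have "(\<Sum>j<n. (c(n := K 0)) j * s ^ j) = (\<Sum>j<n. c j * s ^ j)"
      by (intro sum.cong) auto
    then have "(\<Sum>j<Suc n. (c(n := K 0)) j * s ^ j) + s ^ Suc n * K' s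
        = (\<Sum>j<n. c j * s ^ j) + s ^ n * (K 0 + s * K' s)"
      by (simp add: distrib_left mult_ac)
    then show ?thesis unfolding K(2)[OF that] using K'[of s] by simp
  qed
  ultimately show ?case
    by (intro exI[of _ "c(n := K 0)"] exI[of _ K'] conjI ballI)
qed

text \<open>The remainder carries s^6 because three differentiations in z use up six powers of s.
  Dividing by s before expanding identifies the linear coefficient as \<open>deriv H 0\<close>, the
  one that decides the leading constant.\<close>

lemma holomorphic_taylor_5:
  assumes "H holomorphic_on ball 0 \<eta>" "\<eta> > 0"
  obtains c K where "K holomorphic_on ball 0 \<eta>" "c 1 = deriv H 0"
    "\<And>s. s \<in> ball 0 \<eta> \<Longrightarrow> H s = (\<Sum>j<6. c j * s ^ j) + s ^ 6 * K s"
proof -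
  define N where "N s = (if s = 0 then deriv H 0 else (H s - H 0) / (s - 0))" for s
  have "N holomorphic_on ball 0 \<eta>"
    unfolding N_def[abs_def] by (rule pole_lemma_open[OF assms(1) open_ball])
  from holomorphic_taylor_remainder[OF this, of 5] obtain d K where
    "K holomorphic_on ball 0 \<eta> \<and> (\<forall>s\<in>ball 0 \<eta>. N s = (\<Sum>j<5. d j * s ^ j) + s ^ 5 * K s)"
    by (elim exE)
  then have K: "K holomorphic_on ball 0 \<eta>"
    "\<And>s. s \<in> ball 0 \<eta> \<Longrightarrow> N s = (\<Sum>j<5. d j * s ^ j) + s ^ 5 * K s" by simp_all
  define c where "c = case_nat (H 0) d"
  have "N 0 = d 0" using K(2)[of 0] assms(2) by (simp add: sum.lessThan_Suc_shift[of _ 4, simplified])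
  then have "c 1 = deriv H 0" by (simp add: c_def N_def)
  moreover have "H s = (\<Sum>j<6. c j * s ^ j) + s ^ 6 * K s" if "s \<in> ball 0 \<eta>" for s
  proof -
    have "(\<Sum>j<6. c j * s ^ j) = H 0 + (\<Sum>j<5. d j * s ^ Suc j)"
      using sum.lessThan_Suc_shift[of "\<lambda>j. c j * s ^ j" 5] by (simp add: c_def)
    also have "(\<Sum>j<5. d j * s ^ Suc j) = s * (\<Sum>j<5. d j * s ^ j)"
      unfolding sum_distrib_left by (intro sum.cong) auto
    finally have 1: "(\<Sum>j<6. c j * s ^ j) = H 0 + s * (\<Sum>j<5. d j * s ^ j)" .
    have 2: "s ^ 6 = s * s ^ 5" using power_Suc[of s 5] by simp
    have "H s = H 0 + s * N s" by (simp add: N_def)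
    then show ?thesis unfolding K(2)[OF that] 1 2 by (simp only: distrib_left mult.assoc add.assoc)
  qed
  ultimately show ?thesis using that[OF K(1)] by simp
qed

lemma Re_one_minus_quotient_pos:
  fixes u z :: complex
  assumes "norm u = 1" "norm z < 1"
  shows "1 - z / u \<notin> \<real>\<^sub>\<le>\<^sub>0"
proof -
  have "norm (z / u) < 1" using assms by (simp add: norm_divide)
  then have "Re (1 - z / u) > 0" using abs_Re_le_cmod[of "z / u"] by auto
  then show ?thesis by (auto simp: complex_nonpos_Reals_iff)
qed

text \<open>From s^2 = 1 - z / u follows ds/dz = -1 / (2 u s): one differentiation lowers the power
  of s by two and replaces K by another function holomorphic in s.\<close>

lemma csqrt_power_has_derivative:
  defines "s \<equiv> \<lambda>u z. csqrt (1 - z / u)"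
  assumes u: "norm u = 1" and z: "norm z < 1" and s: "s u z \<in> ball 0 \<eta>"
    and K: "K holomorphic_on ball 0 \<eta>"
  shows "((\<lambda>z. s u z ^ (n + 2) * K (s u z)) has_field_derivative
          s u z ^ n * (- (of_nat (n + 2) * K (s u z) + s u z * deriv K (s u z)) / (2 * u))) (at z)"
proof -
  define w where "w = s u z"
  have nz: "1 - z / u \<notin> \<real>\<^sub>\<le>\<^sub>0" by (rule Re_one_minus_quotient_pos[OF u z])
  then have "1 - z / u \<noteq> 0" by (metis nonpos_Reals_zero_I)
  then have w: "w \<noteq> 0" by (simp add: w_def s_def)
  have u0: "u \<noteq> 0" using u by auto
  have dw: "(s u has_field_derivative (- (1 / u) / (2 * w))) (at z)"
    unfolding w_def s_def using nz u0 by (auto intro!: derivative_eq_intros)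
  have dK: "(K has_field_derivative deriv K (s u z)) (at (s u z))"
    using K s by (intro holomorphic_derivI[of K "ball 0 \<eta>"]) auto
  have "((\<lambda>z. s u z ^ (n + 2) * K (s u z)) has_field_derivative
          (of_nat (n + 2) * w ^ (n + 1) * (- (1 / u) / (2 * w))) * K w
           + w ^ (n + 2) * (deriv K w * (- (1 / u) / (2 * w)))) (at z)"
    using DERIV_mult[OF DERIV_power[OF dw, of "n + 2"] DERIV_chain2[OF dK dw]]
    unfolding w_def[symmetric] by (rule DERIV_cong) (simp add: mult_ac)
  moreover have "(of_nat (n + 2) * w ^ (n + 1) * (- (1 / u) / (2 * w))) * K w
           + w ^ (n + 2) * (deriv K w * (- (1 / u) / (2 * w)))
        = w ^ n * (- (of_nat (n + 2) * K w + w * deriv K w) / (2 * u))"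
    using w u0 by (simp add: field_simps)
  ultimately show ?thesis by (simp add: w_def)
qed

lemma deriv_eq_on_open:
  assumes "open V" "\<And>z. z \<in> V \<Longrightarrow> (f has_field_derivative f' z) (at z)" "\<And>z. z \<in> V \<Longrightarrow> g z = f z" "z \<in> V"
  shows "deriv g z = f' z"
proof -
  have "(g has_field_derivative f' z) (at z)"
    by (rule has_field_derivative_transform_within_open[OF assms(2)[OF assms(4)] assms(1,4)]) (simp add: assms(3))
  then show ?thesis by (rule DERIV_imp_deriv)
qed

text \<open>After three differentiations no negative power of s has appeared, so the result stays
  bounded near u although s itself is not differentiable there.\<close>

lemma csqrt_power_6_third_deriv:
  assumes u: "norm u = 1" and V: "open V" "V \<subseteq> ball 0 1"
    and s: "\<And>z. z \<in> V \<Longrightarrow> csqrt (1 - z / u) \<in> ball 0 \<eta>"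
    and K: "K holomorphic_on ball 0 \<eta>"
  obtains K3 where "K3 holomorphic_on ball 0 \<eta>"
    "\<And>z. z \<in> V \<Longrightarrow> (deriv ^^ 3) (\<lambda>z. csqrt (1 - z / u) ^ 6 * K (csqrt (1 - z / u))) z = K3 (csqrt (1 - z / u))"
proof -
  define D where "D n K w = - (of_nat (n + 2) * K w + w * deriv K w) / (2 * u)" for n K w
  have D: "D n K holomorphic_on ball 0 \<eta>" if "K holomorphic_on ball 0 \<eta>" for n K
    unfolding D_def using that u by (intro holomorphic_intros holomorphic_deriv) auto
  let ?s = "\<lambda>z. csqrt (1 - z / u)"
  have der: "((\<lambda>z. ?s z ^ (n + 2) * K (?s z)) has_field_derivative ?s z ^ n * D n K (?s z)) (at z)"
    if "K holomorphic_on ball 0 \<eta>" "z \<in> V" for K n z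
    unfolding D_def using csqrt_power_has_derivative[OF u _ s that(1), of z n] that(2) V(2) by auto
  define K1 where "K1 = D 4 K"
  define K2 where "K2 = D 2 K1"
  define K3 where "K3 = D 0 K2"
  have hol: "K1 holomorphic_on ball 0 \<eta>" "K2 holomorphic_on ball 0 \<eta>" "K3 holomorphic_on ball 0 \<eta>"
    unfolding K1_def K2_def K3_def by (intro D K)+
  define L where "L = (\<lambda>z. ?s z ^ 6 * K (?s z))"
  have L1: "deriv L z = ?s z ^ 4 * K1 (?s z)" if "z \<in> V" for z
    by (rule deriv_eq_on_open[OF V(1) _ _ that, where f = "\<lambda>z. ?s z ^ (4 + 2) * K (?s z)"])
      (use der[OF K, of _ 4] in \<open>auto simp: K1_def L_def\<close>)
  have L2: "deriv (deriv L) z = ?s z ^ 2 * K2 (?s z)" if "z \<in> V" for z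
    by (rule deriv_eq_on_open[OF V(1) _ _ that, where f = "\<lambda>z. ?s z ^ (2 + 2) * K1 (?s z)"])
      (use der[OF hol(1), of _ 2] L1 in \<open>auto simp: K2_def\<close>)
  have L3: "deriv (deriv (deriv L)) z = ?s z ^ 0 * K3 (?s z)" if "z \<in> V" for z
    by (rule deriv_eq_on_open[OF V(1) _ _ that, where f = "\<lambda>z. ?s z ^ (0 + 2) * K2 (?s z)"])
      (use der[OF hol(2), of _ 0] L2 in \<open>auto simp: K3_def numeral_2_eq_2\<close>)
  show ?thesis
    by (rule that[OF hol(3)]) (use L3 in \<open>simp add: L_def eval_nat_numeral\<close>)
qed

section \<open>Bounded third derivatives and the size of coefficients\<close>

lemma bounded_on_compact:
  fixes f :: "'a :: topological_space \<Rightarrow> 'b :: real_normed_vector"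
  assumes "compact S" "continuous_on S f" shows "\<exists>C. \<forall>x\<in>S. norm (f x) \<le> C"
  using compact_imp_bounded[OF compact_continuous_image[OF assms(2,1)]] unfolding bounded_iff by blast

text \<open>Compactness of the closed disc: at interior points local boundedness is continuity, at
  boundary points it is \<open>loc\<close>, and finitely many neighbourhoods suffice.\<close>

lemma third_deriv_bounded_of_local:
  assumes E: "E holomorphic_on ball 0 1"
    and loc: "\<And>u. norm u = 1 \<Longrightarrow> \<exists>U C. open U \<and> u \<in> U \<and> (\<forall>z\<in>U \<inter> ball 0 1. norm ((deriv ^^ k) E z) \<le> C)"
  obtains C where "\<And>z. z \<in> ball 0 1 \<Longrightarrow> norm ((deriv ^^ k) E z) \<le> C"
proof -
  have hol: "(deriv ^^ k) E holomorphic_on ball 0 1" by (intro holomorphic_higher_deriv E) auto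
  have "\<exists>U C. open U \<and> u \<in> U \<and> (\<forall>z\<in>U \<inter> ball 0 1. norm ((deriv ^^ k) E z) \<le> C)" if "u \<in> cball 0 1" for u
  proof (cases "norm u = 1")
    case False
    then have u: "u \<in> ball 0 1" using that by auto
    obtain r where r: "r > 0" "cball u r \<subseteq> ball 0 1" using u open_contains_cball open_ball by blast
    have "continuous_on (cball u r) ((deriv ^^ k) E)"
      using holomorphic_on_imp_continuous_on[OF hol] r(2) by (rule continuous_on_subset)
    then obtain C where "\<forall>z\<in>cball u r. norm ((deriv ^^ k) E z) \<le> C"
      using bounded_on_compact[OF compact_cball] by blast
    then show ?thesis using r by (intro exI[of _ "ball u r"] exI[of _ C]) auto
  qed (use loc in auto)
  then obtain U C where UC: "\<And>u. u \<in> cball 0 1 \<Longrightarrow> open (U u) \<and> u \<in> U u \<and> (\<forall>z\<in>U u \<inter> ball 0 1. norm ((deriv ^^ k) E z) \<le> C u)"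
    by metis
  obtain S where S: "S \<subseteq> cball 0 1" "finite S" "cball 0 1 \<subseteq> (\<Union>c\<in>S. U c)"
    by (rule compactE_image[of "cball 0 1" "cball 0 1" U]) (use UC in auto)
  show ?thesis
  proof (rule that[of "\<Sum>c\<in>S. \<bar>C c\<bar>"])
    fix z :: complex assume z: "z \<in> ball 0 1"
    then obtain c where c: "c \<in> S" "z \<in> U c" using S(3) by force
    have "norm ((deriv ^^ k) E z) \<le> C c" using UC[of c] S(1) c z by auto
    also have "\<dots> \<le> (\<Sum>c\<in>S. \<bar>C c\<bar>)" using member_le_sum[of c S "\<lambda>c. \<bar>C c\<bar>"] c S(2) by simp
    finally show "norm ((deriv ^^ k) E z) \<le> (\<Sum>c\<in>S. \<bar>C c\<bar>)" .
  qed
qed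

text \<open>Cauchy's estimate for the third derivative on circles of radius r, with r tending to 1.
  The coefficients of the third derivative are those of E times a cubic polynomial in n, which
  yields the power n^(-3).\<close>

lemma coeff_bound_of_third_deriv:
  assumes E: "E holomorphic_on ball 0 1" and sums: "\<And>z. norm z < 1 \<Longrightarrow> (\<lambda>n. e n * z ^ n) sums E z"
    and bd: "\<And>z. z \<in> ball 0 1 \<Longrightarrow> norm ((deriv ^^ 3) E z) \<le> C" and n: "n \<ge> 3"
  shows "norm (e n) \<le> 5 * C / real n ^ 3"
proof -
  define D where "D = (deriv ^^ 3) E"
  define m where "m = n - 3"
  have m: "n = m + 3" using n by (simp add: m_def)
  have D_hol: "D holomorphic_on ball 0 1" unfolding D_def by (intro holomorphic_higher_deriv E) auto
  have C: "C \<ge> 0" using bd[of 0] order_trans[OF norm_ge_zero] by simp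
  have "E has_fps_expansion Abs_fps e"
  proof (rule has_fps_expansionI)
    have "\<forall>\<^sub>F u in nhds (0::complex). u \<in> ball 0 1" by (intro eventually_nhds_in_open) auto
    then show "\<forall>\<^sub>F u in nhds 0. (\<lambda>n. fps_nth (Abs_fps e) n * u ^ n) sums E u"
      by eventually_elim (use sums in auto)
  qed
  then have "e n = (deriv ^^ n) E 0 / fact n"
    using fps_nth_fps_expansion[where f = E and F = "Abs_fps e"] by simp
  also have "(deriv ^^ n) E = (deriv ^^ m) D" unfolding D_def m by (simp add: funpow_add)
  finally have e: "norm (e n) * fact n = norm ((deriv ^^ m) D 0)" by (simp add: norm_divide)
  have "norm ((deriv ^^ m) D 0) * r ^ m \<le> fact m * C" if "r \<in> {0<..<1}" for r
  proof -
    have "norm ((deriv ^^ m) D 0) \<le> fact m * C / r ^ m"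
    proof (rule Cauchy_inequality)
      show "D holomorphic_on ball 0 r" using D_hol by (rule holomorphic_on_subset) (use that in auto)
      show "continuous_on (cball 0 r) D"
        using holomorphic_on_imp_continuous_on[OF D_hol] by (rule continuous_on_subset) (use that in auto)
      show "norm (D x) \<le> C" if "norm (0 - x) = r" for x
        using bd[of x] that \<open>r \<in> {0<..<1}\<close> by (auto simp: D_def)
    qed (use that in auto)
    then show ?thesis using that by (simp add: field_simps)
  qed
  then have "\<forall>\<^sub>F r in at_left 1. norm ((deriv ^^ m) D 0) * r ^ m \<le> fact m * C"
    by (rule eventually_mono[OF eventually_at_left_real[of 0 1], rotated]) auto
  moreover have "((\<lambda>r. norm ((deriv ^^ m) D 0) * r ^ m) \<longlongrightarrow> norm ((deriv ^^ m) D 0) * 1 ^ m) (at_left 1)"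
    by (intro tendsto_intros)
  ultimately have "norm ((deriv ^^ m) D 0) * 1 ^ m \<le> fact m * C"
    by (intro tendsto_upperbound[where F = "at_left (1::real)"] trivial_limit_at_left_real)
  then have "norm (e n) * fact n \<le> fact m * C" using e by simp
  moreover have "(fact n :: real) = fact m * ((real m + 1) * (real m + 2) * (real m + 3))"
  proof -
    have "n = Suc (Suc (Suc m))" using m by simp
    then have "(fact n :: real) = (real m + 3) * ((real m + 2) * ((real m + 1) * fact m))"
      by (simp only: fact_Suc) (simp add: add_ac)
    then show ?thesis by (simp only: mult_ac)
  qed
  ultimately have "norm (e n) * (fact m * ((real m + 1) * (real m + 2) * (real m + 3))) \<le> fact m * C"
    by simp
  then have "fact m * (norm (e n) * ((real m + 1) * (real m + 2) * (real m + 3))) \<le> fact m * C"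
    by (simp only: mult.left_commute)
  then have "norm (e n) * ((real m + 1) * (real m + 2) * (real m + 3)) \<le> C"
    by (subst (asm) mult_le_cancel_left_pos) auto
  \<comment> \<open>The quotient n^3 / (n (n - 1) (n - 2)) is largest at n = 3, where it equals 27/6
    < 5.\<close>
  moreover have "real n ^ 3 \<le> 5 * ((real m + 1) * (real m + 2) * (real m + 3))"
    unfolding m by (simp add: power3_eq_cube algebra_simps)
  then have "norm (e n) * real n ^ 3 \<le> norm (e n) * (5 * ((real m + 1) * (real m + 2) * (real m + 3)))"
    by (rule mult_left_mono) auto
  ultimately have "norm (e n) * real n ^ 3 \<le> 5 * C" by simp
  then show ?thesis using n by (simp add: field_simps)
qed

text \<open>\<open>B\<close> is analytic across u, so its derivatives are bounded near u;
  \<open>M\<close> is the singular remainder, which lives only on the side of the disc.\<close>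

lemma local_third_deriv_bound:
  assumes E: "E holomorphic_on ball 0 1" and U: "open U" "u \<in> U"
    and B: "B holomorphic_on U" and M: "M holomorphic_on U \<inter> ball 0 1"
    and eq: "\<And>z. z \<in> U \<inter> ball 0 1 \<Longrightarrow> E z = B z + M z"
    and bd: "\<And>z. z \<in> U \<inter> ball 0 1 \<Longrightarrow> norm ((deriv ^^ k) M z) \<le> C"
  shows "\<exists>U C. open U \<and> u \<in> U \<and> (\<forall>z\<in>U \<inter> ball 0 1. norm ((deriv ^^ k) E z) \<le> C)"
proof -
  obtain r where r: "r > 0" "cball u r \<subseteq> U" using U open_contains_cball by blast
  have "(deriv ^^ k) B holomorphic_on U" by (intro holomorphic_higher_deriv B U)
  then have "continuous_on (cball u r) ((deriv ^^ k) B)"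
    using r(2) holomorphic_on_imp_continuous_on continuous_on_subset by blast
  then obtain C1 where C1: "\<And>z. z \<in> cball u r \<Longrightarrow> norm ((deriv ^^ k) B z) \<le> C1"
    using bounded_on_compact[OF compact_cball] by blast
  let ?V = "U \<inter> ball 0 1"
  have V: "open ?V" using U by auto
  have BV: "B holomorphic_on ?V" and EV: "E holomorphic_on ?V"
    using B E by (auto intro: holomorphic_on_subset)
  show ?thesis
  proof (intro exI[of _ "ball u r"] exI[of _ "C1 + C"] conjI ballI)
    fix z assume z: "z \<in> ball u r \<inter> ball 0 1"
    then have zV: "z \<in> ?V" using r(2) by auto
    have "(deriv ^^ k) E z = (deriv ^^ k) (\<lambda>z. B z + M z) z"
      by (rule higher_deriv_transform_within_open[OF EV _ V zV eq])
        (intro holomorphic_intros BV M)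
    also have "\<dots> = (deriv ^^ k) B z + (deriv ^^ k) M z"
      by (rule higher_deriv_add[OF BV M V zV])
    finally show "norm ((deriv ^^ k) E z) \<le> C1 + C"
      using norm_triangle_ineq[of "(deriv ^^ k) B z" "(deriv ^^ k) M z"] C1[of z] bd[OF zV] z by auto
  qed (use r in auto)
qed

text \<open>On the unit circle Re (v / u) >= 1 happens only for v = u. Hence csqrt (1 - z / u) is
  analytic at every boundary point other than u, and the singular terms do not disturb each
  other.\<close>

lemma one_minus_quotient_notin_nonpos_Reals:
  fixes u v :: complex
  assumes "norm u = 1" "norm v = 1" "u \<noteq> v"
  shows "1 - v / u \<notin> \<real>\<^sub>\<le>\<^sub>0"
proof
  define w where "w = v / u"
  assume "1 - v / u \<in> \<real>\<^sub>\<le>\<^sub>0"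
  then have "Re w \<ge> 1" by (simp add: w_def complex_nonpos_Reals_iff)
  moreover have n: "norm w = 1" using assms by (simp add: w_def norm_divide)
  ultimately have Re: "Re w = 1" using abs_Re_le_cmod[of w] by simp
  have "(Re w)\<^sup>2 + (Im w)\<^sup>2 = 1" using n by (metis cmod_power2 one_power2)
  then have "w = 1" using Re by (simp add: complex_eq_iff)
  then show False using assms by (auto simp: w_def)
qed

text \<open>Darboux's method. Subtracting the terms of order 1, 3 and 5 in \<open>sqrt (1 - z / u)\<close> at every
  singular point \<open>u\<close> leaves a function whose third derivative is bounded in the unit disc, so its
  coefficients are of order \<open>1 / n ^ 3\<close>. This needs no continuation beyond the unit circle.\<close>

theorem sqrt_singularity_transfer:
  fixes f :: "nat \<Rightarrow> complex" and F :: "complex \<Rightarrow> complex"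
  assumes sums: "\<And>z. norm z < 1 \<Longrightarrow> (\<lambda>n. f n * z ^ n) sums F z"
    and F_hol: "F holomorphic_on ball 0 1"
    and \<Omega>: "finite \<Omega>" "\<And>u. u \<in> \<Omega> \<Longrightarrow> norm u = 1"
    and sym: "\<And>u z. u \<in> \<Omega> \<Longrightarrow> norm z < 1 \<Longrightarrow> F (u * z) = u * F z"
    and reg: "\<And>u. norm u = 1 \<Longrightarrow> u \<notin> \<Omega> \<Longrightarrow>
        \<exists>\<epsilon> h. \<epsilon> > 0 \<and> h holomorphic_on ball u \<epsilon> \<and> (\<forall>z\<in>ball u \<epsilon> \<inter> ball 0 1. F z = h z)"
    and sing: "\<epsilon> > 0" "\<eta> > 0" "H holomorphic_on ball 0 \<eta>"
      "\<And>z. z \<in> ball 1 \<epsilon> \<inter> ball 0 1 \<Longrightarrow> F z = H (csqrt (1 - z))"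
  shows "\<exists>C. \<forall>n\<ge>1. (\<forall>u\<in>\<Omega>. u ^ n = u) \<longrightarrow>
    norm (f n - of_nat (card \<Omega>) * deriv H 0 * of_real (sqrt_coeff 1 n)) \<le> C * \<bar>sqrt_coeff 1 n\<bar> / real n"
proof -
  obtain c K where K: "K holomorphic_on ball 0 \<eta>" "c 1 = deriv H 0"
    "\<And>s. s \<in> ball 0 \<eta> \<Longrightarrow> H s = (\<Sum>j<6. c j * s ^ j) + s ^ 6 * K s"
    using holomorphic_taylor_5[OF sing(3,2)] by blast
  define S where "S w = c 1 * csqrt (1 - w) ^ 1 + c 3 * csqrt (1 - w) ^ 3 + c 5 * csqrt (1 - w) ^ 5" for w
  \<comment> \<open>By \<open>sym\<close>, the expansion of F at u is u times its expansion at 1 in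
    the variable z / u; this gives the form of the subtracted terms.\<close>
  define E where "E z = F z - (\<Sum>u\<in>\<Omega>. u * S (z / u))" for z
  have u0: "u \<noteq> 0" if "u \<in> \<Omega>" for u using \<Omega>(2)[OF that] by auto
  have S_hol: "(\<lambda>z. S (z / u)) holomorphic_on X" if "\<And>z. z \<in> X \<Longrightarrow> 1 - z / u \<notin> \<real>\<^sub>\<le>\<^sub>0" "u \<noteq> 0" for X u
    unfolding S_def using that by (intro holomorphic_intros) auto
  have E_hol: "E holomorphic_on ball 0 1"
    unfolding E_def
    by (intro holomorphic_intros F_hol S_hol u0) (use \<Omega>(2) Re_one_minus_quotient_pos in auto)
  have loc: "\<exists>U C. open U \<and> v \<in> U \<and> (\<forall>z\<in>U \<inter> ball 0 1. norm ((deriv ^^ 3) E z) \<le> C)" if v: "norm v = 1" for v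
  proof -
    \<comment> \<open>A neighbourhood of \<open>v\<close> on which the terms subtracted for the
      other singular points are holomorphic.\<close>
    define U where "U = (\<Inter>u\<in>\<Omega> - {v}. {z. 1 - z / u \<in> - \<real>\<^sub>\<le>\<^sub>0})"
    have U_open: "open U" unfolding U_def
    proof (intro open_INT ballI)
      fix u assume "u \<in> \<Omega> - {v}"
      then have "continuous_on UNIV (\<lambda>z. 1 - z / u)" using u0 by (intro continuous_intros) auto
      from open_vimage[OF _ this, of "- \<real>\<^sub>\<le>\<^sub>0"] show "open {z. 1 - z / u \<in> - \<real>\<^sub>\<le>\<^sub>0}"
        by (simp add: vimage_def open_Compl)
    qed (use \<Omega> in auto)
    have vU: "v \<in> U" using one_minus_quotient_notin_nonpos_Reals \<Omega>(2) v by (auto simp: U_def)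
    define Rest where "Rest z = (\<Sum>u\<in>\<Omega> - {v}. u * S (z / u))" for z
    have Rest_hol: "Rest holomorphic_on U"
      unfolding Rest_def by (intro holomorphic_intros S_hol) (use u0 in \<open>auto simp: U_def\<close>)
    show ?thesis
    proof (cases "v \<in> \<Omega>")
      case False
      obtain e h where h: "e > 0" "h holomorphic_on ball v e" "\<And>z. z \<in> ball v e \<inter> ball 0 1 \<Longrightarrow> F z = h z"
        using reg[OF v False] by blast
      have "\<Omega> - {v} = \<Omega>" using False by auto
      then have "E z = (h z - Rest z) + 0" if "z \<in> (ball v e \<inter> U) \<inter> ball 0 1" for z
        using h(3)[of z] that by (simp add: E_def Rest_def)
      then show ?thesis
        using h(1) vU U_open
        by (intro local_third_deriv_bound[OF E_hol, of "ball v e \<inter> U" v "\<lambda>z. h z - Rest z" "\<lambda>_. 0" _ 0]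
            holomorphic_intros holomorphic_on_subset[OF h(2)] holomorphic_on_subset[OF Rest_hol]) auto
    next
      case True
      \<comment> \<open>Halving \<open>\<eta>\<close> keeps s in a compact ball, on which
        \<open>K3\<close> is bounded.\<close>
      define e where "e = min \<epsilon> ((\<eta> / 2)\<^sup>2)"
      have e: "e > 0" "e \<le> \<epsilon>" "e \<le> (\<eta> / 2)\<^sup>2" using sing by (auto simp: e_def)
      define s where "s z = csqrt (1 - z / v)" for z
      have v0: "v \<noteq> 0" using u0 True by auto
      have s_sq: "(s z)\<^sup>2 = 1 - z / v" for z by (simp add: s_def)
      have norm_s: "norm (s z) < \<eta> / 2" if "z \<in> ball v e" for z
      proof -
        have "(norm (s z))\<^sup>2 = norm (1 - z / v)" by (metis norm_power s_sq)
        also have "1 - z / v = (v - z) / v" using v0 by (simp add: field_simps)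
        also have "norm \<dots> = norm (v - z)" using v by (simp add: norm_divide)
        also have "\<dots> < (\<eta> / 2)\<^sup>2" using that e by (simp add: dist_norm)
        finally show ?thesis by (rule power_less_imp_less_base) (use sing(2) in simp)
      qed
      have s_ball: "s z \<in> ball 0 \<eta>" if "z \<in> ball v e" for z using norm_s[OF that] sing(2) by simp
      define K' where "K' w = v * K w" for w
      have K'_hol: "K' holomorphic_on ball 0 \<eta>" unfolding K'_def by (intro holomorphic_intros K(1))
      define V where "V = (ball v e \<inter> U) \<inter> ball 0 1"
      have V: "open V" "V \<subseteq> ball 0 1" using U_open by (auto simp: V_def)
      have sV: "s z \<in> ball 0 \<eta>" if "z \<in> V" for z using s_ball that by (auto simp: V_def)
      define M where "M z = s z ^ 6 * K' (s z)" for z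
      \<comment> \<open>Even powers of s are polynomials in z, so they belong to the analytic
        part.\<close>
      define B where "B z = v * (c 0 + c 2 * (1 - z / v) + c 4 * (1 - z / v)\<^sup>2) - Rest z" for z
      obtain K3 where K3: "K3 holomorphic_on ball 0 \<eta>" "\<And>z. z \<in> V \<Longrightarrow> (deriv ^^ 3) M z = K3 (s z)"
        using csqrt_power_6_third_deriv[OF v V sV[unfolded s_def] K'_hol] unfolding M_def s_def by blast
      have "continuous_on (cball 0 (\<eta> / 2)) K3"
        using holomorphic_on_imp_continuous_on[OF K3(1)] by (rule continuous_on_subset) (use sing(2) in auto)
      then obtain C where "\<forall>x\<in>cball 0 (\<eta> / 2). norm (K3 x) \<le> C"
        using bounded_on_compact[OF compact_cball] by blast
      then have C: "\<And>w. norm w \<le> \<eta> / 2 \<Longrightarrow> norm (K3 w) \<le> C" by simp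
      have M_hol: "M holomorphic_on V"
        unfolding holomorphic_on_open[OF V(1)]
      proof
        fix z assume z: "z \<in> V"
        then have "norm z < 1" using V(2) by auto
        from csqrt_power_has_derivative[OF v this sV[OF z, unfolded s_def] K'_hol, of 4]
        show "\<exists>f'. (M has_field_derivative f') (at z)"
          unfolding M_def s_def by (intro exI) simp
      qed
      have eq: "E z = B z + M z" if z: "z \<in> (ball v e \<inter> U) \<inter> ball 0 1" for z
      proof -
        have nz: "norm (z / v) < 1" "z / v \<in> ball 1 \<epsilon>"
        proof -
          show "norm (z / v) < 1" using z v by (simp add: norm_divide)
          have "1 - z / v = (v - z) / v" using v0 by (simp add: field_simps)
          then have "norm (1 - z / v) = norm (v - z)" using v by (simp add: norm_divide)
          then show "z / v \<in> ball 1 \<epsilon>" using z e by (simp add: dist_norm)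
        qed
        have "F z = v * F (z / v)" using sym[OF True nz(1)] v0 by simp
        also have "F (z / v) = H (s z)" using sing(4)[of "z / v"] nz by (simp add: s_def)
        also have "\<dots> = (\<Sum>j<6. c j * s z ^ j) + s z ^ 6 * K (s z)" using K(3) s_ball z by auto
        finally have Fz: "F z = v * ((\<Sum>j<6. c j * s z ^ j) + s z ^ 6 * K (s z))" .
        have 1: "(\<Sum>u\<in>\<Omega>. u * S (z / u)) = v * S (z / v) + Rest z"
          unfolding Rest_def using True \<Omega>(1) by (subst sum.remove[of _ v]) auto
        have 2: "S (z / v) = c 1 * s z ^ 1 + c 3 * s z ^ 3 + c 5 * s z ^ 5"
          by (simp add: S_def s_def)
        have 3: "(\<Sum>j<6. c j * s z ^ j) = c 0 + c 1 * s z ^ 1 + c 2 * s z ^ 2 + c 3 * s z ^ 3 + c 4 * s z ^ 4 + c 5 * s z ^ 5"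
          by (simp add: lessThan_nat_numeral lessThan_Suc add_ac)
        have 4: "B z = v * (c 0 + c 2 * s z ^ 2 + c 4 * s z ^ 4) - Rest z"
        proof -
          have "s z ^ 4 = ((s z)\<^sup>2)\<^sup>2" by (simp flip: power_mult)
          then show ?thesis unfolding B_def s_sq by simp
        qed
        show ?thesis
          unfolding E_def Fz 1 2 3 4 M_def K'_def
          by (simp only: distrib_left diff_conv_add_uminus minus_add_distrib mult_ac add_ac) simp
      qed
      show ?thesis
      proof (rule local_third_deriv_bound[OF E_hol, of "ball v e \<inter> U" v B M])
        show "B holomorphic_on ball v e \<inter> U"
          unfolding B_def by (intro holomorphic_intros holomorphic_on_subset[OF Rest_hol]) (use v0 in auto)
        show "norm ((deriv ^^ 3) M z) \<le> C" if "z \<in> (ball v e \<inter> U) \<inter> ball 0 1" for z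
          using K3(2)[of z] C[of "s z"] norm_s[of z] that by (auto simp: V_def)
      qed (use e vU U_open eq M_hol in \<open>auto simp: V_def\<close>)
    qed
  qed
  obtain C where C: "\<And>z. z \<in> ball 0 1 \<Longrightarrow> norm ((deriv ^^ 3) E z) \<le> C"
    using third_deriv_bounded_of_local[OF E_hol loc] by blast
  define S_coeff where "S_coeff n = c 1 * of_real (sqrt_coeff 1 n) + c 3 * of_real (sqrt_coeff 3 n) + c 5 * of_real (sqrt_coeff 5 n)" for n
  define e where "e n = f n - (\<Sum>u\<in>\<Omega>. u * ((1 / u) ^ n * S_coeff n))" for n
  have S_sums: "(\<lambda>n. S_coeff n * w ^ n) sums S w" if "norm w < 1" for w
    unfolding S_coeff_def S_def distrib_right mult.assoc
    by (intro sums_add sums_mult csqrt_power_sums that)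
  have e_sums: "(\<lambda>n. e n * z ^ n) sums E z" if "norm z < 1" for z
  proof -
    have "(\<lambda>n. f n * z ^ n - (\<Sum>u\<in>\<Omega>. u * (S_coeff n * (z / u) ^ n))) sums E z"
      unfolding E_def
      by (intro sums_diff sums_sum sums_mult sums S_sums that) (use \<Omega>(2) that in \<open>auto simp: norm_divide\<close>)
    moreover have "f n * z ^ n - (\<Sum>u\<in>\<Omega>. u * (S_coeff n * (z / u) ^ n)) = e n * z ^ n" for n
    proof -
      have "(\<Sum>u\<in>\<Omega>. u * (S_coeff n * (z / u) ^ n)) = (\<Sum>u\<in>\<Omega>. u * ((1 / u) ^ n * S_coeff n)) * z ^ n"
        unfolding sum_distrib_right by (intro sum.cong) (simp_all add: power_divide)
      then show ?thesis by (simp add: e_def left_diff_distrib)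
    qed
    ultimately show ?thesis by simp
  qed
  have e_bound: "norm (e n) \<le> 5 * C / real n ^ 3" if "n \<ge> 3" for n
    by (rule coeff_bound_of_third_deriv[OF E_hol e_sums C that])
  have C0: "C \<ge> 0" using order_trans[OF norm_ge_zero C[of 0]] by simp
  define A where "A = real (card \<Omega>) * (6 * norm (c 3) + 30 * norm (c 5)) + 10 * C + 4 * norm (e 1) + 16 * norm (e 2)"
  show ?thesis
  proof (intro exI[of _ A] allI impI)
    fix n :: nat assume n: "n \<ge> 1" and good: "\<forall>u\<in>\<Omega>. u ^ n = u"
    let ?d = "f n - of_nat (card \<Omega>) * deriv H 0 * of_real (sqrt_coeff 1 n)"
    define \<beta> where "\<beta> = \<bar>sqrt_coeff 1 n\<bar>"
    have \<beta>: "1 / (2 * real n ^ 2) \<le> \<beta>" unfolding \<beta>_def by (rule sqrt_coeff_1_lower[OF n])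
    define q where "q = \<beta> / real n"
    have q3: "1 / real n ^ 3 \<le> 2 * q"
    proof -
      have "1 / real n ^ 3 = 2 * (1 / (2 * real n ^ 2) / real n)"
        by (simp add: power2_eq_square power3_eq_cube)
      also have "\<dots> \<le> 2 * (\<beta> / real n)"
        by (rule mult_left_mono[OF divide_right_mono[OF \<beta>]]) auto
      finally show ?thesis by (simp add: q_def)
    qed
    \<comment> \<open>The bound from the third derivative starts at n = 3. The terms with
      \<open>e 1\<close> and \<open>e 2\<close> extend norm (e n) <= P / n^3 to n = 1 and n = 2; the
      factor 8 is 2^3.\<close>
    define P where "P = 5 * C + 2 * norm (e 1) + 8 * norm (e 2)"
    have P: "5 * C \<le> P" "norm (e 1) \<le> P" "8 * norm (e 2) \<le> P" "P \<ge> 0"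
      using C0 norm_ge_zero[of "e 1"] norm_ge_zero[of "e 2"] unfolding P_def
      by (simp_all add: add_nonneg_nonneg)
    have e_n: "norm (e n) \<le> P * (2 * q)"
    proof -
      have "norm (e n) \<le> P * (1 / real n ^ 3)"
      proof (cases "n \<ge> 3")
        case True
        then show ?thesis using e_bound[OF True] divide_right_mono[OF P(1), of "real n ^ 3"] by simp
      next
        case False
        then have "n = 1 \<or> n = 2" using n by auto
        then show ?thesis using P by auto
      qed
      also have "\<dots> \<le> P * (2 * q)"
        by (rule mult_left_mono[OF q3 P(4)])
      finally show ?thesis .
    qed
    have s3: "\<bar>sqrt_coeff 3 n\<bar> \<le> 6 * q" using sqrt_coeff_3[OF n] by (simp add: q_def \<beta>_def)
    have s5: "\<bar>sqrt_coeff 5 n\<bar> \<le> 30 * q" using sqrt_coeff_5[OF n] by (simp add: q_def \<beta>_def)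
    \<comment> \<open>For admissible n the rotations cancel: every point of \<open>\<Omega>\<close>
      contributes the same amount, and the leading constant acquires the factor
      \<open>card \<Omega>\<close>.\<close>
    have "u * ((1 / u) ^ n * x) = x" if "u \<in> \<Omega>" for u x
      using good that u0[OF that] by (simp add: power_divide)
    then have "(\<Sum>u\<in>\<Omega>. u * ((1 / u) ^ n * S_coeff n)) = (\<Sum>u\<in>\<Omega>. S_coeff n)"
      by (intro sum.cong refl)
    then have "e n = f n - of_nat (card \<Omega>) * S_coeff n" by (simp add: e_def)
    then have fn: "?d
       = e n + of_nat (card \<Omega>) * (c 3 * of_real (sqrt_coeff 3 n) + c 5 * of_real (sqrt_coeff 5 n))"
      by (simp add: S_coeff_def K(2) algebra_simps del: One_nat_def)
    have "norm ?d \<le> norm (e n) + norm (of_nat (card \<Omega>) * (c 3 * of_real (sqrt_coeff 3 n) + c 5 * of_real (sqrt_coeff 5 n)))"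
      unfolding fn by (rule norm_triangle_ineq)
    also have "\<dots> = norm (e n) + real (card \<Omega>) * norm (c 3 * of_real (sqrt_coeff 3 n) + c 5 * of_real (sqrt_coeff 5 n))"
      by (simp add: norm_mult)
    also have "\<dots> \<le> norm (e n) + real (card \<Omega>) * (norm (c 3 * of_real (sqrt_coeff 3 n)) + norm (c 5 * of_real (sqrt_coeff 5 n)))"
      by (intro add_left_mono mult_left_mono norm_triangle_ineq) simp
    also have "\<dots> = norm (e n) + real (card \<Omega>) * (norm (c 3) * \<bar>sqrt_coeff 3 n\<bar> + norm (c 5) * \<bar>sqrt_coeff 5 n\<bar>)"
      by (simp add: norm_mult)
    also have "\<dots> \<le> P * (2 * q) + real (card \<Omega>) * (norm (c 3) * (6 * q) + norm (c 5) * (30 * q))"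
    proof -
      have "norm (c 3) * \<bar>sqrt_coeff 3 n\<bar> + norm (c 5) * \<bar>sqrt_coeff 5 n\<bar> \<le> norm (c 3) * (6 * q) + norm (c 5) * (30 * q)"
        using mult_left_mono[OF s3 norm_ge_zero[of "c 3"]] mult_left_mono[OF s5 norm_ge_zero[of "c 5"]]
        by (rule add_mono)
      from mult_left_mono[OF this of_nat_0_le_iff[of "card \<Omega>"]] e_n show ?thesis by linarith
    qed
    also have "\<dots> = A * q" by (simp add: A_def P_def algebra_simps)
    finally show "norm ?d \<le> A * \<bar>sqrt_coeff 1 n\<bar> / real n"
      by (simp add: \<beta>_def q_def)
  qed
qed

context sqrt_singularity begin

text \<open>The dominant singularities. Describing them by the support of \<open>p\<close> makes it unnecessary to
  introduce the period of the offspring distribution.\<close>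

definition \<Omega> :: "complex set" where
  "\<Omega> = {u. norm u = 1 \<and> (\<forall>k. p k > 0 \<longrightarrow> u ^ k = 1)}"

lemma one_in_\<Omega>: "1 \<in> \<Omega>"
  by (simp add: \<Omega>_def)

lemma finite_\<Omega>: "finite \<Omega>"
proof -
  obtain k where k: "k \<ge> 2" "p k > 0" using p_nonlinear by blast
  have "finite {u :: complex. u ^ k = 1}"
    using k by (intro finite_roots_unity) auto
  then show ?thesis
    by (rule finite_subset[rotated]) (use k in \<open>auto simp: \<Omega>_def\<close>)
qed

text \<open>The transfer is applied to Y - g, whose coefficients are the wanted ones. Since g is
  analytic beyond the circle, it leaves the kind of each boundary point unchanged. The support
  condition gives the rotation rule F (u z) = u F z.\<close>

theorem coefficient_asymptotics_complex:
  assumes b_le_a: "\<And>n. b n \<le> a n" and a_supp: "\<And>n u. a n \<noteq> 0 \<Longrightarrow> u \<in> \<Omega> \<Longrightarrow> u ^ n = u"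
  shows "\<exists>c C. c \<noteq> 0 \<and> (\<forall>n\<ge>1. (\<forall>u\<in>\<Omega>. u ^ n = u) \<longrightarrow>
    norm (complex_of_real (a n - b n) - c * of_real (sqrt_coeff 1 n)) \<le> C * \<bar>sqrt_coeff 1 n\<bar> / real n)"
proof -
  define f where "f n = complex_of_real (a n - b n)" for n
  define F where "F z = Y z - g z" for z
  have sums: "(\<lambda>n. f n * z ^ n) sums F z" if "norm z < 1" for z
    unfolding f_def F_def of_real_diff left_diff_distrib pseries_def
    by (intro sums_diff summable_sums pseries_summable_norm(2)[OF a_nonneg a_summable]
        pseries_summable_norm(2)[OF b_nonneg b_summable])
      (use that R0 in auto)
  have g_hol1: "g holomorphic_on X" if "X \<subseteq> ball 0 R0" for X
    using g_hol that by (rule holomorphic_on_subset)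
  have F_hol: "F holomorphic_on ball 0 1"
    unfolding F_def by (intro holomorphic_intros Y_hol g_hol1) (use R0 in auto)
  have b_supp: "b n = 0" if "a n = 0" for n using b_le_a[of n] b_nonneg[of n] that by simp
  have symm: "F (u * z) = u * F z" if u: "u \<in> \<Omega>" and z: "norm z < 1" for u z
  proof -
    have "f n * (u * z) ^ n = u * (f n * z ^ n)" for n
      using a_supp[OF _ u, of n] b_supp[of n] by (cases "a n = 0") (auto simp: f_def power_mult_distrib)
    then have "(\<lambda>n. f n * (u * z) ^ n) sums (u * F z)"
      using sums_mult[OF sums[OF z], of u] by (simp only:)
    moreover have "norm (u * z) < 1" using u z by (simp add: \<Omega>_def norm_mult)
    ultimately show ?thesis using sums sums_unique2 by blast
  qed
  have reg: "\<exists>\<epsilon> h. \<epsilon> > 0 \<and> h holomorphic_on ball u \<epsilon> \<and> (\<forall>z\<in>ball u \<epsilon> \<inter> ball 0 1. F z = h z)"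
    if u: "norm u = 1" "u \<notin> \<Omega>" for u
  proof -
    obtain k where k: "p k > 0" "u ^ k \<noteq> 1" using u by (auto simp: \<Omega>_def)
    obtain e h where h: "e > 0" "h holomorphic_on ball u e" "\<And>z. z \<in> ball u e \<inter> ball 0 1 \<Longrightarrow> Y z = h z"
      using regular_point[OF u(1) k] by blast
    have sub: "ball u (min e (R0 - 1)) \<subseteq> ball 0 R0"
      using norm_less_of_ball[of _ u "R0 - 1" R0] u by auto
    show ?thesis
      by (intro exI[of _ "min e (R0 - 1)"] exI[of _ "\<lambda>z. h z - g z"] conjI ballI holomorphic_intros
          g_hol1[OF sub] holomorphic_on_subset[OF h(2)]) (use h R0 in \<open>auto simp: F_def\<close>)
  qed
  obtain \<epsilon> \<eta> H where H: "\<epsilon> > 0" "\<eta> > 0" "H holomorphic_on ball 0 \<eta>" "deriv H 0 \<noteq> 0"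
    "\<And>z. z \<in> ball 1 \<epsilon> \<inter> ball 0 1 \<Longrightarrow> norm (csqrt (1 - z)) < \<eta> \<and> Y z = H (csqrt (1 - z))"
    using singular_point by blast
  define \<eta>' where "\<eta>' = min \<eta> (sqrt (R0 - 1))"
  have \<eta>': "\<eta>' > 0" using H R0 by (simp add: \<eta>'_def)
  \<comment> \<open>With z = 1 - s^2 the contribution of g is an even function of s, so it does not
    change the derivative at 0.\<close>
  define H' where "H' s = H s - g (1 - s\<^sup>2)" for s
  have R0_bd: "norm (1 - s\<^sup>2) < R0" if "s \<in> ball 0 \<eta>'" for s :: complex
  proof -
    have "norm s < sqrt (R0 - 1)" using that by (simp add: \<eta>'_def)
    then have "(norm s)\<^sup>2 < (sqrt (R0 - 1))\<^sup>2" by (intro power_strict_mono) auto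
    then have "norm (s\<^sup>2) < R0 - 1" using R0 by (simp add: norm_power)
    then show ?thesis using norm_triangle_ineq4[of 1 "s\<^sup>2"] by simp
  qed
  have H'_hol: "H' holomorphic_on ball 0 \<eta>'"
    unfolding H'_def
    by (intro holomorphic_intros holomorphic_on_subset[OF H(3)] holomorphic_on_compose_gen[OF _ g_hol, unfolded o_def])
      (use R0_bd in \<open>auto simp: \<eta>'_def\<close>)
  have dH': "deriv H' 0 = deriv H 0"
  proof -
    have "(H has_field_derivative deriv H 0) (at 0)"
      using H by (intro holomorphic_derivI[of H "ball 0 \<eta>"]) auto
    moreover have "((\<lambda>s. g (1 - s\<^sup>2)) has_field_derivative pseries (diffs b) (1 - 0\<^sup>2) * 0) (at 0)"
    proof (rule DERIV_chain2[of g _ "\<lambda>s. 1 - s\<^sup>2" 0 0 UNIV])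
      show "(g has_field_derivative pseries (diffs b) (1 - 0\<^sup>2)) (at (1 - 0\<^sup>2))"
        by (rule g_deriv) (use R0 in simp)
      show "((\<lambda>s. 1 - s\<^sup>2) has_field_derivative 0) (at (0 :: complex))"
        by (auto intro!: derivative_eq_intros)
    qed
    ultimately have "(H' has_field_derivative deriv H 0 - pseries (diffs b) (1 - 0\<^sup>2) * 0) (at 0)"
      unfolding H'_def by (rule DERIV_diff)
    then show ?thesis by (simp add: DERIV_imp_deriv)
  qed
  have "\<exists>C. \<forall>n\<ge>1. (\<forall>u\<in>\<Omega>. u ^ n = u) \<longrightarrow>
    norm (f n - of_nat (card \<Omega>) * deriv H' 0 * of_real (sqrt_coeff 1 n)) \<le> C * \<bar>sqrt_coeff 1 n\<bar> / real n"
  proof (rule sqrt_singularity_transfer[OF sums F_hol finite_\<Omega> _ symm reg H(1) \<eta>' H'_hol])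
    show "norm u = 1" if "u \<in> \<Omega>" for u using that by (simp add: \<Omega>_def)
    fix z assume z: "z \<in> ball (1 :: complex) \<epsilon> \<inter> ball 0 1"
    show "F z = H' (csqrt (1 - z))"
      using H(5)[OF z] by (simp add: F_def H'_def)
  qed auto
  moreover have "of_nat (card \<Omega>) * deriv H' 0 \<noteq> 0"
    using H(4) dH' finite_\<Omega> one_in_\<Omega> by auto
  ultimately show ?thesis unfolding f_def by blast
qed

text \<open>Positivity of the constant is read off from the coefficients: they are real and
  nonnegative, and along the infinite set \<open>N\<close> the error C / n forces the imaginary part
  to vanish and the real part not to be negative, while the constant is nonzero. The sign changes
  because the coefficients of sqrt (1 - z) are negative for n >= 1.\<close>

theorem coefficient_asymptotics:
  assumes b_le_a: "\<And>n. b n \<le> a n" and a_supp: "\<And>n u. a n \<noteq> 0 \<Longrightarrow> u \<in> \<Omega> \<Longrightarrow> u ^ n = u"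
    and N: "infinite N" "\<And>n u. n \<in> N \<Longrightarrow> u \<in> \<Omega> \<Longrightarrow> u ^ n = u"
  obtains c C where "c > 0"
    "\<And>n. n \<in> N \<Longrightarrow> n \<ge> 1 \<Longrightarrow> \<bar>(a n - b n) - c * \<bar>sqrt_coeff 1 n\<bar>\<bar> \<le> C * \<bar>sqrt_coeff 1 n\<bar> / real n"
proof -
  obtain c0 C where c0: "c0 \<noteq> 0" and bd: "\<And>n. n \<ge> 1 \<Longrightarrow> n \<in> N \<Longrightarrow>
     norm (complex_of_real (a n - b n) - c0 * of_real (sqrt_coeff 1 n)) \<le> C * \<bar>sqrt_coeff 1 n\<bar> / real n"
    using coefficient_asymptotics_complex[OF b_le_a a_supp] N(2) by metis
  define c where "c = - c0"
  define \<beta> where "\<beta> n = \<bar>sqrt_coeff 1 n\<bar>" for n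
  have \<beta>: "\<beta> n > 0" if "n \<ge> 1" for n
    using sqrt_coeff_1_pos[OF that] by (simp add: \<beta>_def)
  have bd': "norm (complex_of_real (a n - b n) - c * of_real (\<beta> n)) \<le> C * \<beta> n / real n"
    if "n \<ge> 1" "n \<in> N" for n
    using bd[OF that] abs_sqrt_coeff_1[OF that(1)] by (simp add: c_def \<beta>_def)
  have Re_Im: "\<bar>(a n - b n) - Re c * \<beta> n\<bar> \<le> C * \<beta> n / real n" "\<bar>Im c\<bar> \<le> C / real n" "- C / real n \<le> Re c"
    if n: "n \<ge> 1" "n \<in> N" for n
  proof -
    show 1: "\<bar>(a n - b n) - Re c * \<beta> n\<bar> \<le> C * \<beta> n / real n"
      using order_trans[OF abs_Re_le_cmod bd'[OF n]] by simp
    have "\<bar>Im c * \<beta> n\<bar> \<le> C * \<beta> n / real n"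
      using order_trans[OF abs_Im_le_cmod bd'[OF n]] by simp
    then have "\<bar>Im c\<bar> * \<beta> n \<le> (C / real n) * \<beta> n" using \<beta>[OF n(1)] by (simp add: abs_mult)
    then show "\<bar>Im c\<bar> \<le> C / real n" using \<beta>[OF n(1)] by (rule mult_right_le_imp_le)
    have "0 \<le> a n - b n" using b_le_a[of n] by simp
    then have "(- C / real n) * \<beta> n \<le> Re c * \<beta> n" using 1 by simp
    then show "- C / real n \<le> Re c" using \<beta>[OF n(1)] by (rule mult_right_le_imp_le)
  qed
  have lim: "x = 0" if "\<And>n. n \<ge> 1 \<Longrightarrow> n \<in> N \<Longrightarrow> x \<le> C / real n" "x \<ge> 0" for x :: real
  proof (rule ccontr)
    assume "x \<noteq> 0"
    then have x: "x > 0" using that by simp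
    obtain m where m: "C / x < real m" using reals_Archimedean2 by blast
    obtain n where n: "n \<in> N" "n > Suc m" using N(1) infinite_nat_iff_unbounded by blast
    have "x \<le> C / real n" using that(1)[of n] n by simp
    then have "real n \<le> C / x" using n x by (simp add: field_simps)
    then show False using m n by simp
  qed
  have "\<bar>Im c\<bar> = 0" by (rule lim) (use Re_Im in auto)
  moreover have "max 0 (- Re c) = 0"
    by (rule lim) (use Re_Im order_trans[OF abs_ge_zero Re_Im(2)] in fastforce)+
  moreover have "c \<noteq> 0" using c0 by (simp add: c_def)
  ultimately have "Re c > 0" by (auto simp: complex_eq_iff)
  then show ?thesis using that[of "Re c" C] Re_Im(1) by (simp add: \<beta>_def)
qed

end

section \<open>Plane trees and their generating functions\<close>

datatype plane_tree = Node "plane_tree list"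

instance plane_tree :: countable by countable_datatype

fun tree_size :: "plane_tree \<Rightarrow> nat" where
  "tree_size (Node ts) = Suc (\<Sum>t\<leftarrow>ts. tree_size t)"

fun subtree_count :: "plane_tree \<Rightarrow> nat" where
  "subtree_count (Node ts) = (\<Prod>t\<leftarrow>ts. 1 + subtree_count t)"

fun tree_weight :: "(nat \<Rightarrow> real) \<Rightarrow> plane_tree \<Rightarrow> real" where
  "tree_weight p (Node ts) = p (length ts) * (\<Prod>t\<leftarrow>ts. tree_weight p t)"

text \<open>Truncation by height turns partial sums over trees into successive iterates of the
  functional equation. At bound 0 there is no tree at all, so the iteration starts from 0.\<close>

fun height_le :: "nat \<Rightarrow> plane_tree \<Rightarrow> bool" where
  "height_le 0 t = False"
| "height_le (Suc h) (Node ts) = (\<forall>t\<in>set ts. height_le h t)"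

lemma height_le_mono: "height_le h t \<Longrightarrow> h \<le> h' \<Longrightarrow> height_le h' t"
proof (induction h t arbitrary: h' rule: height_le.induct)
  case (2 h ts)
  then show ?case by (cases h') auto
qed auto

lemma ex_height_le: "\<exists>h. height_le h t"
proof (induction t)
  case (Node ts)
  then obtain H where H: "\<And>t. t \<in> set ts \<Longrightarrow> height_le (H t) t" by metis
  have "height_le (Max (insert 0 (H ` set ts))) t" if "t \<in> set ts" for t
    by (rule height_le_mono[OF H[OF that]]) (use that in auto)
  then have "height_le (Suc (Max (insert 0 (H ` set ts)))) (Node ts)" by simp
  then show ?case by blast
qed

lemma tree_size_pos: "tree_size t > 0" by (cases t) auto

lemma subtree_count_pos: "subtree_count t \<ge> 1"
proof (induction t)
  case (Node ts)
  have "(\<Prod>t\<leftarrow>ts. 1 + subtree_count t) > 0"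
    by (induction ts) auto
  then show ?case by simp
qed

text \<open>The summand 1 strengthens the bound so that it multiplies over the branches. It yields
  R(T) <= 2^|T|, and hence a positive radius of convergence for every moment.\<close>

lemma subtree_count_less: "1 + subtree_count t \<le> 2 ^ tree_size t"
proof (induction t)
  case (Node ts)
  have "(\<Prod>t\<leftarrow>ts. 1 + subtree_count t) \<le> 2 ^ (\<Sum>t\<leftarrow>ts. tree_size t)"
    using Node
  proof (induction ts)
    case (Cons t ts)
    then have "(1 + subtree_count t) * (\<Prod>t\<leftarrow>ts. 1 + subtree_count t)
        \<le> 2 ^ tree_size t * 2 ^ (\<Sum>t\<leftarrow>ts. tree_size t)"
      by (intro mult_mono) auto
    then show ?case by (simp add: power_add)
  qed simp
  moreover have "1 \<le> (2 :: nat) ^ (\<Sum>t\<leftarrow>ts. tree_size t)" by simp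
  ultimately have "1 + (\<Prod>t\<leftarrow>ts. 1 + subtree_count t) \<le> 2 * 2 ^ (\<Sum>t\<leftarrow>ts. tree_size t)"
    by linarith
  then show ?case by simp
qed

lemma tree_weight_nonneg: "(\<And>k. p k \<ge> 0) \<Longrightarrow> tree_weight p t \<ge> 0"
proof (induction t)
  case (Node ts)
  have "(\<Prod>t\<leftarrow>ts. tree_weight p t) \<ge> 0"
    using Node by (induction ts) auto
  then show ?case using Node by simp
qed

lemma finite_tree_size: "finite {t. tree_size t = n}"
proof (induction n rule: less_induct)
  case (less n)
  let ?L = "{ts. set ts \<subseteq> (\<Union>k<n. {t. tree_size t = k}) \<and> length ts \<le> n}"
  have "finite ?L"
    by (rule finite_lists_length_le) (use less in auto)
  moreover have "{t. tree_size t = n} \<subseteq> Node ` ?L"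
  proof
    fix t assume "t \<in> {t. tree_size t = n}"
    then obtain ts where t: "t = Node ts" "n = Suc (\<Sum>t\<leftarrow>ts. tree_size t)" by (cases t) auto
    have "tree_size t < n" if "t \<in> set ts" for t
      using member_le_sum_list[of "tree_size t" "map tree_size ts"] that t by auto
    moreover have "length ts \<le> (\<Sum>t\<leftarrow>ts. tree_size t)"
    proof (induction ts)
      case (Cons a ts)
      then show ?case using tree_size_pos[of a] by simp
    qed simp
    ultimately show "t \<in> Node ` ?L" using t by auto
  qed
  ultimately show ?case by (meson finite_imageI finite_subset)
qed

section \<open>Sums over trees as nonnegative integrals for the counting measure\<close>

lemma nn_integral_lists_length:
  fixes w :: "'a :: countable \<Rightarrow> ennreal"
  shows "(\<integral>\<^sup>+ts. indicator {ts. length ts = k} ts * (\<Prod>t\<leftarrow>ts. w t) \<partial>count_space UNIV)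
    = (\<integral>\<^sup>+t. w t \<partial>count_space UNIV) ^ k"
proof (induction k)
  case 0
  have "(\<integral>\<^sup>+ts. indicator {ts. length ts = 0} ts * (\<Prod>t\<leftarrow>ts. w t) \<partial>count_space UNIV)
      = (\<integral>\<^sup>+ts. (\<Prod>t\<leftarrow>ts. w t) * indicator {[]} ts \<partial>count_space UNIV)"
    by (intro nn_integral_cong) (auto simp: indicator_def)
  then show ?case by simp
next
  case (Suc k)
  let ?h = "\<lambda>ts. indicator {ts. length ts = Suc k} ts * (\<Prod>t\<leftarrow>ts. w t)"
  let ?cons = "\<lambda>(t :: 'a, ts). t # ts"
  have "(\<integral>\<^sup>+ts. ?h ts \<partial>count_space UNIV) = (\<integral>\<^sup>+ts. ?h ts \<partial>count_space (range ?cons))"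
  proof (rule nn_integral_count_space_eq)
    fix ts :: "'a list" assume ts: "ts \<in> UNIV - range ?cons"
    have "ts = []"
    proof (cases ts)
      case (Cons a list)
      then have "ts = ?cons (a, list)" by simp
      then show ?thesis using ts by blast
    qed
    then show "?h ts = 0" by simp
  qed simp
  also have "\<dots> = (\<integral>\<^sup>+x. ?h (?cons x) \<partial>count_space UNIV)"
    by (rule nn_integral_bij_count_space[symmetric]) (auto simp: bij_betw_def inj_on_def)
  also have "\<dots> = (\<integral>\<^sup>+t. \<integral>\<^sup>+ts. ?h (?cons (t, ts)) \<partial>count_space UNIV \<partial>count_space UNIV)"
    by (rule nn_integral_fst_count_space[symmetric])
  also have "\<dots> = (\<integral>\<^sup>+t. \<integral>\<^sup>+ts. w t * (indicator {ts. length ts = k} ts * (\<Prod>t\<leftarrow>ts. w t)) \<partial>count_space UNIV \<partial>count_space UNIV)"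
    by (intro nn_integral_cong) (auto simp: indicator_def)
  also have "\<dots> = (\<integral>\<^sup>+t. w t * (\<integral>\<^sup>+t. w t \<partial>count_space UNIV) ^ k \<partial>count_space UNIV)"
    by (simp add: nn_integral_cmult Suc.IH)
  also have "\<dots> = (\<integral>\<^sup>+t. w t \<partial>count_space UNIV) ^ Suc k"
    by (simp add: nn_integral_multc)
  finally show ?case .
qed

text \<open>Decomposition at the root by the number k of branches, whose list contributes a k-th
  power. In \<open>ennreal\<close> the rearrangement remains legitimate when the sums
  diverge.\<close>

lemma nn_integral_plane_tree:
  fixes h :: "nat \<Rightarrow> ennreal" and w :: "plane_tree \<Rightarrow> ennreal"
  assumes "\<And>ts. G (Node ts) = h (length ts) * (\<Prod>t\<leftarrow>ts. w t)"
  shows "(\<integral>\<^sup>+t. G t \<partial>count_space UNIV) = (\<Sum>k. h k * (\<integral>\<^sup>+t. w t \<partial>count_space UNIV) ^ k)"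
proof -
  have "range Node = UNIV" by (metis plane_tree.exhaust surj_def)
  then have "(\<integral>\<^sup>+t. G t \<partial>count_space UNIV) = (\<integral>\<^sup>+t. G t \<partial>count_space (range Node))" by simp
  also have "\<dots> = (\<integral>\<^sup>+ts. G (Node ts) \<partial>count_space UNIV)"
    by (rule nn_integral_bij_count_space[symmetric]) (auto simp: bij_betw_def inj_on_def)
  also have "\<dots> = (\<integral>\<^sup>+ts. (\<Sum>k. h k * (indicator {ts. length ts = k} ts * (\<Prod>t\<leftarrow>ts. w t))) \<partial>count_space UNIV)"
  proof (intro nn_integral_cong)
    fix ts
    have "(\<Sum>k. h k * (indicator {ts. length ts = k} ts * (\<Prod>t\<leftarrow>ts. w t)))
        = (\<Sum>k\<in>{length ts}. h k * (indicator {ts. length ts = k} ts * (\<Prod>t\<leftarrow>ts. w t)))"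
      by (rule suminf_finite) (auto simp: indicator_def)
    then show "G (Node ts) = (\<Sum>k. h k * (indicator {ts. length ts = k} ts * (\<Prod>t\<leftarrow>ts. w t)))"
      by (simp add: assms)
  qed
  also have "\<dots> = (\<Sum>k. \<integral>\<^sup>+ts. h k * (indicator {ts. length ts = k} ts * (\<Prod>t\<leftarrow>ts. w t)) \<partial>count_space UNIV)"
    by (rule nn_integral_suminf) simp
  also have "\<dots> = (\<Sum>k. h k * (\<integral>\<^sup>+t. w t \<partial>count_space UNIV) ^ k)"
    by (simp add: nn_integral_cmult nn_integral_lists_length)
  finally show ?thesis .
qed

lemma nn_integral_by_size:
  assumes "\<And>t. \<phi> t \<ge> 0" and z: "z \<ge> 0"
  shows "(\<integral>\<^sup>+t. ennreal (\<phi> t * z ^ tree_size t) \<partial>count_space UNIV)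
    = (\<Sum>n. ennreal ((\<Sum>t | tree_size t = n. \<phi> t) * z ^ n))"
proof -
  have "(\<integral>\<^sup>+t. ennreal (\<phi> t * z ^ tree_size t) \<partial>count_space UNIV)
     = (\<integral>\<^sup>+t. (\<Sum>n. ennreal (\<phi> t * z ^ tree_size t) * indicator {t. tree_size t = n} t) \<partial>count_space UNIV)"
  proof (intro nn_integral_cong)
    fix t
    have "(\<Sum>n. ennreal (\<phi> t * z ^ tree_size t) * indicator {t. tree_size t = n} t)
       = (\<Sum>n\<in>{tree_size t}. ennreal (\<phi> t * z ^ tree_size t) * indicator {t. tree_size t = n} t)"
      by (rule suminf_finite) (auto simp: indicator_def)
    then show "ennreal (\<phi> t * z ^ tree_size t)
       = (\<Sum>n. ennreal (\<phi> t * z ^ tree_size t) * indicator {t. tree_size t = n} t)" by simp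
  qed
  also have "\<dots> = (\<Sum>n. \<integral>\<^sup>+t. ennreal (\<phi> t * z ^ tree_size t) * indicator {t. tree_size t = n} t \<partial>count_space UNIV)"
    by (rule nn_integral_suminf) simp
  also have "\<dots> = (\<Sum>n. ennreal ((\<Sum>t | tree_size t = n. \<phi> t) * z ^ n))"
  proof (intro suminf_cong)
    fix n
    have "(\<integral>\<^sup>+t. ennreal (\<phi> t * z ^ tree_size t) * indicator {t. tree_size t = n} t \<partial>count_space UNIV)
       = (\<integral>\<^sup>+t. ennreal (\<phi> t * z ^ tree_size t) \<partial>count_space {t. tree_size t = n})"
      by (simp add: nn_integral_count_space_indicator)
    also have "\<dots> = (\<Sum>t | tree_size t = n. ennreal (\<phi> t * z ^ tree_size t))"
      by (rule nn_integral_count_space_finite[OF finite_tree_size])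
    also have "\<dots> = (\<Sum>t | tree_size t = n. ennreal (\<phi> t * z ^ n))"
      by (intro sum.cong) auto
    also have "\<dots> = ennreal (\<Sum>t | tree_size t = n. \<phi> t * z ^ n)"
      using assms z by (intro sum_ennreal) auto
    finally show "(\<integral>\<^sup>+t. ennreal (\<phi> t * z ^ tree_size t) * indicator {t. tree_size t = n} t \<partial>count_space UNIV)
       = ennreal ((\<Sum>t | tree_size t = n. \<phi> t) * z ^ n)"
      by (simp add: sum_distrib_right)
  qed
  finally show ?thesis .
qed

lemma prod_list_real_nonneg:
  fixes f :: "'a \<Rightarrow> real"
  shows "(\<And>x. x \<in> set xs \<Longrightarrow> f x \<ge> 0) \<Longrightarrow> (\<Prod>x\<leftarrow>xs. f x) \<ge> 0"
  by (induction xs) auto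

lemma prod_list_ennreal:
  "(\<And>x. x \<in> set xs \<Longrightarrow> f x \<ge> 0) \<Longrightarrow> (\<Prod>x\<leftarrow>xs. ennreal (f x)) = ennreal (\<Prod>x\<leftarrow>xs. f x)"
proof (induction xs)
  case (Cons a xs)
  moreover have "(\<Prod>x\<leftarrow>xs. f x) \<ge> 0" using Cons.prems by (intro prod_list_real_nonneg) auto
  ultimately show ?case by (simp add: ennreal_mult)
qed simp

lemma prod_list_mult_distrib:
  fixes f g :: "'a \<Rightarrow> 'b :: comm_monoid_mult"
  shows "(\<Prod>x\<leftarrow>xs. f x * g x) = (\<Prod>x\<leftarrow>xs. f x) * (\<Prod>x\<leftarrow>xs. g x)"
  by (induction xs) (auto simp: mult_ac)

lemma prod_list_power_const:
  fixes z :: "'b :: comm_monoid_mult"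
  shows "(\<Prod>x\<leftarrow>xs. z ^ f x) = z ^ (\<Sum>x\<leftarrow>xs. f x)"
  by (induction xs) (auto simp: power_add)

lemma of_nat_prod_list: "of_nat (\<Prod>x\<leftarrow>xs. f x) = (\<Prod>x\<leftarrow>xs. of_nat (f x))"
  by (induction xs) auto

lemma prod_list_power:
  fixes f :: "'a \<Rightarrow> 'b :: comm_monoid_mult"
  shows "(\<Prod>x\<leftarrow>xs. f x ^ m) = (\<Prod>x\<leftarrow>xs. f x) ^ m"
  by (induction xs) (auto simp: power_mult_distrib)

section \<open>Generating functions of the moments\<close>

locale offspring =
  fixes p :: "nat \<Rightarrow> real"
  assumes p_nonneg: "p k \<ge> 0"
begin

abbreviation "wt \<equiv> tree_weight p"
abbreviation "R \<equiv> \<lambda>t. real (subtree_count t)"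

lemma wt_nonneg: "wt t \<ge> 0"
  by (rule tree_weight_nonneg) (rule p_nonneg)

lemma R_ge_1: "R t \<ge> 1"
  using subtree_count_pos[of t] by simp

definition F_coeff :: "nat \<Rightarrow> nat \<Rightarrow> real" where
  "F_coeff m n = (\<Sum>t | tree_size t = n. wt t * R t ^ m)"
definition Y_coeff :: "nat \<Rightarrow> nat \<Rightarrow> real" where
  "Y_coeff m n = (\<Sum>t | tree_size t = n. wt t * (1 + R t) ^ m)"
definition g_coeff :: "nat \<Rightarrow> nat \<Rightarrow> real" where
  "g_coeff m n = (\<Sum>t | tree_size t = n. wt t * ((1 + R t) ^ m - R t ^ m))"

text \<open>Values in [0, infinity] allow the recursion and the comparison with supersolutions to be
  stated before anything is known about convergence.\<close>

definition Fe :: "nat \<Rightarrow> real \<Rightarrow> ennreal" where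
  "Fe m z = (\<Sum>n. ennreal (F_coeff m n * z ^ n))"
definition Ye :: "nat \<Rightarrow> real \<Rightarrow> ennreal" where
  "Ye m z = (\<Sum>n. ennreal (Y_coeff m n * z ^ n))"
definition ge :: "nat \<Rightarrow> real \<Rightarrow> ennreal" where
  "ge m z = (\<Sum>n. ennreal (g_coeff m n * z ^ n))"

lemma pow_diff_nonneg: "(1 + R t) ^ m - R t ^ m \<ge> 0"
  using power_mono[of "R t" "1 + R t" m] by simp

lemma F_coeff_nonneg: "F_coeff m n \<ge> 0" and Y_coeff_nonneg: "Y_coeff m n \<ge> 0"
  and g_coeff_nonneg: "g_coeff m n \<ge> 0"
  unfolding F_coeff_def Y_coeff_def g_coeff_def
  by (auto intro!: sum_nonneg mult_nonneg_nonneg wt_nonneg pow_diff_nonneg)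

lemma Y_coeff_eq: "Y_coeff m n = F_coeff m n + g_coeff m n"
  unfolding F_coeff_def Y_coeff_def g_coeff_def by (simp add: algebra_simps sum.distrib sum_subtractf)

lemma Fe_integral: "z \<ge> 0 \<Longrightarrow> Fe m z = (\<integral>\<^sup>+t. ennreal (wt t * R t ^ m * z ^ tree_size t) \<partial>count_space UNIV)"
  unfolding Fe_def F_coeff_def by (rule nn_integral_by_size[symmetric]) (auto intro: mult_nonneg_nonneg wt_nonneg)

lemma Ye_integral: "z \<ge> 0 \<Longrightarrow> Ye m z = (\<integral>\<^sup>+t. ennreal (wt t * (1 + R t) ^ m * z ^ tree_size t) \<partial>count_space UNIV)"
  unfolding Ye_def Y_coeff_def by (rule nn_integral_by_size[symmetric]) (auto intro: mult_nonneg_nonneg wt_nonneg)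

lemma ge_integral: "z \<ge> 0 \<Longrightarrow> ge m z = (\<integral>\<^sup>+t. ennreal (wt t * ((1 + R t) ^ m - R t ^ m) * z ^ tree_size t) \<partial>count_space UNIV)"
  unfolding ge_def g_coeff_def by (rule nn_integral_by_size[symmetric]) (auto intro: mult_nonneg_nonneg wt_nonneg pow_diff_nonneg)

lemma weight_Node:
  assumes "z \<ge> 0"
  shows "ennreal (wt (Node ts) * R (Node ts) ^ m * z ^ tree_size (Node ts))
     = (ennreal z * ennreal (p (length ts))) * (\<Prod>t\<leftarrow>ts. ennreal (wt t * (1 + R t) ^ m * z ^ tree_size t))"
proof -
  have nn: "(\<Prod>t\<leftarrow>ts. wt t * (1 + R t) ^ m * z ^ tree_size t) \<ge> 0"
    using assms wt_nonneg by (intro prod_list_real_nonneg) auto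
  have "R (Node ts) = (\<Prod>t\<leftarrow>ts. 1 + R t)" by (simp add: of_nat_prod_list)
  then have "wt (Node ts) * R (Node ts) ^ m * z ^ tree_size (Node ts)
     = (z * p (length ts)) * (\<Prod>t\<leftarrow>ts. wt t * (1 + R t) ^ m * z ^ tree_size t)"
    by (simp add: prod_list_mult_distrib prod_list_power prod_list_power_const mult_ac)
  then have "ennreal (wt (Node ts) * R (Node ts) ^ m * z ^ tree_size (Node ts))
     = ennreal (z * p (length ts)) * ennreal (\<Prod>t\<leftarrow>ts. wt t * (1 + R t) ^ m * z ^ tree_size t)"
    using assms p_nonneg nn by (simp only: ennreal_mult mult_nonneg_nonneg)
  also have "ennreal (z * p (length ts)) = ennreal z * ennreal (p (length ts))"
    using assms p_nonneg by (rule ennreal_mult)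
  also have "ennreal (\<Prod>t\<leftarrow>ts. wt t * (1 + R t) ^ m * z ^ tree_size t)
     = (\<Prod>t\<leftarrow>ts. ennreal (wt t * (1 + R t) ^ m * z ^ tree_size t))"
    using assms wt_nonneg by (intro prod_list_ennreal[symmetric]) auto
  finally show ?thesis .
qed

theorem Fe_recursion:
  assumes "z \<ge> 0"
  shows "Fe m z = ennreal z * (\<Sum>k. ennreal (p k) * Ye m z ^ k)"
proof -
  have "Fe m z = (\<Sum>k. (ennreal z * ennreal (p k)) * Ye m z ^ k)"
    unfolding Fe_integral[OF assms] Ye_integral[OF assms]
    by (rule nn_integral_plane_tree) (rule weight_Node[OF assms])
  then show ?thesis by (simp add: mult.assoc ennreal_suminf_cmult)
qed

text \<open>The sums over trees of bounded height increase to the full sum, and the decomposition at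
  the root expresses each through the one before. By induction they stay below any y with g + z
  \<Phi>(y) <= y, and monotone convergence gives the claim. This is how convergence is later
  obtained beyond points where it is already known.\<close>

theorem Fe_le_supersolution:
  assumes z: "z \<ge> 0" and y: "ge m z + ennreal z * (\<Sum>k. ennreal (p k) * y ^ k) \<le> y"
  shows "Fe m z \<le> y"
proof -
  let ?F = "\<lambda>t. ennreal (wt t * R t ^ m * z ^ tree_size t)"
  let ?Y = "\<lambda>t. ennreal (wt t * (1 + R t) ^ m * z ^ tree_size t)"
  let ?g = "\<lambda>t. ennreal (wt t * ((1 + R t) ^ m - R t ^ m) * z ^ tree_size t)"
  let ?I = "\<lambda>h. indicator {t. height_le h t}"
  define Fh where "Fh h = (\<integral>\<^sup>+t. ?F t * ?I h t \<partial>count_space UNIV)" for h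
  define Yh where "Yh h = (\<integral>\<^sup>+t. ?Y t * ?I h t \<partial>count_space UNIV)" for h
  have Fh_Suc: "Fh (Suc h) = ennreal z * (\<Sum>k. ennreal (p k) * Yh h ^ k)" for h
  proof -
    have prod_ind: "(\<Prod>t\<leftarrow>ts. w t * ?I h t) = (\<Prod>t\<leftarrow>ts. w t) * ?I (Suc h) (Node ts)"
      for w :: "plane_tree \<Rightarrow> ennreal" and ts
      by (induction ts) (auto simp: indicator_def)
    have "Fh (Suc h) = (\<Sum>k. (ennreal z * ennreal (p k)) * Yh h ^ k)"
      unfolding Fh_def Yh_def
    proof (rule nn_integral_plane_tree)
      fix ts
      show "?F (Node ts) * ?I (Suc h) (Node ts)
        = ennreal z * ennreal (p (length ts)) *
          (\<Prod>t\<leftarrow>ts. ?Y t * ?I h t)"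
        unfolding weight_Node[OF z] prod_ind by (rule mult.assoc)
    qed
    then show ?thesis by (simp add: mult.assoc ennreal_suminf_cmult)
  qed
  \<comment> \<open>\<open>g\<close> is kept whole rather than truncated: an inequality suffices,
    and the hypothesis on \<open>y\<close> already contains all of \<open>g\<close>.\<close>
  have Yh_le: "Yh h \<le> Fh h + ge m z" for h
  proof -
    have "Yh h \<le> (\<integral>\<^sup>+t. ?F t * ?I h t
        + ?g t \<partial>count_space UNIV)"
      unfolding Yh_def
    proof (rule nn_integral_mono)
      fix t
      have "wt t * (1 + R t) ^ m * z ^ tree_size t = wt t * R t ^ m * z ^ tree_size t + wt t * ((1 + R t) ^ m - R t ^ m) * z ^ tree_size t"
        by (simp add: algebra_simps)
      then have "?Y t
        = ?F t + ?g t"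
        using z wt_nonneg pow_diff_nonneg[of t m] by (simp add: ennreal_plus)
      then show "?Y t * ?I h t
        \<le> ?F t * ?I h t
        + ?g t"
        by (auto simp: indicator_def)
    qed
    also have "\<dots> = Fh h + ge m z"
      unfolding Fh_def ge_integral[OF z] by (rule nn_integral_add) auto
    finally show ?thesis .
  qed
  have bound: "Fh h + ge m z \<le> y" for h
  proof (induction h)
    case 0
    have "Fh 0 = 0" by (simp add: Fh_def)
    moreover have "ge m z \<le> ge m z + ennreal z * (\<Sum>k. ennreal (p k) * y ^ k)" by simp
    ultimately show ?case using y by (metis add_0 order_trans)
  next
    case (Suc h)
    have "Yh h \<le> y" using Yh_le Suc by (rule order_trans)
    then have "Fh (Suc h) \<le> ennreal z * (\<Sum>k. ennreal (p k) * y ^ k)"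
      unfolding Fh_Suc by (intro mult_left_mono suminf_le power_mono) auto
    then have "Fh (Suc h) + ge m z \<le> ge m z + ennreal z * (\<Sum>k. ennreal (p k) * y ^ k)"
      by (subst add.commute) (rule add_left_mono)
    then show ?case using y by (rule order_trans)
  qed
  have "Fe m z = (\<integral>\<^sup>+t. (SUP h. ?F t * ?I h t) \<partial>count_space UNIV)"
    unfolding Fe_integral[OF z]
  proof (intro nn_integral_cong antisym)
    fix t
    obtain h where "height_le h t" using ex_height_le by blast
    then show "?F t \<le> (SUP h. ?F t * ?I h t)"
      by (intro SUP_upper2[of h]) auto
    show "(SUP h. ?F t * ?I h t) \<le> ?F t"
      by (intro SUP_least) (auto simp: indicator_def)
  qed
  also have "\<dots> = (SUP h. Fh h)"
    unfolding Fh_def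
    by (rule nn_integral_monotone_convergence_SUP)
      (auto simp: incseq_def le_fun_def indicator_def intro: height_le_mono)
  also have "\<dots> \<le> y"
  proof (rule SUP_least)
    fix h show "Fh h \<le> y" using bound[of h] by (metis add.commute le_iff_add order_trans)
  qed
  finally show ?thesis .
qed

lemma F_coeff_mono: "m \<le> m' \<Longrightarrow> F_coeff m n \<le> F_coeff m' n"
  unfolding F_coeff_def by (intro sum_mono mult_left_mono power_increasing R_ge_1 wt_nonneg)

lemma Y_coeff_mono: "m \<le> m' \<Longrightarrow> Y_coeff m n \<le> Y_coeff m' n"
  unfolding Y_coeff_def by (intro sum_mono mult_left_mono power_increasing wt_nonneg) auto

text \<open>Comes from 1 + R <= 2 R; it makes \<open>Y m\<close> converge wherever
  \<open>F m\<close> does.\<close>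

lemma Y_coeff_le: "Y_coeff m n \<le> 2 ^ m * F_coeff m n"
  unfolding F_coeff_def Y_coeff_def sum_distrib_left
proof (intro sum_mono)
  fix t
  have "(1 + R t) ^ m \<le> (2 * R t) ^ m" using R_ge_1[of t] by (intro power_mono) auto
  then show "wt t * (1 + R t) ^ m \<le> 2 ^ m * (wt t * R t ^ m)"
    using mult_left_mono[OF _ wt_nonneg[of t]] by (fastforce simp: power_mult_distrib mult_ac)
qed

text \<open>In (1 + r)^(m + 1) - r^(m + 1) the leading power cancels, so for r >= 1 the difference
  is at most a constant times r^m. Thus g (m + 1) converges wherever \<open>F m\<close>
  does.\<close>

lemma ex_g_coeff_le: "\<exists>K\<ge>0. \<forall>n. g_coeff (Suc m) n \<le> K * F_coeff m n"
proof -
  have "\<exists>K\<ge>0. \<forall>r\<ge>1. (1 + r) ^ Suc m - r ^ Suc m \<le> K * (r :: real) ^ m"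
  proof (induction m)
    case 0 show ?case by (intro exI[of _ 1]) auto
  next
    case (Suc m)
    then obtain K where K: "K \<ge> 0" "\<And>r. r \<ge> 1 \<Longrightarrow> (1 + r) ^ Suc m - r ^ Suc m \<le> K * (r :: real) ^ m" by blast
    show ?case
    proof (intro exI[of _ "2 * K + 1"] conjI allI impI)
      fix r :: real assume r: "1 \<le> r"
      have "(1 + r) ^ Suc (Suc m) - r ^ Suc (Suc m) = (1 + r) * ((1 + r) ^ Suc m - r ^ Suc m) + r ^ Suc m"
        by (simp add: algebra_simps)
      also have "\<dots> \<le> (2 * r) * (K * r ^ m) + r ^ Suc m"
        using r K(1) K(2)[OF r] power_mono[of r "1 + r" "Suc m"] by (intro add_right_mono mult_mono) auto
      finally show "(1 + r) ^ Suc (Suc m) - r ^ Suc (Suc m) \<le> (2 * K + 1) * r ^ Suc m"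
        by (simp add: algebra_simps)
    qed (use K in auto)
  qed
  then obtain K where K: "K \<ge> 0" "\<And>r. r \<ge> 1 \<Longrightarrow> (1 + r) ^ Suc m - r ^ Suc m \<le> K * (r :: real) ^ m" by blast
  have "g_coeff (Suc m) n \<le> K * F_coeff m n" for n
    unfolding F_coeff_def g_coeff_def sum_distrib_left
  proof (intro sum_mono)
    fix t
    have "wt t * ((1 + R t) ^ Suc m - R t ^ Suc m) \<le> wt t * (K * R t ^ m)"
      by (rule mult_left_mono[OF K(2)[OF R_ge_1] wt_nonneg])
    then show "wt t * ((1 + R t) ^ Suc m - R t ^ Suc m) \<le> K * (wt t * R t ^ m)"
      by (simp add: mult_ac)
  qed
  then show ?thesis using K(1) by blast
qed

lemma F_coeff_le_0: "F_coeff m n \<le> (2 ^ m) ^ n * F_coeff 0 n"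
  unfolding F_coeff_def sum_distrib_left
proof (intro sum_mono)
  fix t assume "t \<in> {t. tree_size t = n}"
  then have "subtree_count t \<le> 2 ^ n" using subtree_count_less[of t] by auto
  then have "real (subtree_count t) \<le> real (2 ^ n)" by (rule of_nat_mono)
  then have "R t \<le> 2 ^ n" by simp
  then have "R t ^ m \<le> (2 ^ n) ^ m" by (intro power_mono) auto
  then show "wt t * R t ^ m \<le> (2 ^ m) ^ n * (wt t * R t ^ 0)"
    using mult_left_mono[OF _ wt_nonneg[of t]] by (fastforce simp flip: power_mult simp: mult.commute)
qed

lemma F_coeff_ge_weight: "wt t * R t ^ m \<le> F_coeff m (tree_size t)"
  unfolding F_coeff_def by (rule member_le_sum) (auto intro: mult_nonneg_nonneg wt_nonneg finite_tree_size)

lemma Y_coeff_pos: "wt t > 0 \<Longrightarrow> Y_coeff m (tree_size t) > 0"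
  using F_coeff_ge_weight[of t m] R_ge_1[of t] g_coeff_nonneg[of m "tree_size t"]
  unfolding Y_coeff_eq by (smt (verit) mult_pos_pos zero_less_power)

end

section \<open>Galton--Watson trees\<close>

text \<open>A tree written as a family of offspring numbers, the form of a sample point of the
  probability space. The value 0 off the tree is a default: the node set depends only on the values
  at its own nodes.\<close>

fun degree_of :: "plane_tree \<Rightarrow> node \<Rightarrow> nat" where
  "degree_of (Node ts) [] = length ts"
| "degree_of (Node ts) (i # v) = (if i < length ts then degree_of (ts ! i) v else 0)"

abbreviation nodes :: "plane_tree \<Rightarrow> node set" where
  "nodes t \<equiv> tree_of (degree_of t)"

lemma tree_of_decomp:
  "tree_of c = insert [] (\<Union>i<c []. (#) i ` tree_of (\<lambda>v. c (i # v)))" (is "_ = ?R")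
proof
  show "tree_of c \<subseteq> ?R"
  proof
    fix v assume "v \<in> tree_of c"
    then show "v \<in> ?R"
    proof induction
      case (child v i)
      show ?case
      proof (cases v)
        case Nil
        then show ?thesis using child by (auto intro!: bexI[of _ i] imageI tree_of.root)
      next
        case (Cons j w)
        then have "j < c []" "w \<in> tree_of (\<lambda>v. c (j # v))" using child by auto
        then show ?thesis using child Cons by (auto intro!: bexI[of _ j] imageI tree_of.child)
      qed
    qed simp
  qed
  have "i # v \<in> tree_of c" if "v \<in> tree_of (\<lambda>v. c (i # v))" "i < c []" for i v
    using that
  proof induction
    case root
    then show ?case using tree_of.child[OF tree_of.root, of i c] by simp
  next
    case (child v j)
    then show ?case using tree_of.child[of "i # v" c j] by simp
  qed
  then show "?R \<subseteq> tree_of c" by (auto intro: tree_of.root)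
qed

lemma tree_of_cong: "(\<And>v. v \<in> tree_of c \<Longrightarrow> c' v = c v) \<Longrightarrow> tree_of c' = tree_of c"
proof
  assume *: "\<And>v. v \<in> tree_of c \<Longrightarrow> c' v = c v"
  show "tree_of c' \<subseteq> tree_of c"
  proof
    fix v assume "v \<in> tree_of c'"
    then show "v \<in> tree_of c"
      by induction (use * in \<open>auto intro: tree_of.intros\<close>)
  qed
  show "tree_of c \<subseteq> tree_of c'"
  proof
    fix v assume "v \<in> tree_of c"
    then show "v \<in> tree_of c'"
      by induction (use * in \<open>auto intro: tree_of.intros\<close>)
  qed
qed

text \<open>The node set determines the offspring numbers on it. This turns the event that the
  random tree is a given finite tree into finitely many coordinate conditions.\<close>

lemma tree_of_eq_iff: "tree_of c' = tree_of c \<longleftrightarrow> (\<forall>v\<in>tree_of c. c' v = c v)"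
proof
  assume eq: "tree_of c' = tree_of c"
  show "\<forall>v\<in>tree_of c. c' v = c v"
  proof
    fix v assume v: "v \<in> tree_of c"
    have "i < c' v \<longleftrightarrow> i < c v" for i
      using tree_of_snoc_iff[of v i c] tree_of_snoc_iff[of v i c'] v eq by simp
    then show "c' v = c v" by (metis less_irrefl linorder_neqE_nat)
  qed
qed (use tree_of_cong in blast)

lemma nodes_Node: "nodes (Node ts) = insert [] (\<Union>i<length ts. (#) i ` nodes (ts ! i))"
proof -
  have "(\<lambda>v. degree_of (Node ts) (i # v)) = degree_of (ts ! i)" if "i < length ts" for i
    using that by auto
  then show ?thesis by (subst tree_of_decomp) auto
qed

lemma Cons_in_nodes_iff: "i # v \<in> nodes (Node ts) \<longleftrightarrow> i < length ts \<and> v \<in> nodes (ts ! i)"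
  unfolding nodes_Node by auto

lemma finite_nodes: "finite (nodes t)"
proof (induction t)
  case (Node ts)
  then show ?case unfolding nodes_Node by auto
qed

lemma prod_nodes_Node:
  fixes f :: "node \<Rightarrow> 'a :: comm_monoid_mult"
  shows "prod f (nodes (Node ts)) = f [] * (\<Prod>i<length ts. \<Prod>v\<in>nodes (ts ! i). f (i # v))"
proof -
  have "prod f (nodes (Node ts)) = f [] * prod f (\<Union>i<length ts. (#) i ` nodes (ts ! i))"
    unfolding nodes_Node using finite_nodes by (subst prod.insert) auto
  also have "prod f (\<Union>i<length ts. (#) i ` nodes (ts ! i)) = (\<Prod>i<length ts. prod f ((#) i ` nodes (ts ! i)))"
    by (rule prod.UNION_disjoint) (auto simp: finite_nodes)
  also have "\<dots> = (\<Prod>i<length ts. \<Prod>v\<in>nodes (ts ! i). f (i # v))"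
    by (rule prod.cong[OF refl], subst prod.reindex) (auto simp: inj_on_def o_def)
  finally show ?thesis .
qed

lemma card_nodes: "card (nodes t) = tree_size t"
proof (induction t)
  case (Node ts)
  have "card (nodes (Node ts)) = 1 + card (\<Union>i<length ts. (#) i ` nodes (ts ! i))"
    unfolding nodes_Node using finite_nodes by (subst card_insert_disjoint) auto
  also have "card (\<Union>i<length ts. (#) i ` nodes (ts ! i)) = (\<Sum>i<length ts. card ((#) i ` nodes (ts ! i)))"
    by (rule card_UN_disjoint) (auto simp: finite_nodes)
  also have "\<dots> = (\<Sum>i<length ts. card (nodes (ts ! i)))"
    by (simp add: card_image)
  also have "(\<Sum>i<length ts. card (nodes (ts ! i))) = (\<Sum>i<length ts. tree_size (ts ! i))"
    using Node by (intro sum.cong) auto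
  also have "\<dots> = (\<Sum>t\<leftarrow>ts. tree_size t)"
    by (simp add: sum_list_sum_nth atLeast0LessThan)
  finally show ?case by simp
qed

lemma prod_degree_weight: "(\<Prod>v\<in>nodes t. p (degree_of t v)) = tree_weight p t"
proof (induction t)
  case (Node ts)
  have "(\<Prod>v\<in>nodes (Node ts). p (degree_of (Node ts) v))
      = p (length ts) * (\<Prod>i<length ts. \<Prod>v\<in>nodes (ts ! i). p (degree_of (Node ts) (i # v)))"
    unfolding prod_nodes_Node by simp
  also have "(\<Prod>i<length ts. \<Prod>v\<in>nodes (ts ! i). p (degree_of (Node ts) (i # v))) = (\<Prod>i<length ts. tree_weight p (ts ! i))"
    using Node by (intro prod.cong) auto
  also have "\<dots> = (\<Prod>t\<leftarrow>ts. tree_weight p t)"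
    by (simp add: prod.list_conv_set_nth atLeast0LessThan)
  finally show ?case by simp
qed

lemma nodes_inj: "nodes t = nodes t' \<Longrightarrow> t = t'"
proof (induction t arbitrary: t')
  case (Node ts)
  obtain ts' where t': "t' = Node ts'" by (cases t')
  have deg: "degree_of (Node ts) [] = degree_of t' []"
    using Node.prems tree_of_eq_iff[of "degree_of (Node ts)" "degree_of t'"] tree_of.root by blast
  then have len: "length ts = length ts'" by (simp add: t')
  have "ts ! i = ts' ! i" if i: "i < length ts" for i
  proof (rule Node.IH)
    show "nodes (ts ! i) = nodes (ts' ! i)"
      using Node.prems Cons_in_nodes_iff[of i _ ts] Cons_in_nodes_iff[of i _ ts'] i len t' by auto
  qed (use i in auto)
  then show ?case using len t' by (auto intro: nth_equalityI)
qed

text \<open>Induction on the number of nodes, since each branch at the root lacks the root. It lets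
  the event of order n split into events for individual plane trees.\<close>

lemma finite_tree_of_is_nodes: "finite (tree_of c) \<Longrightarrow> \<exists>t. tree_of c = nodes t"
proof (induction "card (tree_of c)" arbitrary: c rule: less_induct)
  case less
  define c' where "c' i v = c (i # v)" for i v
  have dec: "tree_of c = insert [] (\<Union>i<c []. (#) i ` tree_of (c' i))"
    unfolding c'_def by (rule tree_of_decomp)
  have "\<exists>t. tree_of (c' i) = nodes t" if i: "i < c []" for i
  proof (rule less.hyps)
    have sub: "(#) i ` tree_of (c' i) \<subseteq> tree_of c - {[]}" using dec i by auto
    then have fin: "finite ((#) i ` tree_of (c' i))" using less.prems finite_subset by blast
    then show "finite (tree_of (c' i))" by (rule finite_imageD) (simp add: inj_on_def)
    have "card (tree_of (c' i)) = card ((#) i ` tree_of (c' i))" by (simp add: card_image inj_on_def)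
    also have "\<dots> \<le> card (tree_of c - {[]})" using sub less.prems by (intro card_mono) auto
    also have "\<dots> < card (tree_of c)" using less.prems tree_of.root by (intro psubset_card_mono) auto
    finally show "card (tree_of (c' i)) < card (tree_of c)" .
  qed
  then obtain T where T: "\<And>i. i < c [] \<Longrightarrow> tree_of (c' i) = nodes (T i)" by metis
  have "tree_of c = nodes (Node (map T [0..<c []]))"
    unfolding dec nodes_Node using T by auto
  then show ?case by blast
qed

section \<open>Root subtrees as prefix-closed sets\<close>

definition prefix_closed :: "node set \<Rightarrow> bool" where
  "prefix_closed S \<longleftrightarrow> (\<forall>v i. v @ [i] \<in> S \<longrightarrow> v \<in> S)"

lemma prefix_closed_Nil: "prefix_closed S \<Longrightarrow> v \<in> S \<Longrightarrow> [] \<in> S"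
  by (induction v rule: rev_induct) (auto simp: prefix_closed_def)

text \<open>The only exit from the descendants of v @ [i] is through v, so a path to the root inside
  S must contain v. Conversely, the prefixes of a node form a path to the root.\<close>

lemma connected_nodes_iff:
  assumes S: "[] \<in> S" shows "connected_nodes S \<longleftrightarrow> prefix_closed S"
proof
  let ?E = "{(a, b). a \<in> S \<and> b \<in> S \<and> adjacent a b}"
  {
    assume conn: "connected_nodes S"
    show "prefix_closed S" unfolding prefix_closed_def
    proof (intro allI impI, rule ccontr)
      fix v i assume v: "v @ [i] \<in> S" "v \<notin> S"
      have path: "\<exists>w. y = v @ [i] @ w" if "(v @ [i], y) \<in> ?E\<^sup>*" for y
        using that
      proof (induction rule: rtrancl_induct)
        case (step x y)
        then obtain w where w: "x = v @ [i] @ w" by blast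
        have "y \<in> S" "adjacent x y" using step by auto
        then obtain j where "y = x @ [j] \<or> x = y @ [j]" by (auto simp: adjacent_def)
        then show ?case
        proof
          assume "x = y @ [j]"
          then show ?thesis using w v \<open>y \<in> S\<close> by (cases w rule: rev_cases) auto
        qed (use w in auto)
      qed auto
      have "(v @ [i], []) \<in> ?E\<^sup>*" using conn v S unfolding connected_nodes_def by blast
      from path[OF this] have "\<exists>w. [] = v @ [i] @ w" .
      then show False by simp
    qed
  }
  {
    assume closed: "prefix_closed S"
    have sym: "sym ?E" by (auto simp: sym_def adjacent_def)
    have reach: "([], v) \<in> ?E\<^sup>*" if "v \<in> S" for v
      using that
    proof (induction v rule: rev_induct)
      case (snoc i v)
      then have "v \<in> S" using closed by (auto simp: prefix_closed_def)
      then have "(v, v @ [i]) \<in> ?E" using snoc by (auto simp: adjacent_def)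
      then show ?case using snoc.IH[OF \<open>v \<in> S\<close>] by (rule rtrancl_into_rtrancl[rotated])
    qed simp
    show "connected_nodes S" unfolding connected_nodes_def
    proof (intro ballI)
      fix u v assume "u \<in> S" "v \<in> S"
      have "(u, []) \<in> ?E\<^sup>*" using reach[OF \<open>u \<in> S\<close>] sym_rtrancl[OF sym] by (auto dest: symD)
      then show "(u, v) \<in> ?E\<^sup>*" using reach[OF \<open>v \<in> S\<close>] by (rule rtrancl_trans)
    qed
  }
qed

lemma root_subtrees_eq: "root_subtrees T = {S. S \<subseteq> T \<and> [] \<in> S \<and> prefix_closed S}"
  unfolding root_subtrees_def using connected_nodes_iff by auto

text \<open>A root subtree corresponds to its family of traces on the branches, each trace being
  empty or a root subtree of the branch. The empty trace accounts for the summand 1.\<close>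

lemma num_root_subtrees_nodes: "num_root_subtrees (nodes t) = subtree_count t"
proof (induction t)
  case (Node ts)
  let ?n = "length ts"
  let ?B = "\<lambda>i. insert {} (root_subtrees (nodes (ts ! i)))"
  let ?P = "\<Pi>\<^sub>E i\<in>{..<?n}. ?B i"
  define \<phi> where "\<phi> S = restrict (\<lambda>i. {v. i # v \<in> S}) {..<?n}" for S :: "node set"
  define \<psi> where "\<psi> f = insert [] (\<Union>i<?n. (#) i ` f i)" for f :: "nat \<Rightarrow> node set"
  have "bij_betw \<phi> (root_subtrees (nodes (Node ts))) ?P"
  proof (rule bij_betw_byWitness[where f' = \<psi>])
    show "\<forall>S\<in>root_subtrees (nodes (Node ts)). \<psi> (\<phi> S) = S"
    proof
      fix S assume S: "S \<in> root_subtrees (nodes (Node ts))"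
      then have sub: "S \<subseteq> nodes (Node ts)" "[] \<in> S" by (auto simp: root_subtrees_eq)
      show "\<psi> (\<phi> S) = S"
      proof
        show "\<psi> (\<phi> S) \<subseteq> S" using sub(2) by (auto simp: \<psi>_def \<phi>_def)
        show "S \<subseteq> \<psi> (\<phi> S)"
        proof
          fix v assume v: "v \<in> S"
          show "v \<in> \<psi> (\<phi> S)"
          proof (cases v)
            case (Cons i w)
            then have "i < ?n" using sub(1) v Cons_in_nodes_iff[of i w ts] by auto
            then show ?thesis using v Cons by (auto simp: \<psi>_def \<phi>_def)
          qed (simp add: \<psi>_def)
        qed
      qed
    qed
    show "\<forall>f\<in>?P. \<phi> (\<psi> f) = f"
      by (auto simp: \<psi>_def \<phi>_def PiE_def extensional_def fun_eq_iff)
    show "\<phi> ` root_subtrees (nodes (Node ts)) \<subseteq> ?P"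
    proof (intro image_subsetI)
      fix S assume S: "S \<in> root_subtrees (nodes (Node ts))"
      have "{v. i # v \<in> S} \<in> ?B i" if i: "i < ?n" for i
      proof (cases "{v. i # v \<in> S} = {}")
        case False
        have "prefix_closed {v. i # v \<in> S}"
          using S unfolding root_subtrees_eq prefix_closed_def by (auto simp flip: append_Cons)
        moreover have "[] \<in> {v. i # v \<in> S}" using prefix_closed_Nil[OF calculation] False by blast
        moreover have "{v. i # v \<in> S} \<subseteq> nodes (ts ! i)"
          using S Cons_in_nodes_iff by (auto simp: root_subtrees_eq)
        ultimately show ?thesis by (simp add: root_subtrees_eq)
      qed simp
      then show "\<phi> S \<in> ?P" by (auto simp: \<phi>_def)
    qed
    show "\<psi> ` ?P \<subseteq> root_subtrees (nodes (Node ts))"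
    proof (intro image_subsetI)
      fix f assume f: "f \<in> ?P"
      have fB: "f i \<in> ?B i" if "i < ?n" for i using f that by auto
      have closed: "v \<in> f i" if "i < ?n" "v @ [j] \<in> f i" for i v j
        using fB[OF that(1)] that(2) by (auto simp: root_subtrees_eq prefix_closed_def)
      have "prefix_closed (\<psi> f)" unfolding prefix_closed_def
      proof (intro allI impI)
        fix v j assume "v @ [j] \<in> \<psi> f"
        then obtain i w where iw: "i < ?n" "v @ [j] = i # w" "w \<in> f i" by (auto simp: \<psi>_def)
        show "v \<in> \<psi> f"
        proof (cases v)
          case (Cons i' v')
          then show ?thesis using iw closed[of i v' j] by (auto simp: \<psi>_def)
        qed (simp add: \<psi>_def)
      qed
      moreover have "\<psi> f \<subseteq> nodes (Node ts)"
        using fB unfolding \<psi>_def nodes_Node by (fastforce simp: root_subtrees_eq)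
      ultimately show "\<psi> f \<in> root_subtrees (nodes (Node ts))"
        by (simp add: root_subtrees_eq \<psi>_def)
    qed
  qed
  then have "num_root_subtrees (nodes (Node ts)) = card ?P"
    unfolding num_root_subtrees_def by (rule bij_betw_same_card)
  also have "\<dots> = (\<Prod>i<?n. card (?B i))" by (rule card_PiE) simp
  also have "\<dots> = (\<Prod>i<?n. 1 + subtree_count (ts ! i))"
  proof (intro prod.cong refl)
    fix i assume "i \<in> {..<?n}"
    then have "card (root_subtrees (nodes (ts ! i))) = subtree_count (ts ! i)"
      using Node by (auto simp: num_root_subtrees_def)
    moreover have "finite (root_subtrees (nodes (ts ! i)))"
      by (rule finite_subset[of _ "Pow (nodes (ts ! i))"]) (auto simp: root_subtrees_def finite_nodes)
    moreover have "{} \<notin> root_subtrees (nodes (ts ! i))" by (auto simp: root_subtrees_def)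
    ultimately show "card (?B i) = 1 + subtree_count (ts ! i)" by simp
  qed
  also have "\<dots> = (\<Prod>t\<leftarrow>ts. 1 + subtree_count t)"
    by (simp add: prod.list_conv_set_nth atLeast0LessThan)
  finally show ?case by simp
qed

text \<open>The prefixes of each node form a root subtree, and different nodes give different ones,
  so \<open>card\<close> takes its default value 0. The count is therefore constant on the event of
  an infinite tree, as \<open>num_root_subtrees_measurable\<close> requires.\<close>

lemma num_root_subtrees_infinite:
  assumes "infinite (tree_of c)" shows "num_root_subtrees (tree_of c) = 0"
proof -
  define P where "P v = {w. \<exists>u. v = w @ u}" for v :: node
  have closed: "w @ u \<in> tree_of c \<Longrightarrow> w \<in> tree_of c" for w u
    by (induction u rule: rev_induct) (auto simp: tree_of_snoc_iff simp flip: append_assoc)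
  have "P v \<in> root_subtrees (tree_of c)" if "v \<in> tree_of c" for v
    using that closed by (auto simp: root_subtrees_eq prefix_closed_def P_def)
  moreover have "inj_on P (tree_of c)"
  proof (rule inj_onI)
    fix v w assume "P v = P w"
    moreover have "v \<in> P v" "w \<in> P w" by (auto simp: P_def)
    ultimately have "v \<in> P w" "w \<in> P v" by auto
    then show "v = w" by (auto simp: P_def)
  qed
  ultimately have "infinite (root_subtrees (tree_of c))"
    using assms by (meson finite_imageD finite_subset image_subsetI)
  then show ?thesis by (simp add: num_root_subtrees_def)
qed

section \<open>The law of the Galton-Watson tree\<close>

abbreviation tree_event :: "nat pmf \<Rightarrow> plane_tree \<Rightarrow> (node \<Rightarrow> nat) set" where
  "tree_event \<xi> t \<equiv> {\<omega> \<in> space (gw_space \<xi>). tree_of \<omega> = nodes t}"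

text \<open>By \<open>tree_of_eq_iff\<close> the event prescribes the coordinates at finitely many
  nodes, and independence multiplies their probabilities.\<close>

lemma emeasure_tree_of_eq_nodes:
  "tree_event \<xi> t \<in> sets (gw_space \<xi>)"
  "emeasure (gw_space \<xi>) (tree_event \<xi> t) = ennreal (tree_weight (pmf \<xi>) t)"
proof -
  interpret product_prob_space "\<lambda>_ :: node. measure_pmf \<xi>" UNIV
    by (simp add: product_prob_space_def product_prob_space_axioms_def product_sigma_finite_def
        measure_pmf.prob_space_axioms prob_space_imp_sigma_finite)
  have eq: "tree_event \<xi> t
      = {\<omega> \<in> space (gw_space \<xi>). \<forall>v\<in>nodes t. \<omega> v \<in> {degree_of t v}}"
    by (simp add: tree_of_eq_iff)
  have "emeasure (gw_space \<xi>) (tree_event \<xi> t)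
      = (\<Prod>v\<in>nodes t. emeasure (measure_pmf \<xi>) {degree_of t v})"
    unfolding eq unfolding gw_space_def
    by (rule emeasure_PiM_Collect) (auto simp: finite_nodes)
  also have "\<dots> = (\<Prod>v\<in>nodes t. ennreal (pmf \<xi> (degree_of t v)))"
    by (simp add: emeasure_pmf_single)
  also have "\<dots> = ennreal (\<Prod>v\<in>nodes t. pmf \<xi> (degree_of t v))"
    by (rule prod_ennreal) simp
  finally show "emeasure (gw_space \<xi>) (tree_event \<xi> t) = ennreal (tree_weight (pmf \<xi>) t)"
    by (simp add: prod_degree_weight)
  show "tree_event \<xi> t \<in> sets (gw_space \<xi>)"
  proof -
    have "{\<omega> \<in> space (gw_space \<xi>). \<omega> v \<in> {degree_of t v}} \<in> sets (gw_space \<xi>)" for v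
    proof -
      have "(\<lambda>\<omega>. \<omega> v) \<in> measurable (gw_space \<xi>) (measure_pmf \<xi>)"
        unfolding gw_space_def by (rule measurable_component_singleton) simp
      then have "(\<lambda>\<omega>. \<omega> v) -` {degree_of t v} \<inter> space (gw_space \<xi>) \<in> sets (gw_space \<xi>)"
        by (rule measurable_sets) simp
      then show ?thesis by (simp add: vimage_def Int_def conj_commute)
    qed
    moreover have "nodes t \<noteq> {}" using tree_of.root by blast
    ultimately show ?thesis unfolding eq by (intro sets.sets_Collect_finite_All' finite_nodes)
  qed
qed

lemma gw_size_eq:
  "gw_size \<xi> n = (\<Union>t\<in>{t. tree_size t = n}. tree_event \<xi> t)"
  unfolding gw_size_def using finite_tree_of_is_nodes card_nodes finite_nodes by fastforce

lemma indicator_gw_size: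
  assumes "\<omega> \<in> space (gw_space \<xi>)"
  shows "F (tree_of \<omega>) * indicator (gw_size \<xi> n) \<omega>
    = (\<Sum>t | tree_size t = n. F (nodes t) * indicator (tree_event \<xi> t) \<omega> :: ennreal)"
proof (cases "\<omega> \<in> gw_size \<xi> n")
  case True
  then obtain t where t: "tree_size t = n" "tree_of \<omega> = nodes t" by (auto simp: gw_size_eq)
  have "(\<Sum>t | tree_size t = n. F (nodes t) * indicator (tree_event \<xi> t) \<omega> :: ennreal)
     = (\<Sum>t'\<in>{t}. F (nodes t') * indicator (tree_event \<xi> t') \<omega>)"
    by (rule sum.mono_neutral_right) (use t finite_tree_size nodes_inj in \<open>auto simp: indicator_def\<close>)
  then show ?thesis using t True assms by simp
next
  case False
  then have "indicator (tree_event \<xi> t) \<omega> = (0 :: ennreal)" if "tree_size t = n" for t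
    using that by (auto simp: gw_size_eq indicator_def)
  then show ?thesis using False by simp
qed

abbreviation moment :: "nat \<Rightarrow> node set \<Rightarrow> real" where
  "moment m T \<equiv> real (num_root_subtrees T) ^ m"

text \<open>The function is constant on each of the countably many events of a given finite tree and
  on what remains, the event of an infinite tree.\<close>

lemma num_root_subtrees_measurable:
  assumes "m \<ge> 1"
  shows "(\<lambda>\<omega>. moment m (tree_of \<omega>)) \<in> borel_measurable (gw_space \<xi>)"
proof -
  let ?M = "gw_space \<xi>"
  define A where "A = tree_event \<xi>"
  define B where "B = space ?M - (\<Union>t. A t)"
  have A: "A t \<in> sets ?M" for t unfolding A_def by (rule emeasure_tree_of_eq_nodes)
  have B: "B \<in> sets ?M" unfolding B_def using A by (intro sets.Diff sets.top sets.countable_UN') auto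
  show ?thesis
  proof (rule measurable_piecewise_restrict[of "insert B (range A)"])
    show "countable (insert B (range A))" by simp
    show "\<Omega> \<inter> space ?M \<in> sets ?M" if "\<Omega> \<in> insert B (range A)" for \<Omega> using that A B by auto
    show "space ?M \<subseteq> \<Union> (insert B (range A))" by (auto simp: B_def)
    fix \<Omega> assume "\<Omega> \<in> insert B (range A)"
    then consider "\<Omega> = B" | t where "\<Omega> = A t" by auto
    then have "\<exists>c. \<forall>\<omega>\<in>\<Omega>. moment m (tree_of \<omega>) = c"
    proof cases
      case 1
      have "infinite (tree_of \<omega>)" if "\<omega> \<in> B" for \<omega>
        using that finite_tree_of_is_nodes unfolding B_def A_def by blast
      then show ?thesis using 1 assms num_root_subtrees_infinite by auto
    next
      case 2
      then show ?thesis by (auto simp: A_def)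
    qed
    then obtain c where "\<And>\<omega>. \<omega> \<in> \<Omega> \<Longrightarrow> moment m (tree_of \<omega>) = c" by blast
    then show "(\<lambda>\<omega>. moment m (tree_of \<omega>)) \<in> borel_measurable (restrict_space ?M \<Omega>)"
      by (subst measurable_cong[of _ _ "\<lambda>_. c"]) (auto simp: space_restrict_space)
  qed
qed

context
  fixes \<xi> :: "nat pmf"
begin

interpretation offspring "pmf \<xi>" by unfold_locales simp

lemma nn_integral_gw_size:
  assumes [measurable]: "(\<lambda>\<omega>. moment m (tree_of \<omega>)) \<in> borel_measurable (gw_space \<xi>)"
  shows "(\<integral>\<^sup>+\<omega>. ennreal (moment m (tree_of \<omega>)) * indicator (gw_size \<xi> n) \<omega> \<partial>gw_space \<xi>)
    = ennreal (F_coeff m n)"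
proof -
  have "(\<integral>\<^sup>+\<omega>. ennreal (moment m (tree_of \<omega>)) * indicator (gw_size \<xi> n) \<omega> \<partial>gw_space \<xi>)
     = (\<integral>\<^sup>+\<omega>. (\<Sum>t | tree_size t = n. ennreal (moment m (nodes t)) * indicator (tree_event \<xi> t) \<omega>) \<partial>gw_space \<xi>)"
    by (intro nn_integral_cong indicator_gw_size[where F = "\<lambda>T. ennreal (moment m T)"])
  also have "\<dots> = (\<Sum>t | tree_size t = n. \<integral>\<^sup>+\<omega>. ennreal (moment m (nodes t)) * indicator (tree_event \<xi> t) \<omega> \<partial>gw_space \<xi>)"
    by (rule nn_integral_sum) (use emeasure_tree_of_eq_nodes(1) in simp)
  also have "\<dots> = (\<Sum>t | tree_size t = n. ennreal (wt t * R t ^ m))"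
    using wt_nonneg
    by (intro sum.cong refl) (simp add: nn_integral_cmult_indicator emeasure_tree_of_eq_nodes num_root_subtrees_nodes ennreal_mult mult.commute)
  also have "\<dots> = ennreal (F_coeff m n)"
    unfolding F_coeff_def using wt_nonneg by (intro sum_ennreal) auto
  finally show ?thesis .
qed

lemma measure_gw_size: "measure (gw_space \<xi>) (gw_size \<xi> n) = F_coeff 0 n"
  and emeasure_gw_size: "emeasure (gw_space \<xi>) (gw_size \<xi> n) = ennreal (F_coeff 0 n)"
proof -
  show 1: "emeasure (gw_space \<xi>) (gw_size \<xi> n) = ennreal (F_coeff 0 n)"
    using nn_integral_gw_size[of 0 n] gw_size_measurable[of \<xi> n] by simp
  show "measure (gw_space \<xi>) (gw_size \<xi> n) = F_coeff 0 n"
    unfolding measure_def 1 using F_coeff_nonneg by simp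
qed

lemma gw_orders_eq: "gw_orders \<xi> = {n. F_coeff 0 n > 0}"
  unfolding gw_orders_def measure_gw_size ..

lemma cond_gw_moment:
  assumes m: "m \<ge> 1" and n: "n \<in> gw_orders \<xi>"
  shows "integral\<^sup>L (cond_gw_space \<xi> n) (\<lambda>\<omega>. moment m (tree_of \<omega>)) = F_coeff m n / F_coeff 0 n"
proof -
  note meas = num_root_subtrees_measurable[OF m, of \<xi>]
  have pos: "F_coeff 0 n > 0" using n by (simp add: gw_orders_eq)
  have "integral\<^sup>L (cond_gw_space \<xi> n) (\<lambda>\<omega>. moment m (tree_of \<omega>))
     = enn2real (\<integral>\<^sup>+\<omega>. ennreal (moment m (tree_of \<omega>)) \<partial>cond_gw_space \<xi> n)"
    using meas unfolding cond_gw_space_def by (intro integral_eq_nn_integral) auto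
  also have "(\<integral>\<^sup>+\<omega>. ennreal (moment m (tree_of \<omega>)) \<partial>cond_gw_space \<xi> n)
     = ennreal (F_coeff m n) / ennreal (F_coeff 0 n)"
    unfolding cond_gw_space_def
    by (subst nn_integral_uniform_measure)
      (use meas gw_size_measurable in \<open>auto simp: nn_integral_gw_size[OF meas] emeasure_gw_size\<close>)
  finally show ?thesis using pos F_coeff_nonneg by (simp add: divide_ennreal)
qed

end

section \<open>Criticality at the dominant singularity\<close>

lemma power_Suc_diff_ge:
  fixes x y :: real
  assumes "0 \<le> x" "x \<le> y"
  shows "y ^ Suc k - x ^ Suc k \<ge> real (Suc k) * x ^ k * (y - x)"
proof (induction k)
  case (Suc k)
  have "y ^ Suc (Suc k) - x ^ Suc (Suc k) = y * (y ^ Suc k - x ^ Suc k) + x ^ Suc k * (y - x)"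
    by (simp add: algebra_simps)
  moreover have "y * (y ^ Suc k - x ^ Suc k) \<ge> x * (real (Suc k) * x ^ k * (y - x))"
    using assms Suc by (intro mult_mono) auto
  ultimately show ?case by (simp add: algebra_simps)
qed simp

lemma continuous_on_power_series_real:
  assumes "\<And>n. c n \<ge> 0" "summable (\<lambda>n. c n * r ^ n)"
  shows "continuous_on {0..r} (\<lambda>x :: real. \<Sum>n. c n * x ^ n)"
proof -
  have "continuous_on {0..r} (\<lambda>x. Re (pseries c (of_real x)))"
    by (intro continuous_intros continuous_on_compose2[OF pseries_continuous_on[OF assms]]) auto
  moreover have "Re (pseries c (of_real x)) = (\<Sum>n. c n * x ^ n)" if "x \<in> {0..r}" for x
  proof -
    have "summable (\<lambda>n. c n * x ^ n)"
      using pseries_summable_norm(3)[OF assms, of "of_real x"] that by simp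
    then show ?thesis by (simp add: pseries_of_real)
  qed
  ultimately show ?thesis using continuous_on_cong by (metis (no_types, lifting))
qed

text \<open>\<open>steep\<close> is the form in which the divergence of \<Phi>' at its radius
  enters: a point where the series of \<Phi>' converges is never at the edge of convergence of
  \<Phi>. Finite and infinite radius are treated alike.\<close>

locale steep_offspring = offspring p for p +
  assumes p0: "p 0 > 0" and p_nonlinear: "\<exists>k\<ge>2. p k > 0" and p_sums: "p sums 1"
    and steep: "\<And>y. y \<ge> 0 \<Longrightarrow> summable (\<lambda>k. diffs p k * y ^ k) \<Longrightarrow> \<exists>r>y. summable (\<lambda>k. p k * r ^ k)"
begin

definition F :: "nat \<Rightarrow> real \<Rightarrow> real" where "F m z = (\<Sum>n. F_coeff m n * z ^ n)"
definition Y :: "nat \<Rightarrow> real \<Rightarrow> real" where "Y m z = (\<Sum>n. Y_coeff m n * z ^ n)"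
definition g :: "nat \<Rightarrow> real \<Rightarrow> real" where "g m z = (\<Sum>n. g_coeff m n * z ^ n)"
definition \<Phi> :: "real \<Rightarrow> real" where "\<Phi> y = (\<Sum>k. p k * y ^ k)"

definition conv :: "nat \<Rightarrow> real \<Rightarrow> bool" where
  "conv m z \<longleftrightarrow> z \<ge> 0 \<and> summable (\<lambda>n. F_coeff m n * z ^ n)"

lemma conv_Fe:
  assumes z: "z \<ge> 0" shows "conv m z \<longleftrightarrow> Fe m z \<noteq> \<top>"
proof
  assume "conv m z"
  then have "Fe m z = ennreal (\<Sum>n. F_coeff m n * z ^ n)"
    unfolding conv_def Fe_def using F_coeff_nonneg by (intro suminf_ennreal2) auto
  then show "Fe m z \<noteq> \<top>" by simp
next
  assume "Fe m z \<noteq> \<top>"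
  then have "summable (\<lambda>n. F_coeff m n * z ^ n)"
    unfolding Fe_def using F_coeff_nonneg z by (intro summable_suminf_not_top) auto
  then show "conv m z" using z by (simp add: conv_def)
qed

lemma conv_summable:
  assumes "conv m z"
  shows "summable (\<lambda>n. F_coeff m n * z ^ n)" "summable (\<lambda>n. Y_coeff m n * z ^ n)" "summable (\<lambda>n. g_coeff m n * z ^ n)"
proof -
  have z: "z \<ge> 0" using assms by (simp add: conv_def)
  show 1: "summable (\<lambda>n. F_coeff m n * z ^ n)" using assms by (simp add: conv_def)
  have "\<bar>Y_coeff m n * z ^ n\<bar> \<le> 2 ^ m * (F_coeff m n * z ^ n)" for n
    using mult_right_mono[OF Y_coeff_le[of m n], of "z ^ n"] Y_coeff_nonneg[of m n] z by (simp add: mult.assoc)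
  then show 2: "summable (\<lambda>n. Y_coeff m n * z ^ n)"
    by (intro summable_comparison_test'[OF summable_mult[OF 1, of "2 ^ m"], of 0]) auto
  show "summable (\<lambda>n. g_coeff m n * z ^ n)"
    using summable_diff[OF 2 1] by (simp add: Y_coeff_eq algebra_simps)
qed

lemma Y_eq: "conv m z \<Longrightarrow> Y m z = F m z + g m z"
  unfolding Y_def F_def g_def Y_coeff_eq distrib_right
  by (rule suminf_add[symmetric]) (rule conv_summable; assumption)+

lemma Y_nonneg: "conv m z \<Longrightarrow> Y m z \<ge> 0" and g_nonneg: "conv m z \<Longrightarrow> g m z \<ge> 0" and F_nonneg: "conv m z \<Longrightarrow> F m z \<ge> 0"
  using conv_summable[of m z] Y_coeff_nonneg g_coeff_nonneg F_coeff_nonneg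
  unfolding Y_def g_def F_def conv_def by (auto intro!: suminf_nonneg mult_nonneg_nonneg)

lemma functional_equation:
  assumes "conv m z" "z > 0"
  shows "summable (\<lambda>k. p k * Y m z ^ k)" "F m z = z * \<Phi> (Y m z)"
proof -
  note s = conv_summable[OF assms(1)]
  have Ye: "Ye m z = ennreal (Y m z)"
    unfolding Ye_def Y_def using s(2) Y_coeff_nonneg assms by (intro suminf_ennreal2) auto
  have Fe: "Fe m z = ennreal (F m z)"
    unfolding Fe_def F_def using s(1) F_coeff_nonneg assms by (intro suminf_ennreal2) auto
  have pY: "ennreal (p k) * ennreal (Y m z) ^ k = ennreal (p k * Y m z ^ k)" for k
    using p_nonneg Y_nonneg[OF assms(1)] by (simp add: ennreal_mult ennreal_power)
  have eq: "ennreal (F m z) = ennreal z * (\<Sum>k. ennreal (p k * Y m z ^ k))"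
    using Fe_recursion[of z m] assms unfolding Ye Fe pY by simp
  then have "(\<Sum>k. ennreal (p k * Y m z ^ k)) \<noteq> \<top>"
    using assms(2) by (metis ennreal_mult_eq_top_iff ennreal_neq_top ennreal_eq_0_iff not_le)
  then show sm: "summable (\<lambda>k. p k * Y m z ^ k)"
    using p_nonneg Y_nonneg[OF assms(1)] by (intro summable_suminf_not_top) auto
  have nn: "\<Phi> (Y m z) \<ge> 0"
    unfolding \<Phi>_def using sm p_nonneg Y_nonneg[OF assms(1)] by (intro suminf_nonneg) auto
  have "(\<Sum>k. ennreal (p k * Y m z ^ k)) = ennreal (\<Phi> (Y m z))"
    unfolding \<Phi>_def using sm p_nonneg Y_nonneg[OF assms(1)] by (intro suminf_ennreal2) auto
  then have "ennreal (F m z) = ennreal (z * \<Phi> (Y m z))"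
    using eq assms(2) nn by (simp add: ennreal_mult)
  then show "F m z = z * \<Phi> (Y m z)"
    using F_nonneg[OF assms(1)] assms(2) nn by simp
qed

lemma conv_of_supersolution:
  assumes z: "z \<ge> 0" and y: "y \<ge> 0" "summable (\<lambda>k. p k * y ^ k)" and s: "summable (\<lambda>n. g_coeff m n * z ^ n)"
    and le: "g m z + z * \<Phi> y \<le> y"
  shows "conv m z"
proof -
  have ge: "ge m z = ennreal (g m z)"
    unfolding ge_def g_def using s g_coeff_nonneg z by (intro suminf_ennreal2) auto
  have nn: "\<Phi> y \<ge> 0" "g m z \<ge> 0"
    unfolding \<Phi>_def g_def using y s z p_nonneg g_coeff_nonneg by (auto intro!: suminf_nonneg)
  have "(\<Sum>k. ennreal (p k) * ennreal y ^ k) = (\<Sum>k. ennreal (p k * y ^ k))"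
    using p_nonneg y by (simp add: ennreal_mult ennreal_power)
  also have "\<dots> = ennreal (\<Phi> y)"
    unfolding \<Phi>_def using y p_nonneg by (intro suminf_ennreal2) auto
  finally have "ge m z + ennreal z * (\<Sum>k. ennreal (p k) * ennreal y ^ k) = ennreal (g m z + z * \<Phi> y)"
    using nn z by (simp add: ge ennreal_mult)
  also have "\<dots> \<le> ennreal y" using le by (rule ennreal_leI)
  finally have "Fe m z \<le> ennreal y" by (rule Fe_le_supersolution[OF z])
  then have "Fe m z \<noteq> \<top>" using ennreal_neq_top top_unique by metis
  then show ?thesis using conv_Fe[OF z] by simp
qed

lemma conv_mono: "conv m z \<Longrightarrow> 0 \<le> z' \<Longrightarrow> z' \<le> z \<Longrightarrow> conv m z'"
  unfolding conv_def
  by (auto intro!: summable_comparison_test'[of "\<lambda>n. F_coeff m n * z ^ n" 0] mult_left_mono power_mono F_coeff_nonneg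
      simp: abs_mult F_coeff_nonneg)

lemma conv_index_mono: "conv m z \<Longrightarrow> m' \<le> m \<Longrightarrow> conv m' z"
  unfolding conv_def
  by (auto intro!: summable_comparison_test'[of "\<lambda>n. F_coeff m n * z ^ n" 0] mult_right_mono F_coeff_mono
      simp: abs_mult F_coeff_nonneg)

text \<open>For m = 0 one has g = 0 and \<Phi>(1) = 1, so 1 is a supersolution at z = 1. Higher
  moments enlarge the n-th coefficient by at most 2^(m n), whence the point 1 / 2^m.\<close>

lemma conv_ex: "\<exists>z>0. conv m z"
proof -
  have "conv 0 1"
  proof (rule conv_of_supersolution[of _ 1])
    have g0: "g_coeff 0 n = 0" for n by (simp add: g_coeff_def)
    show "summable (\<lambda>n. g_coeff 0 n * 1 ^ n)" by (simp add: g0)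
    show "summable (\<lambda>k. p k * 1 ^ k)" using p_sums by (simp add: sums_iff)
    show "g 0 1 + 1 * \<Phi> 1 \<le> 1" using p_sums by (simp add: g_def g0 \<Phi>_def sums_iff)
  qed auto
  then have s: "summable (F_coeff 0)" by (simp add: conv_def)
  have "F_coeff m n * (1 / 2 ^ m) ^ n \<le> F_coeff 0 n" for n
    using F_coeff_le_0[of m n] by (simp add: power_divide divide_le_eq mult.commute)
  then have "conv m (1 / 2 ^ m)"
    unfolding conv_def
    by (auto intro!: summable_comparison_test'[OF s, of 0] simp: abs_mult F_coeff_nonneg)
  then show ?thesis by (intro exI[of _ "1 / 2 ^ m"]) auto
qed

lemma leaf: "tree_size (Node []) = 1" "wt (Node []) = p 0" "R (Node []) = 1" by auto

lemma p0_le_F: "conv m z \<Longrightarrow> p 0 * z \<le> F m z"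
proof -
  assume c: "conv m z"
  then have z: "z \<ge> 0" by (simp add: conv_def)
  have "p 0 \<le> F_coeff m 1" using F_coeff_ge_weight[of "Node []" m] leaf by simp
  then have "p 0 * z \<le> (\<Sum>n\<in>{1}. F_coeff m n * z ^ n)" using z by (simp add: mult_right_mono)
  also have "\<dots> \<le> F m z"
    unfolding F_def using conv_summable(1)[OF c] z F_coeff_nonneg by (intro sum_le_suminf) auto
  finally show ?thesis .
qed

text \<open>A single nonlinear term suffices: F = z \<Phi>(Y) >= z p_k F^k with k >= 2 bounds F, and
  F >= p_0 z then bounds z. Consequently the radius of convergence is finite and F stays bounded on
  approaching it.\<close>

lemma conv_bounds:
  obtains k q where "k \<ge> 2" "q > 0" "\<And>m z. conv m z \<Longrightarrow> z > 0 \<Longrightarrow> F m z \<le> max 1 (1 / (z * q))"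
    "\<And>m z. conv m z \<Longrightarrow> z > 0 \<Longrightarrow> z \<le> max 1 (1 / (q * p 0 ^ (k - 1)))"
proof -
  obtain k where k: "k \<ge> 2" "p k > 0" using p_nonlinear by blast
  have main: "z * p k * F m z ^ (k - 1) \<le> 1" if c: "conv m z" and z: "z > 0" for m z
  proof -
    have Fpos: "F m z > 0" using p0_le_F[OF c] p0 z by (meson less_le_trans mult_pos_pos)
    have "p k * Y m z ^ k = (\<Sum>j\<in>{k}. p j * Y m z ^ j)" by simp
    also have "\<dots> \<le> \<Phi> (Y m z)"
      unfolding \<Phi>_def using functional_equation(1)[OF c z] p_nonneg Y_nonneg[OF c]
      by (intro sum_le_suminf) auto
    finally have "z * (p k * Y m z ^ k) \<le> F m z"
      using functional_equation(2)[OF c z] z by simp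
    moreover have "F m z ^ k \<le> Y m z ^ k"
      using Fpos g_nonneg[OF c] by (intro power_mono) (auto simp: Y_eq[OF c])
    then have "z * (p k * F m z ^ k) \<le> z * (p k * Y m z ^ k)" using z k by simp
    ultimately have "z * (p k * F m z ^ k) \<le> F m z" by linarith
    moreover have "F m z ^ k = F m z ^ (k - 1) * F m z" using k by (simp flip: power_Suc2)
    ultimately have "(z * p k * F m z ^ (k - 1)) * F m z \<le> 1 * F m z" by (simp add: mult_ac)
    then show ?thesis using Fpos by (rule mult_right_le_imp_le)
  qed
  show ?thesis
  proof (rule that[OF k])
    fix m z assume c: "conv m z" and z: "z > 0"
    have Fpos: "F m z > 0" using p0_le_F[OF c] p0 z by (meson less_le_trans mult_pos_pos)
    show "F m z \<le> max 1 (1 / (z * p k))"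
    proof (cases "F m z \<le> 1")
      case False
      then have "F m z ^ 1 \<le> F m z ^ (k - 1)" using k by (intro power_increasing) auto
      also have "\<dots> \<le> 1 / (z * p k)" using main[OF c z] z k by (simp add: pos_le_divide_eq mult.commute)
      finally show ?thesis by simp
    qed simp
    show "z \<le> max 1 (1 / (p k * p 0 ^ (k - 1)))"
    proof (cases "z \<le> 1")
      case False
      have "(p 0 * z) ^ (k - 1) \<le> F m z ^ (k - 1)" using p0_le_F[OF c] p0 z by (intro power_mono) auto
      then have "z * p k * (p 0 * z) ^ (k - 1) \<le> z * p k * F m z ^ (k - 1)" using z k by (intro mult_left_mono) auto
      then have "z * p k * (p 0 * z) ^ (k - 1) \<le> 1" using main[OF c z] by linarith
      then have "z * z ^ (k - 1) * (p k * p 0 ^ (k - 1)) \<le> 1" by (simp add: power_mult_distrib mult_ac)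
      moreover have "z \<le> z * z ^ (k - 1)" using False by (simp add: one_le_power)
      then have "z * (p k * p 0 ^ (k - 1)) \<le> z * z ^ (k - 1) * (p k * p 0 ^ (k - 1))"
        using k p0 by (intro mult_right_mono) auto
      ultimately have "z * (p k * p 0 ^ (k - 1)) \<le> 1" by linarith
      moreover have "p k * p 0 ^ (k - 1) > 0" using k p0 by simp
      ultimately have "z \<le> 1 / (p k * p 0 ^ (k - 1))" by (simp only: pos_le_divide_eq)
      then show ?thesis by simp
    qed simp
  qed
qed

section \<open>Radius of convergence and criticality\<close>

definition \<rho> :: "nat \<Rightarrow> real" where "\<rho> m = Sup {z. conv m z}"

lemma conv_bdd: "bdd_above {z. conv m z}"
proof -
  obtain k q where "\<And>m z. conv m z \<Longrightarrow> z > 0 \<Longrightarrow> z \<le> max 1 (1 / (q * p 0 ^ (k - 1)))"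
    using conv_bounds by metis
  then show ?thesis
    by (intro bdd_aboveI[of _ "max 1 (1 / (q * p 0 ^ (k - 1)))"]) (metis le_max_iff_disj linorder_le_less_linear mem_Collect_eq order_trans zero_le_one)
qed

lemma conv_le_\<rho>: "conv m z \<Longrightarrow> z \<le> \<rho> m"
  unfolding \<rho>_def by (rule cSup_upper[OF _ conv_bdd]) simp

lemma \<rho>_pos: "\<rho> m > 0"
  using conv_ex[of m] conv_le_\<rho> by (meson less_le_trans)

lemma conv_below_\<rho>: "0 \<le> z \<Longrightarrow> z < \<rho> m \<Longrightarrow> conv m z"
proof -
  assume z: "0 \<le> z" "z < \<rho> m"
  then obtain z' where "conv m z'" "z < z'"
    unfolding \<rho>_def using less_cSup_iff[OF _ conv_bdd[of m]] conv_ex[of m] by auto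
  then show ?thesis using conv_mono z by auto
qed

text \<open>The bound of \<open>conv_bounds\<close> is uniform on (\<rho> / 2, \<rho>), so it passes
  to each partial sum at \<rho> by continuity.\<close>

lemma conv_\<rho>: "conv m (\<rho> m)"
proof -
  obtain k q where q: "q > 0" and B: "\<And>m z. conv m z \<Longrightarrow> z > 0 \<Longrightarrow> F m z \<le> max 1 (1 / (z * q))"
    using conv_bounds by metis
  define C where "C = max 1 (2 / (\<rho> m * q))"
  have "(\<Sum>n<N. F_coeff m n * \<rho> m ^ n) \<le> C" for N
  proof -
    have "\<forall>\<^sub>F z in at_left (\<rho> m). z \<in> {\<rho> m / 2<..<\<rho> m}"
      using \<rho>_pos[of m] by (intro eventually_at_left_real) auto
    then have "\<forall>\<^sub>F z in at_left (\<rho> m). (\<Sum>n<N. F_coeff m n * z ^ n) \<le> C"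
    proof eventually_elim
      case (elim z)
      then have z: "z > 0" "conv m z" using \<rho>_pos[of m] conv_below_\<rho>[of z m] by auto
      have "(\<Sum>n<N. F_coeff m n * z ^ n) \<le> F m z"
        unfolding F_def using conv_summable(1)[OF z(2)] F_coeff_nonneg z by (intro sum_le_suminf) auto
      also have "\<dots> \<le> max 1 (1 / (z * q))" by (rule B[OF z(2,1)])
      also have "1 / (z * q) \<le> 1 / (\<rho> m / 2 * q)"
        using elim z q \<rho>_pos[of m] by (intro divide_left_mono mult_right_mono mult_pos_pos) auto
      then have "max 1 (1 / (z * q)) \<le> C" unfolding C_def by (intro max.mono) auto
      finally show ?case .
    qed
    moreover have "((\<lambda>z. \<Sum>n<N. F_coeff m n * z ^ n) \<longlongrightarrow> (\<Sum>n<N. F_coeff m n * \<rho> m ^ n)) (at_left (\<rho> m))"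
      by (intro tendsto_intros)
    ultimately show ?thesis
      by (intro tendsto_upperbound[where F = "at_left (\<rho> m)"] trivial_limit_at_left_real)
  qed
  then have "summable (\<lambda>n. F_coeff m n * \<rho> m ^ n)"
    using F_coeff_nonneg \<rho>_pos[of m] by (intro summableI_nonneg_bounded[of _ C]) auto
  then show ?thesis using \<rho>_pos[of m] by (simp add: conv_def)
qed

lemma Y_coeff_1_pos: "Y_coeff m 1 > 0"
  using Y_coeff_pos[of "Node []" m] leaf p0 by simp

lemma Y_strict_mono: "conv m z \<Longrightarrow> 0 \<le> z' \<Longrightarrow> z' < z \<Longrightarrow> Y m z' < Y m z"
  unfolding Y_def using Y_coeff_nonneg Y_coeff_1_pos conv_summable(2)
  by (intro pseries_strict_mono_real[where i = 1]) auto

lemma dp_nonneg: "diffs p k \<ge> 0"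
  using p_nonneg by (rule diffs_nonneg)

text \<open>Compare the equations at z and at \<rho>, with values y and y'. Convexity gives
  \<Phi>'(y) (y' - y) <= \<Phi>(y') - \<Phi>(y), and since g increases, z (\<Phi>(y') - \<Phi>(y))
  <= y' - y. Partial sums appear because z will tend to \<rho>, where the convergence of \<Phi>' is
  part of the claim.\<close>

lemma derivative_bound_below:
  assumes z: "0 < z" "z < \<rho> m"
  shows "z * (\<Sum>k<N. diffs p k * Y m z ^ k) \<le> 1"
proof -
  let ?\<rho> = "\<rho> m" and ?y = "Y m z" and ?y' = "Y m (\<rho> m)"
  have c: "conv m z" using conv_below_\<rho> z by simp
  note c' = conv_\<rho>[of m] and \<rho>0 = \<rho>_pos[of m]
  have y: "0 \<le> ?y" "?y < ?y'" using Y_nonneg[OF c] Y_strict_mono[OF c'] z by auto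
  have gle: "g m z \<le> g m ?\<rho>"
    unfolding g_def using z g_coeff_nonneg conv_summable(3)[OF c] conv_summable(3)[OF c']
    by (intro suminf_le mult_left_mono power_mono) auto
  have \<Phi>le: "0 \<le> \<Phi> ?y'"
    unfolding \<Phi>_def using functional_equation(1)[OF c' \<rho>0] p_nonneg y by (intro suminf_nonneg) auto
  have "(\<Sum>k<N. diffs p k * ?y ^ k) * (?y' - ?y) \<le> (\<Sum>k<N. p (Suc k) * (?y' ^ Suc k - ?y ^ Suc k))"
    unfolding sum_distrib_right
  proof (intro sum_mono)
    fix k
    have "p (Suc k) * (real (Suc k) * ?y ^ k * (?y' - ?y)) \<le> p (Suc k) * (?y' ^ Suc k - ?y ^ Suc k)"
      using y by (intro mult_left_mono power_Suc_diff_ge p_nonneg) auto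
    then show "diffs p k * ?y ^ k * (?y' - ?y) \<le> p (Suc k) * (?y' ^ Suc k - ?y ^ Suc k)"
      by (simp add: diffs_def mult_ac)
  qed
  also have "\<dots> = (\<Sum>k<Suc N. p k * (?y' ^ k - ?y ^ k))"
    by (subst sum.lessThan_Suc_shift) simp
  also have "\<dots> \<le> (\<Sum>k. p k * (?y' ^ k - ?y ^ k))"
  proof (rule sum_le_suminf)
    show "summable (\<lambda>k. p k * (?y' ^ k - ?y ^ k))"
      unfolding right_diff_distrib
      by (intro summable_diff functional_equation(1) c c' z \<rho>0)
    show "0 \<le> p k * (?y' ^ k - ?y ^ k)" for k
      using y p_nonneg power_mono[of ?y ?y' k] by simp
  qed simp
  also have "\<dots> = \<Phi> ?y' - \<Phi> ?y"
    unfolding \<Phi>_def right_diff_distrib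
    by (intro suminf_diff[symmetric] functional_equation(1) c c' z \<rho>0)
  finally have "z * ((\<Sum>k<N. diffs p k * ?y ^ k) * (?y' - ?y)) \<le> z * (\<Phi> ?y' - \<Phi> ?y)"
    using z by (intro mult_left_mono) auto
  also have "\<dots> \<le> ?\<rho> * \<Phi> ?y' - z * \<Phi> ?y"
    using mult_right_mono[OF _ \<Phi>le, of z ?\<rho>] z by (simp add: algebra_simps)
  also have "\<dots> \<le> 1 * (?y' - ?y)"
    unfolding functional_equation(2)[OF c z(1), symmetric] functional_equation(2)[OF c' \<rho>0, symmetric]
    using gle Y_eq[OF c] Y_eq[OF c'] by simp
  finally have "(z * (\<Sum>k<N. diffs p k * ?y ^ k)) * (?y' - ?y) \<le> 1 * (?y' - ?y)" by (simp add: mult.assoc)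
  then show ?thesis by (rule mult_right_le_imp_le) (use y in simp)
qed

lemma derivative_bound:
  "summable (\<lambda>k. diffs p k * Y m (\<rho> m) ^ k)" "\<rho> m * (\<Sum>k. diffs p k * Y m (\<rho> m) ^ k) \<le> 1"
proof -
  note \<rho>0 = \<rho>_pos[of m] and c = conv_\<rho>[of m]
  have fin: "\<rho> m * (\<Sum>k<N. diffs p k * Y m (\<rho> m) ^ k) \<le> 1" for N
  proof -
    have "continuous_on {0..\<rho> m} (Y m)"
      unfolding Y_def[abs_def] by (rule continuous_on_power_series_real[OF Y_coeff_nonneg conv_summable(2)[OF c]])
    then have "(Y m \<longlongrightarrow> Y m (\<rho> m)) (at (\<rho> m) within {0..\<rho> m})"
      using \<rho>0 by (auto simp: continuous_on)
    then have "(Y m \<longlongrightarrow> Y m (\<rho> m)) (at_left (\<rho> m))"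
      by (simp only: at_within_Icc_at_left[OF \<rho>0])
    then have "((\<lambda>z. z * (\<Sum>k<N. diffs p k * Y m z ^ k)) \<longlongrightarrow> \<rho> m * (\<Sum>k<N. diffs p k * Y m (\<rho> m) ^ k)) (at_left (\<rho> m))"
      by (intro tendsto_intros)
    moreover have "\<forall>\<^sub>F z in at_left (\<rho> m). z * (\<Sum>k<N. diffs p k * Y m z ^ k) \<le> 1"
      by (rule eventually_mono[OF eventually_at_left_real[OF \<rho>0]]) (use derivative_bound_below in auto)
    ultimately show ?thesis
      by (intro tendsto_upperbound[where F = "at_left (\<rho> m)"] trivial_limit_at_left_real)
  qed
  have nn: "0 \<le> diffs p k * Y m (\<rho> m) ^ k" for k using dp_nonneg Y_nonneg[OF c] by simp
  have fin': "(\<Sum>k<N. diffs p k * Y m (\<rho> m) ^ k) \<le> 1 / \<rho> m" for N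
    using fin[of N] \<rho>0 by (simp add: pos_le_divide_eq mult.commute)
  show s: "summable (\<lambda>k. diffs p k * Y m (\<rho> m) ^ k)"
    by (rule summableI_nonneg_bounded[OF nn fin'])
  have "(\<Sum>k. diffs p k * Y m (\<rho> m) ^ k) \<le> 1 / \<rho> m"
    by (rule suminf_le_const[OF s fin'])
  then show "\<rho> m * (\<Sum>k. diffs p k * Y m (\<rho> m) ^ k) \<le> 1"
    using \<rho>0 by (simp add: pos_le_divide_eq mult.commute)
qed

lemma ex_radius: "\<exists>r>Y m (\<rho> m). summable (\<lambda>k. p k * r ^ k)"
  by (rule steep[OF Y_nonneg[OF conv_\<rho>] derivative_bound(1)])

text \<open>If the derivative at the singularity were below 1, a supersolution would exist slightly
  beyond the radius of convergence.\<close>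

lemma critical_of_g:
  assumes z1: "z1 > \<rho> m" and gs: "summable (\<lambda>n. g_coeff m n * z1 ^ n)"
  shows "\<rho> m * (\<Sum>k. diffs p k * Y m (\<rho> m) ^ k) = 1"
proof (rule ccontr)
  let ?\<rho> = "\<rho> m" and ?y = "Y m (\<rho> m)"
  note \<rho>0 = \<rho>_pos[of m] and c = conv_\<rho>[of m]
  assume "?\<rho> * (\<Sum>k. diffs p k * ?y ^ k) \<noteq> 1"
  then have less: "?\<rho> * (\<Sum>k. diffs p k * ?y ^ k) < 1" using derivative_bound(2)[of m] by simp
  obtain r where r: "r > ?y" "summable (\<lambda>k. p k * r ^ k)" using ex_radius by blast
  have y0: "?y \<ge> 0" by (rule Y_nonneg[OF c])
  have "(\<Phi> has_real_derivative (\<Sum>k. diffs p k * ?y ^ k)) (at ?y)"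
    unfolding \<Phi>_def[abs_def] by (rule termdiffs_strong[OF r(2)]) (use y0 r in simp)
  then have "((\<lambda>y. y - ?\<rho> * \<Phi> y) has_real_derivative (1 - ?\<rho> * (\<Sum>k. diffs p k * ?y ^ k))) (at ?y)"
    by (auto intro!: derivative_eq_intros)
  from DERIV_pos_inc_right[OF this] less obtain d where d: "d > 0"
    "\<And>h. h > 0 \<Longrightarrow> h < d \<Longrightarrow> ?y - ?\<rho> * \<Phi> ?y < (?y + h) - ?\<rho> * \<Phi> (?y + h)" by auto
  \<comment> \<open>Since y - \<rho> \<Phi>(y) has positive slope at the value on the boundary, a
    small step upwards gives a strict supersolution at \<rho>, and strictness survives a slight
    increase of z. The halves keep the step below \<open>d\<close> and the new value below
    \<open>r\<close>.\<close>
  define h where "h = min (d / 2) ((r - ?y) / 2)"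
  define y1 where "y1 = ?y + h"
  have h: "h > 0" "h < d" "?y + h < r" using d r by (auto simp: h_def min_def field_simps)
  have y1: "y1 > 0" "y1 < r" using h y0 by (auto simp: y1_def)
  have py1: "summable (\<lambda>k. p k * y1 ^ k)"
    by (rule powser_inside[OF r(2)]) (use y1 in simp)
  have "?y - ?\<rho> * \<Phi> ?y = g m ?\<rho>" using Y_eq[OF c] functional_equation(2)[OF c \<rho>0] by simp
  then have lt: "g m ?\<rho> + ?\<rho> * \<Phi> y1 < y1" using d(2)[OF h(1,2)] by (simp add: y1_def)
  have "continuous_on {0..z1} (g m)"
    unfolding g_def[abs_def] by (rule continuous_on_power_series_real[OF g_coeff_nonneg gs])
  then have "isCont (g m) ?\<rho>"
    by (rule continuous_on_interior) (use \<rho>0 z1 in auto)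
  then have "isCont (\<lambda>z. g m z + z * \<Phi> y1) ?\<rho>" by (intro continuous_intros)
  then have "((\<lambda>z. g m z + z * \<Phi> y1) \<longlongrightarrow> g m ?\<rho> + ?\<rho> * \<Phi> y1) (at_right ?\<rho>)"
    unfolding isCont_def by (rule filterlim_at_split[THEN iffD1, THEN conjunct2])
  then have "\<forall>\<^sub>F z in at_right ?\<rho>. g m z + z * \<Phi> y1 < y1" using lt by (rule order_tendstoD(2))
  moreover have "\<forall>\<^sub>F z in at_right ?\<rho>. z \<in> {?\<rho><..<z1}" using z1 by (rule eventually_at_right_real)
  ultimately have "\<forall>\<^sub>F z in at_right ?\<rho>. g m z + z * \<Phi> y1 < y1 \<and> z \<in> {?\<rho><..<z1}" by (rule eventually_conj)
  then obtain z where z: "g m z + z * \<Phi> y1 < y1" "?\<rho> < z" "z < z1"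
    using eventually_happens'[OF trivial_limit_at_right_real] by fastforce
  have "conv m z"
    by (rule conv_of_supersolution[of z y1]) (use z y1 py1 \<rho>0 in \<open>auto intro!: powser_inside[OF gs]\<close>)
  then show False using conv_le_\<rho> z by fastforce
qed

text \<open>The one-node tree already separates the two series: it contributes p_0 2^m to one and
  p_0 2^(m + 1) to the other.\<close>

lemma Y_index_strict_mono: "conv (Suc m) z \<Longrightarrow> z > 0 \<Longrightarrow> Y m z < Y (Suc m) z"
proof -
  assume c: "conv (Suc m) z" and z: "z > 0"
  have c': "conv m z" using conv_index_mono[OF c] by simp
  have "p 0 \<le> wt (Node []) * ((1 + R (Node [])) ^ m * R (Node []))"
    using p0 by (simp add: one_le_power)
  also have "\<dots> \<le> (\<Sum>t | tree_size t = 1. wt t * ((1 + R t) ^ m * R t))"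
    by (rule member_le_sum) (auto intro!: mult_nonneg_nonneg wt_nonneg finite_tree_size)
  also have "\<dots> = Y_coeff (Suc m) 1 - Y_coeff m 1"
    unfolding Y_coeff_def by (simp add: algebra_simps flip: sum_subtractf)
  finally have "Y_coeff m 1 < Y_coeff (Suc m) 1" using p0 by linarith
  then have "0 < (\<Sum>n. Y_coeff (Suc m) n * z ^ n - Y_coeff m n * z ^ n)"
    using z c c' Y_coeff_mono[of m "Suc m"] conv_summable(2)
    by (intro suminf_pos2[where i = 1] summable_diff) (auto intro!: mult_right_mono)
  then show ?thesis
    unfolding Y_def using suminf_diff[OF conv_summable(2)[OF c] conv_summable(2)[OF c']] by simp
qed

lemma g_Suc_summable: "summable (\<lambda>n. g_coeff (Suc m) n * \<rho> m ^ n)"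
proof -
  obtain K where K: "K \<ge> 0" "\<And>n. g_coeff (Suc m) n \<le> K * F_coeff m n" using ex_g_coeff_le by blast
  have "\<bar>g_coeff (Suc m) n * \<rho> m ^ n\<bar> \<le> K * (F_coeff m n * \<rho> m ^ n)" for n
    using mult_right_mono[OF K(2)[of n], of "\<rho> m ^ n"] g_coeff_nonneg[of "Suc m" n] \<rho>_pos[of m]
    by (simp add: mult.assoc)
  then show ?thesis
    by (intro summable_comparison_test'[OF summable_mult[OF conv_summable(1)[OF conv_\<rho>[of m]], of K], of 0]) auto
qed

text \<open>The two claims feed each other: criticality at m gives the decrease, the decrease puts
  \<rho> (m + 1) strictly inside the range where g (m + 1) converges, and this gives criticality at
  m + 1. Equal consecutive radii would push \<rho> \<Phi>' at level m + 1 above the bound 1 of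
  \<open>derivative_bound\<close>.\<close>

lemma critical_and_decreasing:
  "\<rho> m * (\<Sum>k. diffs p k * Y m (\<rho> m) ^ k) = 1 \<and> \<rho> (Suc m) < \<rho> m"
proof -
  have dec: "\<rho> (Suc m) < \<rho> m" if crit: "\<rho> m * (\<Sum>k. diffs p k * Y m (\<rho> m) ^ k) = 1" for m
  proof (rule ccontr)
    assume "\<not> \<rho> (Suc m) < \<rho> m"
    moreover have "\<rho> (Suc m) \<le> \<rho> m"
      by (rule conv_le_\<rho>[OF conv_index_mono[OF conv_\<rho>]]) simp
    ultimately have eq: "\<rho> (Suc m) = \<rho> m" by simp
    obtain k where k: "k \<ge> 2" "p k > 0" using p_nonlinear by blast
    have "(\<Sum>k. diffs p k * Y m (\<rho> m) ^ k) < (\<Sum>k. diffs p k * Y (Suc m) (\<rho> m) ^ k)"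
      using Y_index_strict_mono[of m "\<rho> m"] conv_\<rho>[of "Suc m"] \<rho>_pos[of m] eq k Y_nonneg[OF conv_\<rho>[of m]]
        derivative_bound(1)[of "Suc m"] dp_nonneg
      by (intro pseries_strict_mono_real[where i = "k - 1"]) (auto simp: diffs_def)
    then have "\<rho> m * (\<Sum>k. diffs p k * Y m (\<rho> m) ^ k) < \<rho> m * (\<Sum>k. diffs p k * Y (Suc m) (\<rho> m) ^ k)"
      using \<rho>_pos[of m] by simp
    then show False using crit derivative_bound(2)[of "Suc m"] eq by simp
  qed
  have "\<rho> m * (\<Sum>k. diffs p k * Y m (\<rho> m) ^ k) = 1"
  proof (induction m)
    case 0
    \<comment> \<open>The series g vanishes for m = 0, so any point beyond \<rho> 0 will do.\<close>
    show ?case by (rule critical_of_g[of 0 "\<rho> 0 + 1"]) (auto simp: g_coeff_def)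
  next
    case (Suc m)
    show ?case by (rule critical_of_g[OF dec[OF Suc] g_Suc_summable])
  qed
  then show ?thesis using dec by blast
qed

lemma g_summable_beyond: "\<exists>z1>\<rho> m. summable (\<lambda>n. g_coeff m n * z1 ^ n)"
proof (cases m)
  case 0
  then show ?thesis by (intro exI[of _ "\<rho> m + 1"]) (auto simp: g_coeff_def)
next
  case (Suc m')
  then show ?thesis using critical_and_decreasing[of m'] g_Suc_summable[of m'] by blast
qed

text \<open>By induction each of the k branches contributes a factor u, and the root another, so the
  result is u * u^k = u. Hence every n that is the size of a tree of nonzero weight satisfies u^n =
  u for all dominant singularities u.\<close>

lemma power_tree_size:
  fixes u :: complex
  assumes u: "\<And>k. p k > 0 \<Longrightarrow> u ^ k = 1" and "wt t \<noteq> 0"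
  shows "u ^ tree_size t = u"
  using assms(2)
proof (induction t)
  case (Node ts)
  have nz: "p (length ts) \<noteq> 0" "wt t \<noteq> 0" if "t \<in> set ts" for t
    using Node.prems that by (auto simp: prod_list_zero_iff)
  have "u ^ (\<Sum>t\<leftarrow>ts. tree_size t) = (\<Prod>t\<leftarrow>ts. u ^ tree_size t)"
    by (rule prod_list_power_const[symmetric])
  also have "\<dots> = (\<Prod>t\<leftarrow>ts. u)"
    using Node.IH nz(2) by (intro arg_cong[where f = prod_list] map_cong) auto
  also have "\<dots> = u ^ length ts" by (induction ts) auto
  also have "\<dots> = 1"
    using Node.prems p_nonneg[of "length ts"] by (intro u) auto
  finally show ?case by simp
qed

lemma ex_weight_of_coeff: "Y_coeff m n \<noteq> 0 \<Longrightarrow> \<exists>t. tree_size t = n \<and> wt t \<noteq> 0"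
  unfolding Y_coeff_def by (erule sum.not_neutral_contains_not_neutral) auto

lemma F_coeff_pos: "wt t > 0 \<Longrightarrow> F_coeff m (tree_size t) > 0"
  using F_coeff_ge_weight[of t m] R_ge_1[of t] by (smt (verit) mult_pos_pos zero_less_power)

text \<open>Hanging a tree below a new root with k >= 2 children, the other children being leaves,
  keeps the weight positive and increases the size.\<close>

lemma infinite_orders: "infinite {n. F_coeff 0 n > 0}"
proof -
  obtain k where k: "k \<ge> 2" "p k > 0" using p_nonlinear by blast
  have lf: "wt (Node []) > 0" using p0 by simp
  have "\<exists>t. wt t > 0 \<and> tree_size t > j" for j
  proof (induction j)
    case 0
    then show ?case using lf tree_size_pos by blast
  next
    case (Suc j)
    then obtain t where t: "wt t > 0" "tree_size t > j" by blast
    define t' where "t' = Node (t # replicate (k - 1) (Node []))"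
    have "wt t' = p k * (wt t * p 0 ^ (k - 1))"
      using k by (simp add: t'_def prod_list_replicate)
    then have "wt t' > 0" using k t p0 by simp
    moreover have "tree_size t' > Suc j" using t by (simp add: t'_def)
    ultimately show ?case by blast
  qed
  then have "\<exists>n>j. n \<in> {n. F_coeff 0 n > 0}" for j using F_coeff_pos[of _ 0] by blast
  then show ?thesis unfolding infinite_nat_iff_unbounded by blast
qed

theorem F_coeff_asymptotics:
  "\<exists>c C. c > 0 \<and> (\<forall>n\<ge>1. F_coeff 0 n > 0 \<longrightarrow>
     \<bar>F_coeff m n * \<rho> m ^ n - c * \<bar>sqrt_coeff 1 n\<bar>\<bar> \<le> C * \<bar>sqrt_coeff 1 n\<bar> / real n)"
proof -
  note \<rho>0 = \<rho>_pos[of m] and c = conv_\<rho>[of m]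
  obtain r where r: "r > Y m (\<rho> m)" "summable (\<lambda>k. p k * r ^ k)" using ex_radius by blast
  obtain z1 where z1: "z1 > \<rho> m" "summable (\<lambda>n. g_coeff m n * z1 ^ n)" using g_summable_beyond by blast
  \<comment> \<open>Rescaling by \<rho> m moves the singularity to 1, and moving the factor \<rho> m
    into the weights keeps the functional equation in the form that the locale expects.\<close>
  define a where "a = (\<lambda>n. Y_coeff m n * \<rho> m ^ n)"
  define b where "b = (\<lambda>n. g_coeff m n * \<rho> m ^ n)"
  define q where "q = (\<lambda>k. \<rho> m * p k)"
  have q_pos: "q k > 0 \<longleftrightarrow> p k > 0" for k using \<rho>0 by (simp add: q_def zero_less_mult_iff)
  interpret S: sqrt_singularity q a b "z1 / \<rho> m" r "Y m (\<rho> m)"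
  proof unfold_locales
    show "q k \<ge> 0" "a n \<ge> 0" "b n \<ge> 0" for k n
      using Y_coeff_nonneg g_coeff_nonneg p_nonneg \<rho>0 by (simp_all add: a_def b_def q_def)
    show "q 0 > 0" "\<exists>k\<ge>2. q k > 0" unfolding q_pos by (rule p0, rule p_nonlinear)
    show "a sums Y m (\<rho> m)"
      unfolding a_def Y_def by (rule summable_sums[OF conv_summable(2)[OF c]])
    show "summable (\<lambda>k. q k * r ^ k)"
      using summable_mult[OF r(2), of "\<rho> m"] by (simp add: q_def mult.assoc)
    show "1 < z1 / \<rho> m" using z1 \<rho>0 by simp
    show "summable (\<lambda>n. b n * (z1 / \<rho> m) ^ n)"
      using z1(2) \<rho>0 by (simp add: b_def power_divide)
    show "(\<Sum>n. a n * x ^ n) = (\<Sum>n. b n * x ^ n) + x * (\<Sum>k. q k * (\<Sum>n. a n * x ^ n) ^ k)"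
      if x: "0 < x" "x < 1" for x
    proof -
      have cx: "conv m (\<rho> m * x)"
        by (rule conv_mono[OF c]) (use \<rho>0 x in \<open>auto simp: mult_le_cancel_left1\<close>)
      have \<rho>x: "\<rho> m * x > 0" using \<rho>0 x by simp
      note fe = functional_equation[OF cx \<rho>x]
      have ab: "(\<Sum>n. a n * x ^ n) = Y m (\<rho> m * x)" "(\<Sum>n. b n * x ^ n) = g m (\<rho> m * x)"
        by (simp_all add: a_def b_def Y_def g_def power_mult_distrib mult.assoc)
      have "(\<Sum>k. q k * Y m (\<rho> m * x) ^ k) = \<rho> m * \<Phi> (Y m (\<rho> m * x))"
        unfolding \<Phi>_def q_def mult.assoc by (rule suminf_mult[OF fe(1)])
      then show ?thesis unfolding ab using Y_eq[OF cx] fe(2) by (simp add: mult_ac)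
    qed
    have "(\<Sum>k. diffs q k * Y m (\<rho> m) ^ k) = \<rho> m * (\<Sum>k. diffs p k * Y m (\<rho> m) ^ k)"
      by (subst suminf_mult[OF derivative_bound(1), symmetric]) (simp add: q_def diffs_def mult_ac)
    then show "(\<Sum>k. diffs q k * Y m (\<rho> m) ^ k) = 1" using critical_and_decreasing[of m] by simp
    show "a 1 > 0" using Y_coeff_1_pos \<rho>0 by (simp add: a_def)
    show "a (Suc k) > 0" if "q k > 0" for k
    proof -
      \<comment> \<open>The star with k leaves has k + 1 nodes and uses only the weights of 0 and
        k.\<close>
      define t where "t = Node (replicate k (Node []))"
      have "wt t = p k * p 0 ^ k" by (simp add: t_def prod_list_replicate)
      then have "wt t > 0" using that p0 by (simp add: q_pos)
      moreover have "tree_size t = Suc k" by (simp add: t_def sum_list_replicate)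
      ultimately have "Y_coeff m (Suc k) > 0" using Y_coeff_pos[of t m] by simp
      then show ?thesis using \<rho>0 by (simp add: a_def)
    qed
  qed (rule r)
  have good: "u ^ n = u" if "Y_coeff m' n \<noteq> 0" "u \<in> S.\<Omega>" for n u m'
  proof -
    obtain t where t: "tree_size t = n" "wt t \<noteq> 0"
      using ex_weight_of_coeff[OF \<open>Y_coeff m' n \<noteq> 0\<close>] by blast
    have "u ^ k = 1" if "p k > 0" for k
      using \<open>u \<in> S.\<Omega>\<close> that by (simp add: S.\<Omega>_def q_pos)
    from power_tree_size[OF this t(2)] show ?thesis by (simp add: t(1))
  qed
  obtain c' C where cC: "c' > 0" "\<And>n. n \<in> {n. F_coeff 0 n > 0} \<Longrightarrow> n \<ge> 1 \<Longrightarrow>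
      \<bar>(a n - b n) - c' * \<bar>sqrt_coeff 1 n\<bar>\<bar> \<le> C * \<bar>sqrt_coeff 1 n\<bar> / real n"
  proof (rule S.coefficient_asymptotics[OF _ _ infinite_orders])
    show "b n \<le> a n" for n
      using \<rho>0 F_coeff_nonneg[of m n] by (simp add: a_def b_def Y_coeff_eq)
    show "u ^ n = u" if "a n \<noteq> 0" "u \<in> S.\<Omega>" for n u
      using good[of m n u] that by (simp add: a_def)
    show "u ^ n = u" if "n \<in> {n. F_coeff 0 n > 0}" "u \<in> S.\<Omega>" for n u
      using good[of 0 n u] that g_coeff_nonneg[of 0 n] by (simp add: Y_coeff_eq)
  qed blast
  have "a n - b n = F_coeff m n * \<rho> m ^ n" for n
    by (simp add: a_def b_def Y_coeff_eq algebra_simps)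
  then show ?thesis using cC by (intro exI[of _ c'] exI[of _ C]) auto
qed

text \<open>The numbers \<open>sqrt_coeff 1 n\<close> are common to numerator and denominator and
  cancel, so no power of n survives. The constant is the quotient of the leading constants for m and
  for 0.\<close>

theorem F_coeff_ratio:
  "\<exists>\<gamma>>0. \<exists>C. \<forall>\<^sub>F n in at_top. F_coeff 0 n > 0 \<longrightarrow>
    \<bar>F_coeff m n / F_coeff 0 n / (\<gamma> * (\<rho> 0 / \<rho> m) ^ n) - 1\<bar> \<le> C / real n"
proof -
  obtain c C where c: "c > 0" and C: "\<And>n. n \<ge> 1 \<Longrightarrow> F_coeff 0 n > 0 \<Longrightarrow>
     \<bar>F_coeff m n * \<rho> m ^ n - c * \<bar>sqrt_coeff 1 n\<bar>\<bar> \<le> C * \<bar>sqrt_coeff 1 n\<bar> / real n"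
    using F_coeff_asymptotics[of m] by blast
  obtain c0 C0 where c0: "c0 > 0" and C0: "\<And>n. n \<ge> 1 \<Longrightarrow> F_coeff 0 n > 0 \<Longrightarrow>
     \<bar>F_coeff 0 n * \<rho> 0 ^ n - c0 * \<bar>sqrt_coeff 1 n\<bar>\<bar> \<le> C0 * \<bar>sqrt_coeff 1 n\<bar> / real n"
    using F_coeff_asymptotics[of 0] by blast
  \<comment> \<open>The errors of numerator and denominator over c0 * c / 2, a lower bound for y * c
    as soon as n >= 2 * C0 / c0.\<close>
  define D where "D = (C * c0 + C0 * c) / (c0 * c / 2)"
  have "\<bar>F_coeff m n / F_coeff 0 n / ((c / c0) * (\<rho> 0 / \<rho> m) ^ n) - 1\<bar> \<le> D / real n"
    if n: "n \<ge> 1" "real n \<ge> 2 * C0 / c0" and pos: "F_coeff 0 n > 0" for n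
  proof -
    define \<beta> where "\<beta> = \<bar>sqrt_coeff 1 n\<bar>"
    have \<beta>: "\<beta> > 0" unfolding \<beta>_def by (rule sqrt_coeff_1_pos[OF n(1)])
    define x where "x = F_coeff m n * \<rho> m ^ n / \<beta>"
    define y where "y = F_coeff 0 n * \<rho> 0 ^ n / \<beta>"
    have quot: "\<bar>v / \<beta> - d\<bar> \<le> D / real n" if "\<bar>v - d * \<beta>\<bar> \<le> D * \<beta> / real n" for v d D
    proof -
      have "v / \<beta> - d = (v - d * \<beta>) / \<beta>" using \<beta> by (simp add: diff_divide_distrib)
      then have "\<bar>v / \<beta> - d\<bar> = \<bar>v - d * \<beta>\<bar> / \<beta>" using \<beta> by (simp add: abs_divide)
      also have "\<dots> \<le> (D * \<beta> / real n) / \<beta>" using that \<beta> by (intro divide_right_mono) auto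
      finally show ?thesis using \<beta> by simp
    qed
    have x: "\<bar>x - c\<bar> \<le> C / real n"
      unfolding x_def by (rule quot) (use C[OF n(1) pos] in \<open>simp add: \<beta>_def\<close>)
    have y: "\<bar>y - c0\<bar> \<le> C0 / real n"
      unfolding y_def by (rule quot) (use C0[OF n(1) pos] in \<open>simp add: \<beta>_def\<close>)
    have "C0 / real n \<le> c0 / 2"
      using n c0 by (simp add: pos_divide_le_eq mult.commute)
    then have y2: "y \<ge> c0 / 2" using y by linarith
    have ypos: "y > 0" using y2 c0 by linarith
    have "F_coeff m n / F_coeff 0 n / ((c / c0) * (\<rho> 0 / \<rho> m) ^ n) = (x * c0) / (y * c)"
      using \<beta> c c0 pos \<rho>_pos[of m] \<rho>_pos[of 0] by (simp add: x_def y_def power_divide field_simps)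
    also have "\<dots> - 1 = ((x - c) * c0 - (y - c0) * c) / (y * c)"
      using ypos c by (simp add: field_simps)
    finally have "\<bar>F_coeff m n / F_coeff 0 n / ((c / c0) * (\<rho> 0 / \<rho> m) ^ n) - 1\<bar>
       = \<bar>(x - c) * c0 - (y - c0) * c\<bar> / (y * c)"
      using ypos c by (simp add: abs_divide abs_mult)
    also have "\<dots> \<le> ((C / real n) * c0 + (C0 / real n) * c) / (c0 / 2 * c)"
    proof (rule frac_le)
      have "\<bar>(x - c) * c0\<bar> \<le> (C / real n) * c0" "\<bar>(y - c0) * c\<bar> \<le> (C0 / real n) * c"
        using mult_right_mono[OF x, of c0] mult_right_mono[OF y, of c] c c0 by (simp_all add: abs_mult)
      then show "\<bar>(x - c) * c0 - (y - c0) * c\<bar> \<le> (C / real n) * c0 + (C0 / real n) * c" by linarith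
      then show "0 \<le> (C / real n) * c0 + (C0 / real n) * c" by linarith
      show "0 < c0 / 2 * c" using c c0 by simp
      show "c0 / 2 * c \<le> y * c" using y2 c by (intro mult_right_mono) auto
    qed
    also have "\<dots> = D / real n"
      by (simp add: D_def add_divide_distrib[symmetric])
    finally show ?thesis .
  qed
  moreover have "\<forall>\<^sub>F n in at_top. n \<ge> 1 \<and> real n \<ge> 2 * C0 / c0"
    by (intro eventually_conj eventually_ge_at_top filterlim_at_top[THEN iffD1, OF filterlim_real_sequentially, rule_format])
  ultimately have "\<forall>\<^sub>F n in at_top. F_coeff 0 n > 0 \<longrightarrow>
      \<bar>F_coeff m n / F_coeff 0 n / ((c / c0) * (\<rho> 0 / \<rho> m) ^ n) - 1\<bar> \<le> D / real n"
    by (auto elim!: eventually_mono)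
  then show ?thesis using c c0 by (intro exI[of _ "c / c0"] conjI exI[of _ D]) auto
qed

end

section \<open>Moments of the number of root subtrees\<close>

lemma pmf_nat_integrable_iff:
  fixes f :: "nat \<Rightarrow> real"
  shows "integrable (measure_pmf \<xi>) f \<longleftrightarrow> summable (\<lambda>k. \<bar>pmf \<xi> k * f k\<bar>)"
proof -
  have "integrable (measure_pmf \<xi>) f \<longleftrightarrow> integrable (count_space UNIV) (\<lambda>k. pmf \<xi> k *\<^sub>R f k)"
    unfolding measure_pmf_eq_density by (rule integrable_density) auto
  then show ?thesis by (simp add: integrable_count_space_nat_iff)
qed

lemma pmf_nat_expectation:
  fixes f :: "nat \<Rightarrow> real"
  assumes "summable (\<lambda>k. \<bar>pmf \<xi> k * f k\<bar>)"
  shows "measure_pmf.expectation \<xi> f = (\<Sum>k. pmf \<xi> k * f k)"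
proof -
  have "measure_pmf.expectation \<xi> f = integral\<^sup>L (count_space UNIV) (\<lambda>k. pmf \<xi> k *\<^sub>R f k)"
    unfolding measure_pmf_eq_density by (rule integral_density) auto
  also have "\<dots> = (\<Sum>k. pmf \<xi> k * f k)"
    using assms by (subst integral_count_space_nat) (auto simp: integrable_count_space_nat_iff)
  finally show ?thesis .
qed

lemma pmf_nat_sums_1: "pmf \<xi> sums (1 :: real)" for \<xi> :: "nat pmf"
proof -
  have "integrable (measure_pmf \<xi>) (\<lambda>_ :: nat. 1 :: real)" by simp
  then have s: "summable (\<lambda>k. \<bar>pmf \<xi> k * 1\<bar>)" by (simp only: pmf_nat_integrable_iff)
  have "(\<Sum>k. pmf \<xi> k * 1) = (1 :: real)"
    using pmf_nat_expectation[OF s] by simp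
  then show ?thesis using s by (simp add: sums_iff)
qed

text \<open>A variable with mean 1 that is always at least 1, or always at most 1, equals 1 almost
  surely, against the positive variance.\<close>

lemma pmf_mean_1_variance_pos:
  fixes \<xi> :: "nat pmf"
  assumes int: "integrable (measure_pmf \<xi>) (\<lambda>k. real k)"
    and mean: "measure_pmf.expectation \<xi> (\<lambda>k. real k) = 1"
    and var: "measure_pmf.variance \<xi> (\<lambda>k. real k) > 0"
  shows "pmf \<xi> 0 > 0" "\<exists>k\<ge>2. pmf \<xi> k > 0"
proof -
  have contra: False if "AE k in measure_pmf \<xi>. real k - 1 = 0"
  proof -
    have "measure_pmf.variance \<xi> (\<lambda>k. real k) = measure_pmf.expectation \<xi> (\<lambda>k. 0)"
      unfolding mean using that by (intro integral_cong_AE) auto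
    then show False using var by simp
  qed
  have e: "measure_pmf.expectation \<xi> (\<lambda>k. real k - 1) = 0" "measure_pmf.expectation \<xi> (\<lambda>k. 1 - real k) = 0"
    using int mean by simp_all
  have i: "integrable (measure_pmf \<xi>) (\<lambda>k. real k - 1)" "integrable (measure_pmf \<xi>) (\<lambda>k. 1 - real k)"
    using int by simp_all
  show "pmf \<xi> 0 > 0"
  proof (rule ccontr)
    assume "\<not> pmf \<xi> 0 > 0"
    then have "pmf \<xi> 0 = 0" using pmf_nonneg[of \<xi> 0] by linarith
    then have "AE k in measure_pmf \<xi>. 0 \<le> real k - 1"
      by (auto simp: AE_measure_pmf_iff set_pmf_iff Suc_le_eq intro: gr0I)
    then have "AE k in measure_pmf \<xi>. real k - 1 = 0"
      using integral_nonneg_eq_0_iff_AE[OF i(1)] e(1) by simp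
    then show False by (rule contra)
  qed
  show "\<exists>k\<ge>2. pmf \<xi> k > 0"
  proof (rule ccontr)
    assume "\<not> ?thesis"
    then have "pmf \<xi> k = 0" if "k \<ge> 2" for k using that pmf_nonneg[of \<xi> k] by (metis less_eq_real_def)
    then have "AE k in measure_pmf \<xi>. 0 \<le> 1 - real k"
      by (auto simp: AE_measure_pmf_iff set_pmf_iff) (metis not_less_eq_eq numeral_2_eq_2 One_nat_def of_nat_1 of_nat_le_iff)
    then have "AE k in measure_pmf \<xi>. 1 - real k = 0"
      using integral_nonneg_eq_0_iff_AE[OF i(2)] e(2) by simp
    then have "AE k in measure_pmf \<xi>. real k - 1 = 0" by eventually_elim simp
    then show False by (rule contra)
  qed
qed

lemma deriv_pgf:
  assumes s: "summable (\<lambda>k. pmf \<xi> k * y ^ k)" and x: "0 < x" "x < y"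
  shows "deriv (pgf \<xi>) x = (\<Sum>k. diffs (pmf \<xi>) k * x ^ k)"
proof -
  have der: "((\<lambda>z. \<Sum>k. pmf \<xi> k * z ^ k) has_field_derivative (\<Sum>k. diffs (pmf \<xi>) k * x ^ k)) (at x)"
    by (rule termdiffs_strong[OF s]) (use x in simp)
  have eq: "(\<Sum>k. pmf \<xi> k * z ^ k) = pgf \<xi> z" if z: "z \<in> {0<..<y}" for z
  proof -
    have "summable (\<lambda>k. pmf \<xi> k * z ^ k)"
      by (rule powser_inside[OF s]) (use z in simp)
    then have "summable (\<lambda>k. \<bar>pmf \<xi> k * z ^ k\<bar>)" using z by (simp add: abs_mult)
    then show ?thesis unfolding pgf_def by (simp add: pmf_nat_expectation)
  qed
  have "(pgf \<xi> has_field_derivative (\<Sum>k. diffs (pmf \<xi>) k * x ^ k)) (at x)"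
    by (rule has_field_derivative_transform_within_open[OF der open_greaterThanLessThan _ eq])
      (use x in auto)
  then show ?thesis by (rule DERIV_imp_deriv)
qed

text \<open>Below the radius there is room. Otherwise convergence of the derivative series at y
  makes y the radius itself and bounds \<Phi>' on the left of y by its value there, against the
  divergence of the derivative.\<close>

lemma pgf_steep:
  assumes lim: "filterlim (deriv (pgf \<xi>) \<circ> real_of_ereal) at_top (at_left (pgf_radius \<xi>))"
    and y: "y \<ge> 0" and sy: "summable (\<lambda>k. diffs (pmf \<xi>) k * y ^ k)"
  shows "\<exists>r>y. summable (\<lambda>k. pmf \<xi> k * r ^ k)"
proof (cases "ereal y < pgf_radius \<xi>")
  case True
  then obtain r where r: "ereal y < ereal r" "ereal r < pgf_radius \<xi>" using ereal_dense2 by blast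
  then have "summable (\<lambda>k. pmf \<xi> k * r ^ k)"
    using y by (intro summable_in_conv_radius) (simp add: pgf_radius_def)
  then show ?thesis using r by auto
next
  case False
  have "summable (\<lambda>k. y * (diffs (pmf \<xi>) k * y ^ k))" by (rule summable_mult[OF sy])
  then have "summable (\<lambda>k. pmf \<xi> (Suc k) * y ^ Suc k)"
  proof (rule summable_comparison_test'[where N = 0])
    fix k
    have "pmf \<xi> (Suc k) * y ^ Suc k \<le> real (Suc k) * (pmf \<xi> (Suc k) * y ^ Suc k)"
      using y mult_right_mono[of 1 "real (Suc k)" "pmf \<xi> (Suc k) * y ^ Suc k"] by simp
    then show "norm (pmf \<xi> (Suc k) * y ^ Suc k) \<le> y * (diffs (pmf \<xi>) k * y ^ k)"
      using y by (simp add: diffs_def mult_ac)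
  qed
  then have sp: "summable (\<lambda>k. pmf \<xi> k * y ^ k)" by (rule summable_Suc_iff[THEN iffD1])
  have ge: "pgf_radius \<xi> \<ge> ereal y"
    using conv_radius_geI[OF sp] y by (simp add: pgf_radius_def)
  then have R: "pgf_radius \<xi> = ereal y" using False by simp
  have "summable (\<lambda>k. pmf \<xi> k * 1 ^ k)" using pmf_nat_sums_1[of \<xi>] by (simp add: sums_iff)
  from conv_radius_geI[OF this] have y1: "y \<ge> 1" using R by (simp add: pgf_radius_def one_ereal_def)
  define B where "B = (\<Sum>k. diffs (pmf \<xi>) k * y ^ k)"
  have ev: "\<forall>\<^sub>F e in at_left (ereal y). B + 1 \<le> (deriv (pgf \<xi>) \<circ> real_of_ereal) e"
    using lim unfolding R filterlim_at_top by blast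
  have lt: "ereal 0 < ereal y" using y1 by simp
  have "\<exists>b<ereal y. \<forall>e>b. e < ereal y \<longrightarrow> B + 1 \<le> (deriv (pgf \<xi>) \<circ> real_of_ereal) e"
    using ev by (simp only: eventually_at_left[OF lt])
  then obtain b where b: "b < ereal y"
    "\<forall>e>b. e < ereal y \<longrightarrow> B + 1 \<le> (deriv (pgf \<xi>) \<circ> real_of_ereal) e" by (elim exE conjE)
  have "max b (ereal 0) < ereal y" using b y1 by simp
  then obtain x where x: "max b (ereal 0) < ereal x" "ereal x < ereal y" using ereal_dense2 by blast
  then have x': "0 < x" "x < y" by auto
  have "B + 1 \<le> deriv (pgf \<xi>) x" using b(2)[rule_format, of "ereal x"] x by simp
  also have "\<dots> = (\<Sum>k. diffs (pmf \<xi>) k * x ^ k)" by (rule deriv_pgf[OF sp x'])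
  also have "\<dots> \<le> B"
    unfolding B_def
  proof (rule suminf_le)
    show le: "diffs (pmf \<xi>) k * x ^ k \<le> diffs (pmf \<xi>) k * y ^ k" for k
      using x' by (intro mult_left_mono power_mono diffs_nonneg) auto
    show "summable (\<lambda>k. diffs (pmf \<xi>) k * x ^ k)"
      by (rule powser_inside[OF sy]) (use x' in simp)
  qed (rule sy)
  finally show ?thesis by simp
qed

theorem theorem2p2:
  fixes \<xi> :: "nat pmf"
  assumes "integrable (measure_pmf \<xi>) (\<lambda>k. real k)"
    and "measure_pmf.expectation \<xi> (\<lambda>k. real k) = 1"
    and "integrable (measure_pmf \<xi>) (\<lambda>k. (real k)\<^sup>2)"
    and "measure_pmf.variance \<xi> (\<lambda>k. real k) > 0"
    and "\<exists>t>0. integrable (measure_pmf \<xi>) (\<lambda>k. exp (t * real k))"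
    and "filterlim (deriv (pgf \<xi>) \<circ> real_of_ereal) at_top (at_left (pgf_radius \<xi>))"
  shows "\<exists>\<gamma> \<tau> :: nat \<Rightarrow> real.
    (\<forall>m\<ge>1. \<gamma> m > 0) \<and> 1 < \<tau> 1 \<and> strict_mono_on {1..} \<tau> \<and>
    (\<forall>m\<ge>1. \<exists>\<epsilon> \<in> O[inf at_top (principal (gw_orders \<xi>))](\<lambda>n. 1 / real n).
       \<forall>n \<in> gw_orders \<xi>.
         integral\<^sup>L (cond_gw_space \<xi> n) (\<lambda>\<omega>. real (num_root_subtrees (tree_of \<omega>)) ^ m)
           = (1 + \<epsilon> n) * \<gamma> m * \<tau> m ^ n)"
proof -
  interpret steep_offspring "pmf \<xi>"
  proof unfold_locales
    show "0 \<le> pmf \<xi> k" for k by simp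
    show "0 < pmf \<xi> 0" "\<exists>k\<ge>2. 0 < pmf \<xi> k"
      by (rule pmf_mean_1_variance_pos[OF assms(1,2,4)])+
    show "pmf \<xi> sums 1" by (rule pmf_nat_sums_1)
    show "\<exists>r>y. summable (\<lambda>k. pmf \<xi> k * r ^ k)"
      if "0 \<le> y" "summable (\<lambda>k. diffs (pmf \<xi>) k * y ^ k)" for y
      by (rule pgf_steep[OF assms(6) that])
  qed
  \<comment> \<open>Naming the estimate allows the constants to be chosen for all m at once.\<close>
  define P where "P m \<gamma> C \<longleftrightarrow> (\<forall>\<^sub>F n in at_top. F_coeff 0 n > 0 \<longrightarrow>
    \<bar>F_coeff m n / F_coeff 0 n / (\<gamma> * (\<rho> 0 / \<rho> m) ^ n) - 1\<bar> \<le> C / real n)" for m \<gamma> C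
  have "\<exists>\<gamma>>0. \<exists>C. P m \<gamma> C" for m
    unfolding P_def by (rule F_coeff_ratio)
  then obtain \<gamma> C where \<gamma>: "\<And>m. \<gamma> m > 0" and C: "\<And>m. P m (\<gamma> m) (C m)" by metis
  define \<tau> where "\<tau> m = \<rho> 0 / \<rho> m" for m
  have \<rho>_dec: "\<rho> n < \<rho> m" if "m < n" for m n
  proof -
    have "- \<rho> m < - \<rho> n"
      by (rule lift_Suc_mono_less[of "\<lambda>m. - \<rho> m", OF _ that]) (use critical_and_decreasing in simp)
    then show ?thesis by simp
  qed
  have \<tau>_mono: "\<tau> m < \<tau> n" if "m < n" for m n
    unfolding \<tau>_def using \<rho>_dec[OF that] \<rho>_pos by (intro divide_strict_left_mono mult_pos_pos) auto
  have \<tau>_pos: "\<tau> m > 0" for m using \<rho>_pos by (simp add: \<tau>_def)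
  show ?thesis
  proof (rule exI[of _ \<gamma>], rule exI[of _ \<tau>], intro conjI allI impI)
    show "1 < \<tau> 1" using \<tau>_mono[of 0 1] \<rho>_pos[of 0] by (simp add: \<tau>_def)
    show "strict_mono_on {1..} \<tau>" using \<tau>_mono by (intro strict_mono_onI)
    show "\<gamma> m > 0" for m by (rule \<gamma>)
    fix m :: nat assume m: "m \<ge> 1"
    \<comment> \<open>The exact relative error: the identity then holds for every admissible n, and
      only the bound on it is asymptotic.\<close>
    define \<epsilon> where "\<epsilon> n = F_coeff m n / F_coeff 0 n / (\<gamma> m * \<tau> m ^ n) - 1" for n
    have "\<epsilon> \<in> O[inf at_top (principal (gw_orders \<xi>))](\<lambda>n. 1 / real n)"
    proof (rule bigoI[of _ "C m"])
      have "\<forall>\<^sub>F n in at_top. n \<in> gw_orders \<xi> \<longrightarrow> norm (\<epsilon> n) \<le> C m * norm (1 / real n)"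
        using C[of m] unfolding P_def by eventually_elim (simp add: gw_orders_eq \<epsilon>_def \<tau>_def)
      then show "\<forall>\<^sub>F n in inf at_top (principal (gw_orders \<xi>)). norm (\<epsilon> n) \<le> C m * norm (1 / real n)"
        by (simp add: eventually_inf_principal)
    qed
    moreover have "integral\<^sup>L (cond_gw_space \<xi> n) (\<lambda>\<omega>. real (num_root_subtrees (tree_of \<omega>)) ^ m)
        = (1 + \<epsilon> n) * \<gamma> m * \<tau> m ^ n" if "n \<in> gw_orders \<xi>" for n
      unfolding cond_gw_moment[OF m that] \<epsilon>_def using \<gamma>[of m] \<tau>_pos[of m] by simp
    ultimately show "\<exists>\<epsilon> \<in> O[inf at_top (principal (gw_orders \<xi>))](\<lambda>n. 1 / real n).
       \<forall>n \<in> gw_orders \<xi>.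
         integral\<^sup>L (cond_gw_space \<xi> n) (\<lambda>\<omega>. real (num_root_subtrees (tree_of \<omega>)) ^ m)
           = (1 + \<epsilon> n) * \<gamma> m * \<tau> m ^ n" by blast
  qed
qed

end
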